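(* Let $n\geq 2$. The Johnson morphism is an isomorphism of graded Lie rings \[\mathrm{Lie}\left(\mathcal A_*(RF_n)\right)\cong\mathrm{Der}(R\mathfrak L_n).\]
   Context: Notation: $[x,y]=xyx^{-1}y^{-1}$, $\Gamma_*$ is the lower central series. $RF_n=\langle x_1,\dots,x_n\mid [x_i,w^{-1}x_iw]=1\ (w\in F_n)\rangle$ is the reduced free group. $R\mathfrak L_n$ is the Lie ring generated by $y_1,\dots,y_n$ subject to $[y_{i_1},[y_{i_2},[\cdots[y_{i_{s-1}},y_{i_s}]\cdots]]]=0$ whenever two of the indices coincide; it is graded by length and identified with $\mathrm{Lie}(RF_n)=\bigoplus_k\Gamma_k/\Gamma_{k+1}$ via $\bar x_i\mapsto y_i$. $\mathrm{Der}(R\mathfrak L_n)=\bigoplus_{k\geq1}\mathrm{Der}_k(R\mathfrak L_n)$ denotes the Lie ring of derivations strictly raising the degree ($\mathrm{Der}_k$ = those raising degree by $k$). The Andreadakis filtration is $\mathcal A_j(RF_n)=\{\sigma\in\mathrm{Aut}(RF_n):\sigma(g)g^{-1}\in\Gamma_{i+j}(RF_n)\ \forall i\geq1,\forall g\in\Gamma_i(RF_n)\}$, and $\mathrm{Lie}(\mathcal A_*(RF_n))=\bigoplus_j\mathcal A_j/\mathcal A_{j+1}$ with bracket induced by commutators. The Johnson morphism sends the class of $\sigma\in\mathcal A_j$ to the degree-$j$ derivation of $R\mathfrak L_n$ induced by $x\mapsto\sigma(x)x^{-1}$. *)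

theory Defs
  imports "HOL-Algebra.Algebra"
begin

type_synonym letter = "nat \<times> bool"  (* (i, True) = x_i, (i, False) = x_i^{-1} *)

fun red_cons :: "letter \<Rightarrow> letter list \<Rightarrow> letter list" where
  "red_cons a [] = [a]"
| "red_cons a (b # bs) = (if fst a = fst b \<and> snd a \<noteq> snd b then bs else a # b # bs)"

fun reduce :: "letter list \<Rightarrow> letter list" where
  "reduce [] = []"
| "reduce (a # as) = red_cons a (reduce as)"

definition free_grp :: "nat \<Rightarrow> letter list monoid" where
  "free_grp n = \<lparr>carrier = {w. reduce w = w \<and> (\<forall>x\<in>set w. fst x < n)},
                 monoid.mult = (\<lambda>u v. reduce (u @ v)), one = []\<rparr>"

definition gen :: "nat \<Rightarrow> letter list" where
  "gen i = [(i, True)]"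

definition comm :: "('a, 'b) monoid_scheme \<Rightarrow> 'a \<Rightarrow> 'a \<Rightarrow> 'a" where
  "comm G x y = x \<otimes>\<^bsub>G\<^esub> y \<otimes>\<^bsub>G\<^esub> inv\<^bsub>G\<^esub> x \<otimes>\<^bsub>G\<^esub> inv\<^bsub>G\<^esub> y"

definition normal_closure :: "('a, 'b) monoid_scheme \<Rightarrow> 'a set \<Rightarrow> 'a set" where
  "normal_closure G S = generate G (\<Union>g\<in>carrier G. (\<lambda>s. g \<otimes>\<^bsub>G\<^esub> s \<otimes>\<^bsub>G\<^esub> inv\<^bsub>G\<^esub> g) ` S)"

definition rf_rel :: "nat \<Rightarrow> letter list set" where
  "rf_rel n = {comm (free_grp n) (gen i)
                 (inv\<^bsub>free_grp n\<^esub> w \<otimes>\<^bsub>free_grp n\<^esub> gen i \<otimes>\<^bsub>free_grp n\<^esub> w)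
               | i w. i < n \<and> w \<in> carrier (free_grp n)}"

definition RF :: "nat \<Rightarrow> letter list set monoid" where
  "RF n = free_grp n Mod normal_closure (free_grp n) (rf_rel n)"

text \<open>Lower central series, indexed from 1: Gamma_1 = G, Gamma_{k+1} = [G, Gamma_k].\<close>

fun lcs :: "('a, 'b) monoid_scheme \<Rightarrow> nat \<Rightarrow> 'a set" where
  "lcs G 0 = carrier G"
| "lcs G (Suc 0) = carrier G"
| "lcs G (Suc (Suc k)) =
     generate G {comm G x y | x y. x \<in> carrier G \<and> y \<in> lcs G (Suc k)}"

definition grQ :: "('a, 'b) monoid_scheme \<Rightarrow> nat \<Rightarrow> 'a set monoid" where
  "grQ G i = (G\<lparr>carrier := lcs G i\<rparr>) Mod lcs G (Suc i)"

definition lie_br :: "('a, 'b) monoid_scheme \<Rightarrow> nat \<Rightarrow> nat \<Rightarrow> 'a set \<Rightarrow> 'a set \<Rightarrow> 'a set" where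
  "lie_br G i l a b =
     r_coset G (lcs G (Suc (i + l))) (comm G (SOME x. x \<in> a) (SOME y. y \<in> b))"

definition der :: "('a, 'b) monoid_scheme \<Rightarrow> nat \<Rightarrow> (nat \<Rightarrow> 'a set \<Rightarrow> 'a set) set" where
  "der G k = {D. D 0 = (\<lambda>_. undefined) \<and>
      (\<forall>i\<ge>1. D i \<in> hom (grQ G i) (grQ G (i + k)) \<and> D i \<in> extensional (carrier (grQ G i))) \<and>
      (\<forall>i\<ge>1. \<forall>l\<ge>1. \<forall>a\<in>carrier (grQ G i). \<forall>b\<in>carrier (grQ G l).
          D (i + l) (lie_br G i l a b) =
            lie_br G (i + k) l (D i a) b \<otimes>\<^bsub>grQ G (i + l + k)\<^esub> lie_br G i (l + k) a (D l b))}"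

definition der_grp :: "('a, 'b) monoid_scheme \<Rightarrow> nat \<Rightarrow> (nat \<Rightarrow> 'a set \<Rightarrow> 'a set) monoid" where
  "der_grp G k = \<lparr>carrier = der G k,
     monoid.mult = (\<lambda>D E i. if i = 0 then (\<lambda>_. undefined)
               else (\<lambda>a\<in>carrier (grQ G i). D i a \<otimes>\<^bsub>grQ G (i + k)\<^esub> E i a)),
     one = (\<lambda>i. if i = 0 then (\<lambda>_. undefined)
               else (\<lambda>a\<in>carrier (grQ G i). \<one>\<^bsub>grQ G (i + k)\<^esub>))\<rparr>"

definition der_br :: "('a, 'b) monoid_scheme \<Rightarrow> nat \<Rightarrow> nat \<Rightarrow>
    (nat \<Rightarrow> 'a set \<Rightarrow> 'a set) \<Rightarrow> (nat \<Rightarrow> 'a set \<Rightarrow> 'a set) \<Rightarrow> (nat \<Rightarrow> 'a set \<Rightarrow> 'a set)" where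
  "der_br G j k D E i = (if i = 0 then (\<lambda>_. undefined)
      else (\<lambda>a\<in>carrier (grQ G i).
              D (i + k) (E i a) \<otimes>\<^bsub>grQ G (i + j + k)\<^esub> inv\<^bsub>grQ G (i + j + k)\<^esub> (E (i + j) (D i a))))"

definition andr :: "('a, 'b) monoid_scheme \<Rightarrow> nat \<Rightarrow> ('a \<Rightarrow> 'a) set" where
  "andr G j = {\<sigma> \<in> auto G. \<forall>i\<ge>1. \<forall>g\<in>lcs G i. \<sigma> g \<otimes>\<^bsub>G\<^esub> inv\<^bsub>G\<^esub> g \<in> lcs G (i + j)}"

definition AQ :: "('a, 'b) monoid_scheme \<Rightarrow> nat \<Rightarrow> ('a \<Rightarrow> 'a) set monoid" where
  "AQ G j = ((AutoGroup G)\<lparr>carrier := andr G j\<rparr>) Mod andr G (Suc j)"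

definition aut_br :: "('a, 'b) monoid_scheme \<Rightarrow> nat \<Rightarrow> nat \<Rightarrow> ('a \<Rightarrow> 'a) set \<Rightarrow> ('a \<Rightarrow> 'a) set \<Rightarrow> ('a \<Rightarrow> 'a) set" where
  "aut_br G j k c d =
     r_coset (AutoGroup G) (andr G (Suc (j + k)))
       (comm (AutoGroup G) (SOME s. s \<in> c) (SOME r. r \<in> d))"

definition johnson :: "('a, 'b) monoid_scheme \<Rightarrow> nat \<Rightarrow> ('a \<Rightarrow> 'a) set \<Rightarrow> (nat \<Rightarrow> 'a set \<Rightarrow> 'a set)" where
  "johnson G j c i = (if i = 0 then (\<lambda>_. undefined)
      else (\<lambda>a\<in>carrier (grQ G i).
        r_coset G (lcs G (Suc (i + j)))
          ((SOME s. s \<in> c) (SOME x. x \<in> a) \<otimes>\<^bsub>G\<^esub> inv\<^bsub>G\<^esub> (SOME x. x \<in> a))))"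

end

theory Submission
  imports Defs
begin

text \<open>
  For every group the Johnson morphism is well defined, injective and compatible with brackets;
  only surjectivity is special to \<open>G = RF n\<close>. Let a derivation of degree \<open>j\<close> be given and lift the
  images of the classes of the generators to \<open>g\<^sub>i \<in> \<Gamma>\<^sub>m\<close>, where \<open>m = j + 1\<close>. An endomorphism
  \<open>x\<^sub>i \<mapsto> g\<^sub>i x\<^sub>i\<close> is an automorphism because \<open>G\<close> is nilpotent: a commutator of weight \<open>m\<close> is trivial
  or lies in the normal closures of \<open>m\<close> distinct generators. The endomorphism exists as soon as each
  \<open>g\<^sub>i x\<^sub>i\<close> commutes with its conjugates. This is automatic if \<open>m \<ge> n - 1\<close>. Otherwise the lift
  \<open>g\<^sub>i\<close> can be chosen in the normal closure of \<open>x\<^sub>i\<close>, which is abelian: map \<open>G\<close> into the units of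
  the ring of non-commutative polynomials modulo monomials with a repeated letter by
  \<open>x\<^sub>i \<mapsto> 1 + X\<^sub>i\<close>. Applying the derivation to \<open>[x\<^sub>i, [x\<^sub>k, x\<^sub>i]] = 1\<close> shows that the leading term of
  \<open>g\<^sub>i\<close> has no monomial that avoids \<open>i\<close>. The leading term of an element of \<open>\<Gamma>\<^sub>m\<close> determines its class
  modulo \<open>\<Gamma>\<^sub>m\<^sub>+\<^sub>1\<close>: this quotient is spanned by the commutators \<open>[x\<^sub>a\<^sub>1, [x\<^sub>a\<^sub>2, \<dots>, x\<^sub>s]]\<close> with
  distinct letters and \<open>s\<close> maximal, and the monomials ending in their maximal letter separate
  these. Hence the image of \<open>g\<^sub>i\<close> under the retraction killing \<open>x\<^sub>i\<close> lies in \<open>\<Gamma>\<^sub>m\<^sub>+\<^sub>1\<close> and can be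
  divided out.
\<close>

section \<open>Commutators\<close>

declare mult_FactGroup [simp del] one_FactGroup [simp del]

context group
begin

lemma comm_closed [intro, simp]:
  "x \<in> carrier G \<Longrightarrow> y \<in> carrier G \<Longrightarrow> comm G x y \<in> carrier G"
  by (simp add: comm_def)

lemma mult_inv_cancel [simp]:
  assumes "x \<in> carrier G" "y \<in> carrier G"
  shows "x \<otimes> (inv x \<otimes> y) = y" "inv x \<otimes> (x \<otimes> y) = y"
  using assms by (simp_all add: m_assoc [symmetric])

lemma mult_eq_comm_mult:
  "x \<in> carrier G \<Longrightarrow> y \<in> carrier G \<Longrightarrow> x \<otimes> y = comm G x y \<otimes> (y \<otimes> x)"
  by (simp add: comm_def m_assoc)

lemma comm_eq_one_iff:
  assumes "x \<in> carrier G" "y \<in> carrier G"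
  shows "comm G x y = \<one> \<longleftrightarrow> x \<otimes> y = y \<otimes> x"
  using assms mult_eq_comm_mult[of x y] r_cancel_one[of "y \<otimes> x" "comm G x y"] by auto

lemma comm_one [simp]:
  "x \<in> carrier G \<Longrightarrow> comm G x \<one> = \<one>" "x \<in> carrier G \<Longrightarrow> comm G \<one> x = \<one>"
  by (simp_all add: comm_def)

lemma comm_self [simp]: "x \<in> carrier G \<Longrightarrow> comm G x x = \<one>"
  by (simp add: comm_eq_one_iff)

lemma inv_comm: "x \<in> carrier G \<Longrightarrow> y \<in> carrier G \<Longrightarrow> inv (comm G x y) = comm G y x"
  by (simp add: comm_def inv_mult_group m_assoc)

lemma conj_eq_comm_mult:
  "x \<in> carrier G \<Longrightarrow> y \<in> carrier G \<Longrightarrow> x \<otimes> y \<otimes> inv x = comm G x y \<otimes> y"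
  by (simp add: comm_def m_assoc)

lemma conj_comm:
  assumes "g \<in> carrier G" "x \<in> carrier G" "y \<in> carrier G"
  shows "g \<otimes> comm G x y \<otimes> inv g = comm G (g \<otimes> x \<otimes> inv g) (g \<otimes> y \<otimes> inv g)"
  using assms by (simp add: comm_def m_assoc inv_mult_group)

lemma comm_mult_left:
  assumes "x \<in> carrier G" "y \<in> carrier G" "z \<in> carrier G"
  shows "comm G (x \<otimes> y) z = x \<otimes> comm G y z \<otimes> inv x \<otimes> comm G x z"
  using assms by (simp add: comm_def m_assoc inv_mult_group)

lemma comm_mult_right:
  assumes "x \<in> carrier G" "y \<in> carrier G" "z \<in> carrier G"
  shows "comm G x (y \<otimes> z) = comm G x y \<otimes> (y \<otimes> comm G x z \<otimes> inv y)"
  using assms by (simp add: comm_def m_assoc inv_mult_group)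

lemma comm_inv_left:
  assumes "x \<in> carrier G" "y \<in> carrier G"
  shows "comm G (inv x) y = inv x \<otimes> inv (comm G x y) \<otimes> x"
  using assms by (simp add: comm_def m_assoc inv_mult_group)

lemma hall_witt:
  assumes "x \<in> carrier G" "y \<in> carrier G" "z \<in> carrier G"
  shows "comm G (comm G x y) (y \<otimes> z \<otimes> inv y) \<otimes> comm G (comm G y z) (z \<otimes> x \<otimes> inv z)
    \<otimes> comm G (comm G z x) (x \<otimes> y \<otimes> inv x) = \<one>"
  using assms by (simp add: comm_def m_assoc inv_mult_group)

lemma three_subgroups:
  assumes N: "subgroup N G" and closed: "x \<in> carrier G" "y \<in> carrier G" "z \<in> carrier G"
    and "comm G (z \<otimes> x \<otimes> inv z) (comm G y z) \<in> N" "comm G (x \<otimes> y \<otimes> inv x) (comm G z x) \<in> N"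
  shows "comm G (comm G x y) (y \<otimes> z \<otimes> inv y) \<in> N"
proof -
  have "comm G (comm G x y) (y \<otimes> z \<otimes> inv y) =
      inv (comm G (comm G y z) (z \<otimes> x \<otimes> inv z) \<otimes> comm G (comm G z x) (x \<otimes> y \<otimes> inv x))"
    using hall_witt[OF closed] closed by (intro inv_equality[symmetric]) (simp_all add: m_assoc)
  also have "\<dots> = comm G (x \<otimes> y \<otimes> inv x) (comm G z x) \<otimes> comm G (z \<otimes> x \<otimes> inv z) (comm G y z)"
    using closed by (simp add: inv_mult_group inv_comm)
  finally show ?thesis using assms(5,6) subgroup.m_closed[OF N] by simp
qed

lemma hom_comm:
  assumes "group H" "h \<in> hom G H" "x \<in> carrier G" "y \<in> carrier G"
  shows "h (comm G x y) = comm H (h x) (h y)"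
proof -
  interpret group_hom G H h using assms(1,2) by (simp add: group_hom_def group_hom_axioms_def)
  show ?thesis using assms(3,4) by (simp add: comm_def)
qed

lemma rcos_eq_iff:
  assumes "subgroup N G" "x \<in> carrier G" "y \<in> carrier G"
  shows "N #> x = N #> y \<longleftrightarrow> x \<otimes> inv y \<in> N"
  using assms by (metis is_group rcos_self repr_independence subgroup.rcos_module)

lemma subgroup_comm_mem:
  assumes "N \<lhd> G" "y \<in> carrier G"
  shows "subgroup {x \<in> carrier G. comm G x y \<in> N} G"
proof -
  interpret normal N G by fact
  show ?thesis
  proof (rule subgroupI)
    fix x z assume "x \<in> {x \<in> carrier G. comm G x y \<in> N}" "z \<in> {x \<in> carrier G. comm G x y \<in> N}"
    then show "x \<otimes> z \<in> {x \<in> carrier G. comm G x y \<in> N}"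
      using assms(2) by (simp add: comm_mult_left inv_op_closed2)
  next
    fix x assume "x \<in> {x \<in> carrier G. comm G x y \<in> N}"
    then show "inv x \<in> {x \<in> carrier G. comm G x y \<in> N}"
      using assms(2) m_inv_closed by (simp add: comm_inv_left inv_op_closed1)
  qed (use assms(2) in auto)
qed

lemma comm_mem_commute:
  assumes "subgroup N G" "x \<in> carrier G" "y \<in> carrier G"
  shows "comm G x y \<in> N \<longleftrightarrow> comm G y x \<in> N"
  using assms by (metis inv_comm subgroup.m_inv_closed)

lemma comm_mult_left_mem:
  assumes "N \<lhd> G" "x \<in> carrier G" "y \<in> carrier G" "z \<in> carrier G"
    and "comm G x z \<in> N" "comm G y z \<in> N"
  shows "comm G (x \<otimes> y) z \<in> N"
  using subgroup.m_closed[OF subgroup_comm_mem[OF assms(1,4)]] assms by simp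

lemma comm_mult_right_mem:
  assumes "N \<lhd> G" "x \<in> carrier G" "y \<in> carrier G" "z \<in> carrier G"
    and "comm G x y \<in> N" "comm G x z \<in> N"
  shows "comm G x (y \<otimes> z) \<in> N"
  using assms comm_mult_left_mem[of N y z x] comm_mem_commute[OF normal_imp_subgroup] by simp

lemma comm_generate_mem:
  assumes N: "N \<lhd> G" and A: "A \<subseteq> carrier G" and B: "B \<subseteq> carrier G"
    and comm: "\<And>a b. a \<in> A \<Longrightarrow> b \<in> B \<Longrightarrow> comm G a b \<in> N"
    and x: "x \<in> generate G A" and y: "y \<in> generate G B"
  shows "comm G x y \<in> N"
proof -
  have closed: "x \<in> carrier G" "y \<in> carrier G"
    using x y A B generate_in_carrier by auto
  note commute = comm_mem_commute[OF normal_imp_subgroup[OF N]]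
  have "comm G b x \<in> N" if b: "b \<in> B" for b
  proof -
    have "generate G A \<subseteq> {a \<in> carrier G. comm G a b \<in> N}"
      by (rule generate_subgroup_incl[OF _ subgroup_comm_mem[OF N]]) (use A B comm b in auto)
    then show ?thesis using x b B commute closed(1) by auto
  qed
  then have "generate G B \<subseteq> {b \<in> carrier G. comm G b x \<in> N}"
    by (intro generate_subgroup_incl[OF _ subgroup_comm_mem[OF N closed(1)]]) (use B in auto)
  then show ?thesis using y commute closed by auto
qed

lemma comm_normal_left:
  assumes "N \<lhd> G" "x \<in> N" "y \<in> carrier G"
  shows "comm G x y \<in> N"
proof -
  interpret normal N G by fact
  have "comm G x y = x \<otimes> (y \<otimes> inv x \<otimes> inv y)"
    using assms by (simp add: comm_def m_assoc)
  then show ?thesis using assms by (simp add: inv_op_closed2)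
qed

lemma comm_normal_right:
  assumes "N \<lhd> G" "x \<in> carrier G" "y \<in> N"
  shows "comm G x y \<in> N"
proof -
  interpret normal N G by fact
  show ?thesis
    using comm_normal_left[OF assms(1,3,2)] comm_mem_commute[OF subgroup_axioms, of x y] assms
    by simp
qed

lemma hom_eq_on_generate:
  assumes "group H" and f: "f \<in> hom (G\<lparr>carrier := K\<rparr>) H" and h: "h \<in> hom (G\<lparr>carrier := K\<rparr>) H"
    and K: "subgroup K G" and S: "S \<subseteq> K" and eq: "\<And>s. s \<in> S \<Longrightarrow> f s = h s"
    and g: "g \<in> generate G S"
  shows "f g = h g"
proof -
  interpret K: group "G\<lparr>carrier := K\<rparr>" by (rule subgroup_imp_group[OF K])
  interpret f: group_hom "G\<lparr>carrier := K\<rparr>" H f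
    using assms by (simp add: group_hom_def group_hom_axioms_def K.is_group)
  interpret h: group_hom "G\<lparr>carrier := K\<rparr>" H h
    using assms by (simp add: group_hom_def group_hom_axioms_def K.is_group)
  have "subgroup {k \<in> K. f k = h k} (G\<lparr>carrier := K\<rparr>)"
  proof (rule K.subgroupI)
    have "\<one> \<in> {k \<in> K. f k = h k}"
      using subgroup.one_closed[OF K] f.hom_one h.hom_one by simp
    then show "{k \<in> K. f k = h k} \<noteq> {}" by blast
  next
    fix k assume "k \<in> {k \<in> K. f k = h k}"
    then show "inv\<^bsub>G\<lparr>carrier := K\<rparr>\<^esub> k \<in> {k \<in> K. f k = h k}"
      using K.inv_closed[of k] f.hom_inv[of k] h.hom_inv[of k] by (simp del: K.inv_closed)
  next
    fix k l assume "k \<in> {k \<in> K. f k = h k}" "l \<in> {k \<in> K. f k = h k}"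
    then show "k \<otimes>\<^bsub>G\<lparr>carrier := K\<rparr>\<^esub> l \<in> {k \<in> K. f k = h k}"
      using K.m_closed[of k l] f.hom_mult[of k l] h.hom_mult[of k l] by (simp del: K.m_closed)
  qed simp
  then have "generate (G\<lparr>carrier := K\<rparr>) S \<subseteq> {k \<in> K. f k = h k}"
    by (intro K.generate_subgroup_incl) (use S eq in auto)
  then show ?thesis using g generate_consistent[OF S K] by auto
qed

end

definition commutes_with_conjugates :: "('a, 'b) monoid_scheme \<Rightarrow> 'a \<Rightarrow> bool" where
  "commutes_with_conjugates G x \<longleftrightarrow>
    (\<forall>g\<in>carrier G. comm G x (g \<otimes>\<^bsub>G\<^esub> x \<otimes>\<^bsub>G\<^esub> inv\<^bsub>G\<^esub> g) = \<one>\<^bsub>G\<^esub>)"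

context group
begin

lemma normal_closure_normal:
  assumes "S \<subseteq> carrier G"
  shows "normal_closure G S \<lhd> G"
  unfolding normal_closure_def
proof (rule normal_generateI)
  show "(\<Union>g\<in>carrier G. (\<lambda>s. g \<otimes> s \<otimes> inv g) ` S) \<subseteq> carrier G"
    using assms by auto
next
  fix h g assume "h \<in> (\<Union>g\<in>carrier G. (\<lambda>s. g \<otimes> s \<otimes> inv g) ` S)" and g: "g \<in> carrier G"
  then obtain k s where k: "k \<in> carrier G" "s \<in> S" "h = k \<otimes> s \<otimes> inv k" by auto
  then have "g \<otimes> h \<otimes> inv g = (g \<otimes> k) \<otimes> s \<otimes> inv (g \<otimes> k)"
    using g subsetD[OF assms, of s] by (simp add: m_assoc inv_mult_group)
  then show "g \<otimes> h \<otimes> inv g \<in> (\<Union>g\<in>carrier G. (\<lambda>s. g \<otimes> s \<otimes> inv g) ` S)"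
    using g k by (intro UN_I[of "g \<otimes> k"]) auto
qed

lemma normal_closure_incl: "S \<subseteq> carrier G \<Longrightarrow> S \<subseteq> normal_closure G S"
  unfolding normal_closure_def by (rule subsetI, rule generate.incl, rule UN_I[of \<one>]) force+

lemma normal_closure_minimal:
  assumes "N \<lhd> G" "S \<subseteq> N"
  shows "normal_closure G S \<subseteq> N"
  unfolding normal_closure_def
proof (rule generate_subgroup_incl[OF _ normal_imp_subgroup[OF assms(1)]])
  show "(\<Union>g\<in>carrier G. (\<lambda>s. g \<otimes> s \<otimes> inv g) ` S) \<subseteq> N"
    using normal.inv_op_closed2[OF assms(1)] assms(2) by auto
qed

lemma normal_closure_commutes:
  assumes x: "x \<in> carrier G" "commutes_with_conjugates G x"
    and "a \<in> normal_closure G {x}" "b \<in> normal_closure G {x}"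
  shows "comm G a b = \<one>"
proof -
  define S where "S = (\<Union>g\<in>carrier G. (\<lambda>s. g \<otimes> s \<otimes> inv g) ` {x})"
  have "S \<subseteq> carrier G" using x by (auto simp: S_def)
  moreover have "comm G s t \<in> {\<one>}" if st: "s \<in> S" "t \<in> S" for s t
  proof -
    obtain g h where g: "g \<in> carrier G" "s = g \<otimes> x \<otimes> inv g"
      and h: "h \<in> carrier G" "t = h \<otimes> x \<otimes> inv h"
      using st by (auto simp: S_def)
    define k where "k = inv g \<otimes> h"
    have k: "k \<in> carrier G" "h = g \<otimes> k" using g h by (simp_all add: k_def)
    have "t = g \<otimes> (k \<otimes> x \<otimes> inv k) \<otimes> inv g"
      using g h k x by (simp add: m_assoc inv_mult_group)
    then have "comm G s t = g \<otimes> comm G x (k \<otimes> x \<otimes> inv k) \<otimes> inv g"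
      using g k x conj_comm by simp
    then show ?thesis using x k g by (simp add: commutes_with_conjugates_def)
  qed
  moreover have "a \<in> generate G S" "b \<in> generate G S"
    using assms(3,4) by (simp_all add: S_def normal_closure_def)
  ultimately have "comm G a b \<in> {\<one>}"
    using comm_generate_mem[OF one_is_normal, of S S a b] by blast
  then show ?thesis by simp
qed

end

section \<open>The lower central series\<close>

context group
begin

lemma lcs_Suc:
  "1 \<le> k \<Longrightarrow> lcs G (Suc k) = generate G {comm G x y | x y. x \<in> carrier G \<and> y \<in> lcs G k}"
  by (cases k) auto

declare lcs.simps(3) [simp del]

lemma lcs_normal: "lcs G k \<lhd> G"
proof (cases "k = 0")
  case False
  then have "1 \<le> k" by simp
  then show ?thesis
  proof (induction k rule: nat_induct_at_least)
    case base
    show ?case by (simp add: normal_self)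
  next
    case (Suc k)
    then interpret normal "lcs G k" G by simp
    let ?S = "{comm G x y | x y. x \<in> carrier G \<and> y \<in> lcs G k}"
    have "generate G ?S \<lhd> G"
    proof (rule normal_generateI)
      fix h g assume "h \<in> ?S" and g: "g \<in> carrier G"
      then obtain x y where h: "h = comm G x y" "x \<in> carrier G" "y \<in> lcs G k" by auto
      then have "g \<otimes> h \<otimes> inv g = comm G (g \<otimes> x \<otimes> inv g) (g \<otimes> y \<otimes> inv g)"
        using g by (simp add: conj_comm)
      moreover have "g \<otimes> y \<otimes> inv g \<in> lcs G k" using g h by (simp add: inv_op_closed2)
      ultimately show "g \<otimes> h \<otimes> inv g \<in> ?S" using g h by blast
    qed auto
    then show ?case using lcs_Suc[OF Suc.hyps] by simp
  qed
qed (simp add: normal_self)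

lemma lcs_subgroup: "subgroup (lcs G k) G"
  by (simp add: lcs_normal normal_imp_subgroup)

lemma lcs_carrier [dest]: "x \<in> lcs G k \<Longrightarrow> x \<in> carrier G"
  using lcs_subgroup subgroup.subset by blast

lemma lcs_closed [intro, simp]:
  "\<one> \<in> lcs G k"
  "x \<in> lcs G k \<Longrightarrow> y \<in> lcs G k \<Longrightarrow> x \<otimes> y \<in> lcs G k"
  "x \<in> lcs G k \<Longrightarrow> inv x \<in> lcs G k"
  using lcs_subgroup subgroup.one_closed subgroup.m_closed subgroup.m_inv_closed by metis+

lemma lcs_one [simp]: "lcs G 1 = carrier G"
  by simp

lemma lcs_conj_closed: "g \<in> carrier G \<Longrightarrow> x \<in> lcs G k \<Longrightarrow> g \<otimes> x \<otimes> inv g \<in> lcs G k"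
  by (rule normal.inv_op_closed2[OF lcs_normal])

lemma comm_lcs_Suc:
  "1 \<le> k \<Longrightarrow> x \<in> carrier G \<Longrightarrow> y \<in> lcs G k \<Longrightarrow> comm G x y \<in> lcs G (Suc k)"
  by (subst lcs_Suc) (auto intro!: generate.incl)

lemma lcs_Suc_minimal:
  assumes "1 \<le> k" "subgroup H G"
    and "\<And>x y. x \<in> carrier G \<Longrightarrow> y \<in> lcs G k \<Longrightarrow> comm G x y \<in> H"
  shows "lcs G (Suc k) \<subseteq> H"
  unfolding lcs_Suc[OF assms(1)]
  by (rule generate_subgroup_incl[OF _ assms(2)]) (auto intro: assms(3))

lemma lcs_Suc_subset: "lcs G (Suc k) \<subseteq> lcs G k"
proof (cases "k = 0")
  case False
  then show ?thesis
    by (intro lcs_Suc_minimal lcs_subgroup comm_normal_right[OF lcs_normal]) auto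
qed simp

lemma lcs_antimono: "i \<le> j \<Longrightarrow> x \<in> lcs G j \<Longrightarrow> x \<in> lcs G i"
  by (rule subsetD[OF lift_Suc_antimono_le[of "lcs G", OF lcs_Suc_subset]])

lemma comm_lcs:
  assumes "1 \<le> i" "1 \<le> j" "x \<in> lcs G i" "y \<in> lcs G j"
  shows "comm G x y \<in> lcs G (i + j)"
  using assms
proof (induction i arbitrary: j x y rule: nat_induct_at_least)
  case base
  then show ?case using comm_lcs_Suc[of j x y] by simp
next
  case (Suc i)
  let ?N = "lcs G (Suc i + j)"
  have generators: "comm G (comm G a b) w \<in> ?N"
    if a: "a \<in> carrier G" and b: "b \<in> lcs G i" and w: "w \<in> lcs G j" for a b w
  proof -
    define z where "z = inv b \<otimes> w \<otimes> b"
    have z: "z \<in> lcs G j"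
      unfolding z_def using lcs_conj_closed[of "inv b" w j] b w by (auto dest: lcs_carrier)
    have closed: "b \<in> carrier G" "w \<in> carrier G" "z \<in> carrier G" using b w z by auto
    have "comm G (z \<otimes> a \<otimes> inv z) (comm G b z) \<in> ?N"
      using comm_lcs_Suc Suc.IH[OF Suc.prems(1) b z] a closed Suc.hyps by auto
    moreover have "comm G z a \<in> lcs G (Suc j)"
      using comm_lcs_Suc[OF Suc.prems(1) a z] comm_mem_commute[OF lcs_subgroup a closed(3)] by simp
    then have "comm G (a \<otimes> b \<otimes> inv a) (comm G z a) \<in> ?N"
      using Suc.IH[of "Suc j"] lcs_conj_closed[OF a b] by simp
    ultimately have "comm G (comm G a b) (b \<otimes> z \<otimes> inv b) \<in> ?N"
      by (intro three_subgroups lcs_subgroup a closed)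
    moreover have "b \<otimes> z \<otimes> inv b = w" using closed by (simp add: z_def m_assoc)
    ultimately show ?thesis by simp
  qed
  show ?case
  proof (rule comm_generate_mem[OF lcs_normal])
    show "x \<in> generate G {comm G a b | a b. a \<in> carrier G \<and> b \<in> lcs G i}"
      using Suc.prems(2) lcs_Suc[OF Suc.hyps] by simp
    show "y \<in> generate G (lcs G j)"
      using Suc.prems(3) by (rule generate.incl)
  qed (use generators in auto)
qed

lemma comm_lcs_le:
  assumes "x \<in> lcs G i" "y \<in> lcs G j" "1 \<le> i" "1 \<le> j" "m \<le> i + j"
  shows "comm G x y \<in> lcs G m"
  using lcs_antimono[OF assms(5) comm_lcs] assms by simp

lemma normal_between_lcs:
  assumes "subgroup H G" "1 \<le> k" "lcs G (Suc k) \<subseteq> H" "H \<subseteq> lcs G k"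
  shows "H \<lhd> G"
proof -
  interpret H: subgroup H G by fact
  have "g \<otimes> h \<otimes> inv g \<in> H" if "g \<in> carrier G" "h \<in> H" for g h
    using comm_lcs_Suc[OF assms(2) that(1), of h] assms(3,4) that conj_eq_comm_mult[of g h] by auto
  then show ?thesis by (intro normal_invI[OF assms(1)])
qed

lemma hom_lcs:
  assumes "group H" "h \<in> hom G H" "x \<in> lcs G i"
  shows "h x \<in> lcs H i"
proof -
  interpret H: group H by fact
  interpret h: group_hom G H h by unfold_locales fact
  have "h ` lcs G i \<subseteq> lcs H i" if "1 \<le> i"
    using that
  proof (induction i rule: nat_induct_at_least)
    case base
    show ?case by auto
  next
    case (Suc i)
    let ?S = "{comm G x y | x y. x \<in> carrier G \<and> y \<in> lcs G i}"
    have "h (comm G x y) \<in> lcs H (Suc i)" if "x \<in> carrier G" "y \<in> lcs G i" for x y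
      using that Suc hom_comm[OF H.is_group assms(2), of x y] H.comm_lcs_Suc[of i "h x" "h y"]
      by (auto simp: image_subset_iff)
    then have "generate H (h ` ?S) \<subseteq> lcs H (Suc i)"
      by (intro H.generate_subgroup_incl H.lcs_subgroup) auto
    moreover have "h ` generate G ?S = generate H (h ` ?S)"
      by (rule h.generate_img[symmetric]) auto
    ultimately show ?case using lcs_Suc[OF Suc.hyps] by simp
  qed
  then show ?thesis using assms(3) by (cases "i = 0") auto
qed

end

section \<open>The graded Lie ring of a group\<close>

definition lcs_class :: "('a, 'b) monoid_scheme \<Rightarrow> nat \<Rightarrow> 'a \<Rightarrow> 'a set" where
  "lcs_class G i x = r_coset G (lcs G (Suc i)) x"

definition displacement :: "('a, 'b) monoid_scheme \<Rightarrow> ('a \<Rightarrow> 'a) \<Rightarrow> 'a \<Rightarrow> 'a" where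
  "displacement G h x = h x \<otimes>\<^bsub>G\<^esub> inv\<^bsub>G\<^esub> x"

context group
begin

lemma subquotient_carrier: "carrier ((G\<lparr>carrier := P\<rparr>) Mod N) = (\<lambda>x. N #> x) ` P"
  by (simp add: carrier_FactGroup r_coset_def)

lemma subquotient_mult:
  assumes "N \<lhd> G" "x \<in> carrier G" "y \<in> carrier G"
  shows "(N #> x) \<otimes>\<^bsub>(G\<lparr>carrier := P\<rparr>) Mod N\<^esub> (N #> y) = N #> (x \<otimes> y)"
  using normal.rcos_sum[OF assms] by (simp add: mult_FactGroup set_mult_def)

lemma subquotient_group:
  assumes "N \<lhd> G" "subgroup P G" "N \<subseteq> P"
  shows "group ((G\<lparr>carrier := P\<rparr>) Mod N)"
  by (rule normal.factorgroup_is_group[OF normal_restrict_supergroup[OF assms(2,1,3)]])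

lemma some_mem_rcos:
  assumes "subgroup N G" "x \<in> carrier G"
  obtains a where "a \<in> N" "(SOME y. y \<in> N #> x) = a \<otimes> x"
proof -
  have "(SOME y. y \<in> N #> x) \<in> N #> x"
    using rcos_self[OF assms(2,1)] by (rule someI)
  then show ?thesis using that by (auto simp: r_coset_def)
qed

lemma carrier_grQ: "carrier (grQ G i) = lcs_class G i ` lcs G i"
  unfolding grQ_def lcs_class_def by (rule subquotient_carrier)

lemma lcs_class_closed [intro, simp]: "x \<in> lcs G i \<Longrightarrow> lcs_class G i x \<in> carrier (grQ G i)"
  by (simp add: carrier_grQ)

lemma grQ_group: "group (grQ G i)"
  unfolding grQ_def by (rule subquotient_group[OF lcs_normal lcs_subgroup lcs_Suc_subset])

lemma lcs_class_mult:
  "x \<in> carrier G \<Longrightarrow> y \<in> carrier G \<Longrightarrow>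
    lcs_class G i (x \<otimes> y) = lcs_class G i x \<otimes>\<^bsub>grQ G i\<^esub> lcs_class G i y"
  unfolding grQ_def lcs_class_def by (rule subquotient_mult[OF lcs_normal, symmetric])

lemma lcs_class_one: "lcs_class G i \<one> = \<one>\<^bsub>grQ G i\<^esub>"
  unfolding grQ_def lcs_class_def
  by (simp add: one_FactGroup coset_mult_one lcs_subgroup subgroup.subset)

lemma lcs_class_hom: "lcs_class G i \<in> hom (G\<lparr>carrier := lcs G i\<rparr>) (grQ G i)"
  by (rule homI) (auto simp: lcs_class_mult lcs_carrier)

lemma lcs_class_inv:
  assumes "x \<in> lcs G i"
  shows "lcs_class G i (inv x) = inv\<^bsub>grQ G i\<^esub> lcs_class G i x"
proof -
  interpret class_hom: group_hom "G\<lparr>carrier := lcs G i\<rparr>" "grQ G i" "lcs_class G i"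
    by (intro group_hom.intro group_hom_axioms.intro subgroup_imp_group lcs_subgroup grQ_group
      lcs_class_hom)
  show ?thesis
    using class_hom.hom_inv[of x] m_inv_consistent[OF lcs_subgroup assms] assms by simp
qed

lemma lcs_class_eq_iff:
  "x \<in> carrier G \<Longrightarrow> y \<in> carrier G \<Longrightarrow>
    lcs_class G i x = lcs_class G i y \<longleftrightarrow> x \<otimes> inv y \<in> lcs G (Suc i)"
  unfolding lcs_class_def by (rule rcos_eq_iff[OF lcs_subgroup])

lemma lcs_class_eq_one_iff:
  "x \<in> carrier G \<Longrightarrow> lcs_class G i x = \<one>\<^bsub>grQ G i\<^esub> \<longleftrightarrow> x \<in> lcs G (Suc i)"
  by (simp add: lcs_class_eq_iff flip: lcs_class_one)

lemma mem_if_lcs_class_eq: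
  assumes L: "subgroup L G" "lcs G (Suc m) \<subseteq> L" and y: "y \<in> L" and x: "x \<in> carrier G"
    and eq: "lcs_class G m x = lcs_class G m y"
  shows "x \<in> L"
proof -
  interpret L: subgroup L G by (rule L(1))
  have "x \<otimes> inv y \<in> L" using eq x y L(2) by (auto simp: lcs_class_eq_iff)
  then have "x \<otimes> inv y \<otimes> y \<in> L" using y by (rule L.m_closed)
  then show ?thesis using x y by (simp add: m_assoc)
qed

lemma lcs_class_mult_left:
  "a \<in> lcs G (Suc i) \<Longrightarrow> x \<in> carrier G \<Longrightarrow> lcs_class G i (a \<otimes> x) = lcs_class G i x"
  by (simp add: lcs_class_eq_iff m_assoc lcs_carrier)

lemma lcs_class_mult_right:
  "a \<in> lcs G (Suc i) \<Longrightarrow> x \<in> carrier G \<Longrightarrow> lcs_class G i (x \<otimes> a) = lcs_class G i x"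
  using lcs_conj_closed[of x a "Suc i"] by (simp add: lcs_class_eq_iff lcs_carrier)

lemma lcs_class_mult_cong:
  assumes "x \<in> carrier G" "y \<in> carrier G" "x' \<in> carrier G" "y' \<in> carrier G"
    and "lcs_class G i x = lcs_class G i x'" "lcs_class G i y = lcs_class G i y'"
  shows "lcs_class G i (x \<otimes> y) = lcs_class G i (x' \<otimes> y')"
  using assms by (simp add: lcs_class_mult)

lemma lcs_class_commute:
  assumes "x \<in> lcs G i" "y \<in> lcs G j" "1 \<le> i" "1 \<le> j" "m < i + j"
  shows "lcs_class G m (x \<otimes> y) = lcs_class G m (y \<otimes> x)"
proof -
  have "comm G x y \<in> lcs G (Suc m)" using comm_lcs_le assms by simp
  then show ?thesis
    using lcs_class_mult_left[of "comm G x y" m "y \<otimes> x"] mult_eq_comm_mult[of x y] assms(1,2)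
    by (simp add: lcs_carrier)
qed

lemma lcs_class_conj:
  assumes "x \<in> lcs G i" "y \<in> lcs G j" "1 \<le> i" "1 \<le> j" "m < i + j"
  shows "lcs_class G m (x \<otimes> y \<otimes> inv x) = lcs_class G m y"
proof -
  have "comm G x y \<in> lcs G (Suc m)" using comm_lcs_le assms by simp
  then show ?thesis
    using lcs_class_mult_left[of "comm G x y" m y] conj_eq_comm_mult[of x y] assms(1,2)
    by (simp add: lcs_carrier)
qed

lemma grQ_comm_group:
  assumes "1 \<le> i"
  shows "comm_group (grQ G i)"
proof (rule group.group_comm_groupI[OF grQ_group])
  fix a b assume "a \<in> carrier (grQ G i)" "b \<in> carrier (grQ G i)"
  then obtain x y where "x \<in> lcs G i" "a = lcs_class G i x" "y \<in> lcs G i" "b = lcs_class G i y"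
    by (auto simp: carrier_grQ)
  then show "a \<otimes>\<^bsub>grQ G i\<^esub> b = b \<otimes>\<^bsub>grQ G i\<^esub> a"
    using lcs_class_commute[of x i y i i] assms by (simp add: lcs_class_mult[symmetric] lcs_carrier)
qed

lemma lcs_class_comm_mult_left:
  assumes "a \<in> lcs G p" "x \<in> lcs G i" "y \<in> lcs G l" "1 \<le> p" "1 \<le> i" "1 \<le> l" "m < p + i + l"
  shows "lcs_class G m (comm G (a \<otimes> x) y) = lcs_class G m (comm G x y \<otimes> comm G a y)"
proof -
  have closed: "a \<in> carrier G" "x \<in> carrier G" "y \<in> carrier G" using assms by auto
  have "lcs_class G m (a \<otimes> comm G x y \<otimes> inv a) = lcs_class G m (comm G x y)"
    by (rule lcs_class_conj[OF assms(1) comm_lcs[OF assms(5,6,2,3)]]) (use assms in auto)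
  then show ?thesis
    using closed by (simp add: comm_mult_left lcs_class_mult_cong)
qed

lemma lcs_class_comm_mult_right:
  assumes "x \<in> lcs G i" "b \<in> lcs G p" "y \<in> lcs G l" "1 \<le> i" "1 \<le> p" "1 \<le> l" "m < i + p + l"
  shows "lcs_class G m (comm G x (b \<otimes> y)) = lcs_class G m (comm G x b \<otimes> comm G x y)"
proof -
  have closed: "b \<in> carrier G" "x \<in> carrier G" "y \<in> carrier G" using assms by auto
  have "lcs_class G m (b \<otimes> comm G x y \<otimes> inv b) = lcs_class G m (comm G x y)"
    by (rule lcs_class_conj[OF assms(2) comm_lcs[OF assms(4,6,1,3)]]) (use assms in auto)
  then show ?thesis
    using closed by (simp add: comm_mult_right lcs_class_mult_cong)
qed

lemma lcs_class_comm_cong: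
  assumes i: "1 \<le> i" and l: "1 \<le> l" and x: "x \<in> lcs G i" and y: "y \<in> lcs G l"
    and a: "a \<in> lcs G (Suc i)" and b: "b \<in> lcs G (Suc l)"
  shows "lcs_class G (i + l) (comm G (a \<otimes> x) (b \<otimes> y)) = lcs_class G (i + l) (comm G x y)"
proof -
  have b_y: "b \<otimes> y \<in> lcs G l" using lcs_antimono[OF _ b] y by simp
  have "comm G a (b \<otimes> y) \<in> lcs G (Suc (i + l))" "comm G x b \<in> lcs G (Suc (i + l))"
    using comm_lcs_le[OF a b_y] comm_lcs_le[OF x b] i l by simp_all
  moreover have "lcs_class G (i + l) (comm G (a \<otimes> x) (b \<otimes> y)) =
      lcs_class G (i + l) (comm G x (b \<otimes> y) \<otimes> comm G a (b \<otimes> y))"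
    by (rule lcs_class_comm_mult_left[OF a x b_y]) (use i l in auto)
  moreover have "lcs_class G (i + l) (comm G x (b \<otimes> y)) =
      lcs_class G (i + l) (comm G x b \<otimes> comm G x y)"
    by (rule lcs_class_comm_mult_right[OF x b y]) (use i l in auto)
  ultimately show ?thesis
    using a b x y by (simp add: lcs_class_mult_left lcs_class_mult_right lcs_carrier)
qed

lemma some_mem_lcs_class:
  assumes "x \<in> lcs G i"
  obtains a where "a \<in> lcs G (Suc i)" "(SOME y. y \<in> lcs_class G i x) = a \<otimes> x"
  unfolding lcs_class_def using some_mem_rcos[OF lcs_subgroup lcs_carrier[OF assms]] .

lemma lie_br_lcs_class:
  assumes "1 \<le> i" "1 \<le> l" "x \<in> lcs G i" "y \<in> lcs G l"
  shows "lie_br G i l (lcs_class G i x) (lcs_class G l y) = lcs_class G (i + l) (comm G x y)"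
proof -
  obtain a where a: "a \<in> lcs G (Suc i)" "(SOME y. y \<in> lcs_class G i x) = a \<otimes> x"
    using some_mem_lcs_class assms by blast
  obtain b where b: "b \<in> lcs G (Suc l)" "(SOME z. z \<in> lcs_class G l y) = b \<otimes> y"
    using some_mem_lcs_class assms by blast
  show ?thesis
    unfolding lie_br_def a(2) b(2) lcs_class_def[symmetric]
    by (rule lcs_class_comm_cong[OF assms a(1) b(1)])
qed

lemma displacement_closed [intro, simp]:
  "h \<in> hom G G \<Longrightarrow> x \<in> carrier G \<Longrightarrow> displacement G h x \<in> carrier G"
  by (auto simp: displacement_def hom_def)

lemma displacement_mult_self [simp]:
  "h \<in> hom G G \<Longrightarrow> x \<in> carrier G \<Longrightarrow> displacement G h x \<otimes> x = h x"
  by (simp add: displacement_def hom_in_carrier m_assoc)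

lemma displacement_mult:
  assumes h: "h \<in> hom G G" and "x \<in> carrier G" "y \<in> carrier G"
  shows "displacement G h (x \<otimes> y) = displacement G h x \<otimes> (x \<otimes> displacement G h y \<otimes> inv x)"
proof -
  interpret h: group_hom G G h by unfold_locales fact
  show ?thesis using assms(2,3) by (simp add: displacement_def m_assoc inv_mult_group)
qed

lemma lcs_class_comm_mult:
  assumes i: "1 \<le> i" and l: "1 \<le> l" and j: "1 \<le> j" and x: "x \<in> lcs G i" and y: "y \<in> lcs G l"
    and u: "u \<in> lcs G (i + j)" and v: "v \<in> lcs G (l + j)"
  shows "lcs_class G (i + l + j) (comm G (u \<otimes> x) (v \<otimes> y)) =
    lcs_class G (i + l + j) (comm G u y \<otimes> comm G x v \<otimes> comm G x y)"
proof -
  let ?m = "i + l + j"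
  have closed: "x \<in> carrier G" "y \<in> carrier G" "u \<in> carrier G" "v \<in> carrier G"
    using x y u v by auto
  have v_y: "v \<otimes> y \<in> lcs G l" using lcs_antimono[OF _ v, of l] y by simp
  have "lcs_class G ?m (comm G (u \<otimes> x) (v \<otimes> y)) =
      lcs_class G ?m (comm G x (v \<otimes> y) \<otimes> comm G u (v \<otimes> y))"
    by (rule lcs_class_comm_mult_left[OF u x v_y]) (use i l in auto)
  also have "\<dots> = lcs_class G ?m ((comm G x v \<otimes> comm G x y) \<otimes> comm G u y)"
  proof (rule lcs_class_mult_cong)
    show "lcs_class G ?m (comm G x (v \<otimes> y)) = lcs_class G ?m (comm G x v \<otimes> comm G x y)"
      by (rule lcs_class_comm_mult_right[OF x v y]) (use i l in auto)
    have "comm G u v \<in> lcs G (Suc ?m)" using comm_lcs_le[OF u v] i l j by simp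
    moreover have "lcs_class G ?m (comm G u (v \<otimes> y)) = lcs_class G ?m (comm G u v \<otimes> comm G u y)"
      by (rule lcs_class_comm_mult_right[OF u v y]) (use i l j in auto)
    ultimately show "lcs_class G ?m (comm G u (v \<otimes> y)) = lcs_class G ?m (comm G u y)"
      using closed by (simp add: lcs_class_mult_left)
  qed (use closed in auto)
  also have "\<dots> = lcs_class G ?m (comm G u y \<otimes> comm G x v \<otimes> comm G x y)"
    using lcs_class_commute[of "comm G x v \<otimes> comm G x y" 1 "comm G u y" ?m ?m]
      comm_lcs_le[OF u y, of ?m] closed i l by (simp add: m_assoc)
  finally show ?thesis .
qed

lemma lcs_class_displacement_comm:
  assumes h: "h \<in> hom G G" and i: "1 \<le> i" and l: "1 \<le> l" and j: "1 \<le> j"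
    and x: "x \<in> lcs G i" and y: "y \<in> lcs G l"
    and dx: "displacement G h x \<in> lcs G (i + j)" and dy: "displacement G h y \<in> lcs G (l + j)"
  shows "lcs_class G (i + l + j) (displacement G h (comm G x y)) =
    lcs_class G (i + l + j) (comm G (displacement G h x) y \<otimes> comm G x (displacement G h y))"
proof -
  define c d where "c = comm G x y"
    and "d = comm G (displacement G h x) y \<otimes> comm G x (displacement G h y)"
  have xy: "x \<in> carrier G" "y \<in> carrier G" using x y by auto
  have closed: "c \<in> carrier G" "d \<in> carrier G" "h c \<in> carrier G"
    using xy h by (simp_all add: c_def d_def hom_in_carrier)
  have "h c = comm G (displacement G h x \<otimes> x) (displacement G h y \<otimes> y)"
    using hom_comm[OF is_group h xy] h xy by (simp add: c_def)
  then have "lcs_class G (i + l + j) (h c) = lcs_class G (i + l + j) (d \<otimes> c)"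
    using lcs_class_comm_mult[OF i l j x y dx dy] by (simp add: c_def d_def)
  then have "lcs_class G (i + l + j) (h c \<otimes> inv c) = lcs_class G (i + l + j) (d \<otimes> c \<otimes> inv c)"
    using closed by (intro lcs_class_mult_cong) simp_all
  then show ?thesis
    using closed unfolding c_def[symmetric] d_def[symmetric]
    by (simp add: displacement_def[of G h c] m_assoc)
qed

lemma lcs_class_jacobi:
  assumes i: "1 \<le> i" and l: "1 \<le> l" and j: "1 \<le> j"
    and x: "x \<in> lcs G i" and y: "y \<in> lcs G l" and z: "z \<in> lcs G j"
  shows "lcs_class G (i + l + j) (comm G z (comm G x y)) =
    lcs_class G (i + l + j) (comm G (comm G z x) y \<otimes> comm G x (comm G z y))"
proof -
  let ?conj = "\<lambda>g. z \<otimes> g \<otimes> inv z"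
  have "?conj \<in> hom G G" using z by (auto intro!: homI simp: m_assoc lcs_carrier)
  moreover have "displacement G ?conj g = comm G z g" for g
    by (simp add: displacement_def comm_def)
  ultimately show ?thesis
    using lcs_class_displacement_comm[of ?conj i l j x y] comm_lcs[OF j _ z] assms
    by (simp add: add.commute)
qed

lemma comm_comm_mem_jacobi:
  assumes L: "L \<lhd> G" "lcs G (Suc (i + l + j)) \<subseteq> L" and "1 \<le> i" "1 \<le> l" "1 \<le> j"
    and x: "x \<in> lcs G i" and y: "y \<in> lcs G l" and z: "z \<in> lcs G j"
    and xz: "comm G (comm G x z) y \<in> L" and zy: "comm G x (comm G z y) \<in> L"
  shows "comm G z (comm G x y) \<in> L"
proof -
  have closed: "x \<in> carrier G" "y \<in> carrier G" "z \<in> carrier G" using x y z by auto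
  have "comm G x z \<in> {a \<in> carrier G. comm G a y \<in> L}" using xz closed by simp
  then have "inv (comm G x z) \<in> {a \<in> carrier G. comm G a y \<in> L}"
    by (rule subgroup.m_inv_closed[OF subgroup_comm_mem[OF L(1) closed(2)]])
  then have "comm G (comm G z x) y \<otimes> comm G x (comm G z y) \<in> L"
    using zy closed subgroup.m_closed[OF normal_imp_subgroup[OF L(1)]] by (simp add: inv_comm)
  from mem_if_lcs_class_eq[OF normal_imp_subgroup[OF L(1)] L(2) this _
      lcs_class_jacobi[OF assms(3-5) x y z]]
  show ?thesis using closed by simp
qed

lemma graded_map_eqI:
  assumes "D 0 = E 0"
    and "\<And>i. 1 \<le> i \<Longrightarrow> D i \<in> extensional (carrier (grQ G i))"
    and "\<And>i. 1 \<le> i \<Longrightarrow> E i \<in> extensional (carrier (grQ G i))"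
    and "\<And>i x. 1 \<le> i \<Longrightarrow> x \<in> lcs G i \<Longrightarrow> D i (lcs_class G i x) = E i (lcs_class G i x)"
  shows "D = E"
proof
  fix i
  show "D i = E i"
  proof (cases "i = 0")
    case False
    then have "1 \<le> i" by simp
    then show ?thesis
      by (intro extensionalityI[OF assms(2,3)]) (auto simp: carrier_grQ assms(4))
  qed (simp add: assms(1))
qed

lemma der_hom: "D \<in> der G k \<Longrightarrow> 1 \<le> i \<Longrightarrow> D i \<in> hom (grQ G i) (grQ G (i + k))"
  by (simp add: der_def)

lemma der_comm:
  assumes D: "D \<in> der G k" and i: "1 \<le> i" and l: "1 \<le> l"
    and x: "x \<in> lcs G i" "x' \<in> lcs G (i + k)" "D i (lcs_class G i x) = lcs_class G (i + k) x'"
    and y: "y \<in> lcs G l" "y' \<in> lcs G (l + k)" "D l (lcs_class G l y) = lcs_class G (l + k) y'"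
  shows "D (i + l) (lcs_class G (i + l) (comm G x y)) =
    lcs_class G (i + l + k) (comm G x' y \<otimes> comm G x y')"
proof -
  have closed: "x \<in> carrier G" "y \<in> carrier G" "x' \<in> carrier G" "y' \<in> carrier G"
    using x y by auto
  have "D (i + l) (lcs_class G (i + l) (comm G x y)) =
      D (i + l) (lie_br G i l (lcs_class G i x) (lcs_class G l y))"
    using lie_br_lcs_class[OF i l x(1) y(1)] by simp
  also have "\<dots> = lie_br G (i + k) l (D i (lcs_class G i x)) (lcs_class G l y)
      \<otimes>\<^bsub>grQ G (i + l + k)\<^esub> lie_br G i (l + k) (lcs_class G i x) (D l (lcs_class G l y))"
    using D i l lcs_class_closed[OF x(1)] lcs_class_closed[OF y(1)] unfolding der_def by blast
  also have "\<dots> = lcs_class G (i + l + k) (comm G x' y)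
      \<otimes>\<^bsub>grQ G (i + l + k)\<^esub> lcs_class G (i + l + k) (comm G x y')"
    using lie_br_lcs_class[OF _ l x(2) y(1)] lie_br_lcs_class[OF i _ x(1) y(2)] x(3) y(3) i l
    by (simp add: ac_simps)
  finally show ?thesis using closed by (simp add: lcs_class_mult)
qed

lemma der_lift:
  assumes "D \<in> der G k" "1 \<le> i" "x \<in> lcs G i"
  obtains x' where "x' \<in> lcs G (i + k)" "D i (lcs_class G i x) = lcs_class G (i + k) x'"
proof -
  have "D i (lcs_class G i x) \<in> carrier (grQ G (i + k))"
    using hom_in_carrier[OF der_hom[OF assms(1,2)]] assms(3) by simp
  then show ?thesis using that by (auto simp: carrier_grQ)
qed

lemma der_eq_on_generate:
  assumes D: "D \<in> der G k" and E: "E \<in> der G k" and i: "1 \<le> i" and S: "S \<subseteq> lcs G i"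
    and eq: "\<And>s. s \<in> S \<Longrightarrow> D i (lcs_class G i s) = E i (lcs_class G i s)"
    and x: "x \<in> generate G S"
  shows "D i (lcs_class G i x) = E i (lcs_class G i x)"
proof -
  have "F i \<circ> lcs_class G i \<in> hom (G\<lparr>carrier := lcs G i\<rparr>) (grQ G (i + k))"
    if "F \<in> der G k" for F
    by (rule Group.hom_compose[OF lcs_class_hom der_hom[OF that i]])
  from hom_eq_on_generate[OF grQ_group this[OF D] this[OF E] lcs_subgroup S _ x]
  show ?thesis using eq by simp
qed

lemma der_eqI:
  assumes D: "D \<in> der G k" and E: "E \<in> der G k"
    and S: "S \<subseteq> carrier G" "generate G S = carrier G"
    and eq: "\<And>s. s \<in> S \<Longrightarrow> D 1 (lcs_class G 1 s) = E 1 (lcs_class G 1 s)"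
  shows "D = E"
proof (rule graded_map_eqI)
  fix i x assume "1 \<le> i" "x \<in> lcs G i"
  then show "D i (lcs_class G i x) = E i (lcs_class G i x)"
  proof (induction i arbitrary: x rule: nat_induct_at_least)
    case base
    then show ?case using der_eq_on_generate[OF D E _ _ eq] S by simp
  next
    case (Suc i)
    show ?case
    proof (rule der_eq_on_generate[OF D E])
      show "x \<in> generate G {comm G y z | y z. y \<in> carrier G \<and> z \<in> lcs G i}"
        using Suc.prems lcs_Suc[OF Suc.hyps] by simp
      show "{comm G y z | y z. y \<in> carrier G \<and> z \<in> lcs G i} \<subseteq> lcs G (Suc i)"
        using comm_lcs_Suc Suc.hyps by auto
      fix s assume "s \<in> {comm G y z | y z. y \<in> carrier G \<and> z \<in> lcs G i}"
      then obtain y z where s: "s = comm G y z" and y: "y \<in> lcs G 1" and z: "z \<in> lcs G i"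
        by auto
      obtain y' where y': "y' \<in> lcs G (1 + k)" "E 1 (lcs_class G 1 y) = lcs_class G (1 + k) y'"
        using der_lift[OF E _ y] by auto
      obtain z' where z': "z' \<in> lcs G (i + k)" "E i (lcs_class G i z) = lcs_class G (i + k) z'"
        using der_lift[OF E Suc.hyps z] by auto
      have "D 1 (lcs_class G 1 y) = E 1 (lcs_class G 1 y)"
        using der_eq_on_generate[OF D E _ _ eq, of S] S y by simp
      then show "D (Suc i) (lcs_class G (Suc i) s) = E (Suc i) (lcs_class G (Suc i) s)"
        using der_comm[OF E _ Suc.hyps y y' z z'] der_comm[OF D _ Suc.hyps y y'(1) _ z z'(1)]
          Suc.IH[OF z] y' z' s by simp
    qed simp
  qed
qed (use D E in \<open>auto simp: der_def\<close>)

end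

section \<open>The Andreadakis filtration\<close>

definition andr_class :: "('a, 'b) monoid_scheme \<Rightarrow> nat \<Rightarrow> ('a \<Rightarrow> 'a) \<Rightarrow> ('a \<Rightarrow> 'a) set" where
  "andr_class G j s = r_coset (AutoGroup G) (andr G (Suc j)) s"

lemma carrier_AutoGroup [simp]: "carrier (AutoGroup G) = auto G"
  by (simp add: AutoGroup_def)

context group
begin

lemma auto_imp_hom: "s \<in> auto G \<Longrightarrow> s \<in> hom G G"
  by (simp add: auto_def)

lemma auto_closed: "s \<in> auto G \<Longrightarrow> x \<in> carrier G \<Longrightarrow> s x \<in> carrier G"
  by (auto simp: auto_def hom_def)

lemma auto_lcs: "s \<in> auto G \<Longrightarrow> x \<in> lcs G i \<Longrightarrow> s x \<in> lcs G i"
  by (rule hom_lcs[OF is_group auto_imp_hom])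

lemma AutoGroup_mult:
  "s \<in> auto G \<Longrightarrow> t \<in> auto G \<Longrightarrow> x \<in> carrier G \<Longrightarrow> (s \<otimes>\<^bsub>AutoGroup G\<^esub> t) x = s (t x)"
  by (simp add: AutoGroup_def BijGroup_def auto_def compose_eq)

lemma AutoGroup_one: "x \<in> carrier G \<Longrightarrow> \<one>\<^bsub>AutoGroup G\<^esub> x = x"
  by (simp add: AutoGroup_def BijGroup_def)

lemma AutoGroup_inv:
  assumes "s \<in> auto G"
  shows "inv\<^bsub>AutoGroup G\<^esub> s \<in> auto G"
    and "x \<in> carrier G \<Longrightarrow> s ((inv\<^bsub>AutoGroup G\<^esub> s) x) = x"
proof -
  interpret A: group "AutoGroup G" by (rule AutoGroup)
  show inv_auto: "inv\<^bsub>AutoGroup G\<^esub> s \<in> auto G"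
    using A.inv_closed[of s] assms by simp
  show "s ((inv\<^bsub>AutoGroup G\<^esub> s) x) = x" if "x \<in> carrier G"
    using AutoGroup_mult[OF assms inv_auto that] A.r_inv[of s] assms AutoGroup_one[OF that] by simp
qed

lemma mem_andr_iff:
  "s \<in> andr G j \<longleftrightarrow>
    s \<in> auto G \<and> (\<forall>i\<ge>1. \<forall>x\<in>lcs G i. displacement G s x \<in> lcs G (i + j))"
  by (simp add: andr_def displacement_def)

lemma andr_auto: "s \<in> andr G j \<Longrightarrow> s \<in> auto G"
  by (simp add: mem_andr_iff)

lemma andr_displacement:
  "s \<in> andr G j \<Longrightarrow> 1 \<le> i \<Longrightarrow> x \<in> lcs G i \<Longrightarrow> displacement G s x \<in> lcs G (i + j)"
  by (simp add: mem_andr_iff)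

lemma andr_Suc_subset: "andr G (Suc j) \<subseteq> andr G j"
proof
  fix s assume "s \<in> andr G (Suc j)"
  moreover have "x \<in> lcs G (i + j)" if "x \<in> lcs G (i + Suc j)" for i x
    using lcs_antimono[OF _ that] by simp
  ultimately show "s \<in> andr G j" unfolding mem_andr_iff by blast
qed

lemma displacement_AutoGroup_mult:
  assumes "s \<in> auto G" "t \<in> auto G" "x \<in> carrier G"
  shows "displacement G (s \<otimes>\<^bsub>AutoGroup G\<^esub> t) x = displacement G s (t x) \<otimes> displacement G t x"
  using assms by (simp add: displacement_def AutoGroup_mult auto_closed m_assoc)

lemma andr_subgroup: "subgroup (andr G j) (AutoGroup G)"
proof -
  interpret A: group "AutoGroup G" by (rule AutoGroup)
  have mult: "s \<otimes>\<^bsub>AutoGroup G\<^esub> t \<in> andr G j" if s: "s \<in> andr G j" and t: "t \<in> andr G j" for s t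
  proof -
    note autos = andr_auto[OF s] andr_auto[OF t]
    have "displacement G (s \<otimes>\<^bsub>AutoGroup G\<^esub> t) x \<in> lcs G (i + j)"
      if "1 \<le> i" "x \<in> lcs G i" for i x
      using andr_displacement[OF s _ auto_lcs[OF autos(2)]] andr_displacement[OF t] that
      by (simp add: displacement_AutoGroup_mult autos lcs_carrier)
    then show ?thesis using A.m_closed[of s t] autos by (simp add: mem_andr_iff)
  qed
  have inv: "inv\<^bsub>AutoGroup G\<^esub> s \<in> andr G j" if s: "s \<in> andr G j" for s
  proof -
    let ?t = "inv\<^bsub>AutoGroup G\<^esub> s"
    note auto = andr_auto[OF s]
    have "displacement G ?t x \<in> lcs G (i + j)" if "1 \<le> i" and x: "x \<in> lcs G i" for i x
    proof -
      have tx: "?t x \<in> lcs G i" by (rule auto_lcs[OF AutoGroup_inv(1)[OF auto] x])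
      then have "inv (displacement G s (?t x)) \<in> lcs G (i + j)"
        using andr_displacement[OF s that(1)] by simp
      moreover have "inv (displacement G s (?t x)) = displacement G ?t x"
        using AutoGroup_inv(2)[OF auto lcs_carrier[OF x]] x tx
        by (simp add: displacement_def inv_mult_group lcs_carrier)
      ultimately show ?thesis by simp
    qed
    then show ?thesis using AutoGroup_inv(1)[OF auto] by (simp add: mem_andr_iff)
  qed
  have "displacement G \<one>\<^bsub>AutoGroup G\<^esub> x = \<one>" if "x \<in> lcs G i" for i x
    using that by (simp add: displacement_def AutoGroup_one lcs_carrier)
  then have "\<one>\<^bsub>AutoGroup G\<^esub> \<in> andr G j"
    using A.one_closed by (simp add: mem_andr_iff)
  then show ?thesis
    by (intro A.subgroupI) (use mult inv andr_auto in auto)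
qed

lemma andr_normal: "andr G j \<lhd> AutoGroup G"
proof -
  interpret A: group "AutoGroup G" by (rule AutoGroup)
  have "t \<otimes>\<^bsub>AutoGroup G\<^esub> s \<otimes>\<^bsub>AutoGroup G\<^esub> inv\<^bsub>AutoGroup G\<^esub> t \<in> andr G j"
    if t: "t \<in> auto G" and s: "s \<in> andr G j" for s t
  proof -
    let ?r = "inv\<^bsub>AutoGroup G\<^esub> t"
    have autos: "s \<in> auto G" "?r \<in> auto G" "t \<otimes>\<^bsub>AutoGroup G\<^esub> s \<in> auto G"
      using s t andr_auto AutoGroup_inv(1)[OF t] A.m_closed[of t s] by auto
    interpret t: group_hom G G t by unfold_locales (rule auto_imp_hom[OF t])
    have "displacement G (t \<otimes>\<^bsub>AutoGroup G\<^esub> s \<otimes>\<^bsub>AutoGroup G\<^esub> ?r) x \<in> lcs G (i + j)"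
      if "1 \<le> i" "x \<in> lcs G i" for i x
    proof -
      have x: "x \<in> carrier G" and rx: "?r x \<in> lcs G i" "?r x \<in> carrier G"
        using that(2) auto_lcs[OF autos(2) that(2)] by auto
      have "t (displacement G s (?r x)) \<in> lcs G (i + j)"
        using auto_lcs[OF t andr_displacement[OF s that(1) rx(1)]] .
      moreover have "t (displacement G s (?r x)) =
          displacement G (t \<otimes>\<^bsub>AutoGroup G\<^esub> s \<otimes>\<^bsub>AutoGroup G\<^esub> ?r) x"
        using x rx(2) autos t
        by (simp add: displacement_def AutoGroup_mult AutoGroup_inv(2) auto_closed)
      ultimately show ?thesis by simp
    qed
    then show ?thesis
      using A.m_closed[OF A.m_closed[of t s], of ?r] autos t by (simp add: mem_andr_iff)
  qed
  then show ?thesis by (simp add: A.normal_inv_iff andr_subgroup)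
qed

lemma carrier_AQ: "carrier (AQ G j) = andr_class G j ` andr G j"
  unfolding AQ_def andr_class_def by (rule group.subquotient_carrier[OF AutoGroup])

lemma andr_class_mult:
  "s \<in> auto G \<Longrightarrow> t \<in> auto G \<Longrightarrow>
    andr_class G j s \<otimes>\<^bsub>AQ G j\<^esub> andr_class G j t = andr_class G j (s \<otimes>\<^bsub>AutoGroup G\<^esub> t)"
  unfolding AQ_def andr_class_def
  by (rule group.subquotient_mult[OF AutoGroup andr_normal]) simp_all

lemma some_mem_andr_class:
  assumes "s \<in> andr G j"
  obtains r where "r \<in> andr G (Suc j)" "(SOME t. t \<in> andr_class G j s) = r \<otimes>\<^bsub>AutoGroup G\<^esub> s"
  using group.some_mem_rcos[OF AutoGroup andr_subgroup, of s "Suc j"] andr_auto[OF assms] that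
  unfolding andr_class_def by auto

lemma andr_class_some:
  assumes "s \<in> andr G j"
  shows "(SOME t. t \<in> andr_class G j s) \<in> andr G j"
    and "andr_class G j (SOME t. t \<in> andr_class G j s) = andr_class G j s"
proof -
  interpret A: group "AutoGroup G" by (rule AutoGroup)
  obtain r where r: "r \<in> andr G (Suc j)" "(SOME t. t \<in> andr_class G j s) = r \<otimes>\<^bsub>AutoGroup G\<^esub> s"
    using some_mem_andr_class[OF assms] .
  show "(SOME t. t \<in> andr_class G j s) \<in> andr G j"
    unfolding r(2) using r(1) assms andr_Suc_subset subgroup.m_closed[OF andr_subgroup] by blast
  have "r \<otimes>\<^bsub>AutoGroup G\<^esub> s \<in> andr G (Suc j) #>\<^bsub>AutoGroup G\<^esub> s"
    unfolding r_coset_def using r(1) by blast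
  then show "andr_class G j (SOME t. t \<in> andr_class G j s) = andr_class G j s"
    unfolding r(2) unfolding andr_class_def
    by (intro A.repr_independence[symmetric] andr_subgroup) (use andr_auto[OF assms] in simp_all)
qed

lemma andr_class_eqI:
  assumes s: "s \<in> auto G" and t: "t \<in> auto G"
    and eq: "\<And>i x. 1 \<le> i \<Longrightarrow> x \<in> lcs G i \<Longrightarrow>
      lcs_class G (i + j) (displacement G s x) = lcs_class G (i + j) (displacement G t x)"
  shows "andr_class G j s = andr_class G j t"
proof -
  interpret A: group "AutoGroup G" by (rule AutoGroup)
  let ?r = "inv\<^bsub>AutoGroup G\<^esub> t"
  have r: "?r \<in> auto G" by (rule AutoGroup_inv(1)[OF t])
  have "displacement G (s \<otimes>\<^bsub>AutoGroup G\<^esub> ?r) x \<in> lcs G (i + Suc j)"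
    if "1 \<le> i" and x: "x \<in> lcs G i" for i x
  proof -
    let ?y = "?r x"
    have y: "?y \<in> lcs G i" by (rule auto_lcs[OF r x])
    have closed: "x \<in> carrier G" "?y \<in> carrier G" "s ?y \<in> carrier G"
      using x y auto_closed[OF s] by auto
    have "displacement G s ?y \<otimes> inv (displacement G t ?y) \<in> lcs G (i + Suc j)"
      using eq[OF that(1) y] closed s t by (simp add: lcs_class_eq_iff auto_imp_hom)
    moreover have "displacement G s ?y \<otimes> inv (displacement G t ?y) =
        displacement G (s \<otimes>\<^bsub>AutoGroup G\<^esub> ?r) x"
      using closed s r by (simp add: displacement_def AutoGroup_mult AutoGroup_inv(2)[OF t]
        inv_mult_group m_assoc)
    ultimately show ?thesis by simp
  qed
  then have "s \<otimes>\<^bsub>AutoGroup G\<^esub> ?r \<in> andr G (Suc j)"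
    using A.m_closed[of s ?r] s r by (simp add: mem_andr_iff)
  then show ?thesis
    unfolding andr_class_def using A.rcos_eq_iff[OF andr_subgroup, of s t] s t by simp
qed

lemma lcs_class_displacement_mult:
  assumes s: "s \<in> andr G j" and i: "1 \<le> i" and x: "x \<in> lcs G i" and y: "y \<in> lcs G i"
  shows "lcs_class G (i + j) (displacement G s (x \<otimes> y)) =
    lcs_class G (i + j) (displacement G s x \<otimes> displacement G s y)"
proof -
  note hom = auto_imp_hom[OF andr_auto[OF s]]
  have closed: "x \<in> carrier G" "y \<in> carrier G" using x y by auto
  have "lcs_class G (i + j) (x \<otimes> displacement G s y \<otimes> inv x) =
      lcs_class G (i + j) (displacement G s y)"
    by (rule lcs_class_conj[OF x andr_displacement[OF s i y]]) (use i in auto)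
  then show ?thesis
    unfolding displacement_mult[OF hom closed] using closed hom
    by (intro lcs_class_mult_cong) auto
qed

lemma lcs_class_displacement_cong:
  assumes s: "s \<in> andr G j" and i: "1 \<le> i" and x: "x \<in> lcs G i" and a: "a \<in> lcs G (Suc i)"
  shows "lcs_class G (i + j) (displacement G s (a \<otimes> x)) = lcs_class G (i + j) (displacement G s x)"
proof -
  have "a \<in> lcs G i" using lcs_antimono[OF _ a] by simp
  then show ?thesis
    using lcs_class_displacement_mult[OF s i _ x] andr_displacement[OF s _ a]
      andr_displacement[OF s i x] by (simp add: lcs_class_mult_left lcs_carrier)
qed

lemma lcs_class_andr:
  assumes s: "s \<in> andr G j" and j: "1 \<le> j" and i: "1 \<le> i" and x: "x \<in> lcs G i"
  shows "lcs_class G i (s x) = lcs_class G i x"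
proof -
  have "displacement G s x \<in> lcs G (Suc i)"
    using lcs_antimono[OF _ andr_displacement[OF s i x]] j by simp
  then show ?thesis
    using lcs_class_mult_left[of "displacement G s x" i x]
      displacement_mult_self[OF auto_imp_hom[OF andr_auto[OF s]]] x by (simp add: lcs_carrier)
qed

lemma hom_commutator_displacement:
  assumes h: "h \<in> hom G G" and k: "k \<in> hom G G" and x: "x \<in> carrier G"
  shows "h (k x) \<otimes> inv (k (h x)) =
    displacement G h (displacement G k x)
    \<otimes> comm G (displacement G k x) (displacement G h x)
    \<otimes> inv (displacement G k (displacement G h x))"
proof -
  interpret h: group_hom G G h by unfold_locales fact
  interpret k: group_hom G G k by unfold_locales fact
  show ?thesis using x by (simp add: displacement_def comm_def m_assoc inv_mult_group)
qed

lemma displacement_AutoGroup_comm: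
  assumes s: "s \<in> auto G" and t: "t \<in> auto G" and x: "x \<in> carrier G"
  shows "displacement G (comm (AutoGroup G) s t) (t (s x)) =
    displacement G s (displacement G t x)
    \<otimes> comm G (displacement G t x) (displacement G s x)
    \<otimes> inv (displacement G t (displacement G s x))"
proof -
  interpret A: group "AutoGroup G" by (rule AutoGroup)
  let ?c = "comm (AutoGroup G) s t"
  have "s \<otimes>\<^bsub>AutoGroup G\<^esub> t = ?c \<otimes>\<^bsub>AutoGroup G\<^esub> (t \<otimes>\<^bsub>AutoGroup G\<^esub> s)"
    using A.mult_eq_comm_mult[of s t] s t by simp
  then have "s (t x) = ?c (t (s x))"
    using AutoGroup_mult[OF s t x] AutoGroup_mult[OF t s x] A.m_closed[of t s] s t x
      AutoGroup_mult[of ?c "t \<otimes>\<^bsub>AutoGroup G\<^esub> s" x] A.comm_closed[of s t] by simp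
  then show ?thesis
    using hom_commutator_displacement[OF auto_imp_hom[OF s] auto_imp_hom[OF t] x]
    by (simp add: displacement_def)
qed

lemma andr_comm:
  assumes s: "s \<in> andr G j" and t: "t \<in> andr G k"
  shows "comm (AutoGroup G) s t \<in> andr G (j + k)"
proof -
  interpret A: group "AutoGroup G" by (rule AutoGroup)
  note autos = andr_auto[OF s] andr_auto[OF t]
  let ?c = "comm (AutoGroup G) s t" and ?s' = "inv\<^bsub>AutoGroup G\<^esub> s" and ?t' = "inv\<^bsub>AutoGroup G\<^esub> t"
  have "displacement G ?c y \<in> lcs G (i + (j + k))" if i: "1 \<le> i" and y: "y \<in> lcs G i" for i y
  proof -
    define x where "x = ?s' (?t' y)"
    have x: "x \<in> lcs G i"
      unfolding x_def using auto_lcs[OF AutoGroup_inv(1)] autos y by blast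
    have "?t' y \<in> carrier G" using AutoGroup_inv(1)[OF autos(2)] y auto_closed by auto
    then have y_eq: "y = t (s x)"
      using AutoGroup_inv(2)[OF autos(1)] AutoGroup_inv(2)[OF autos(2)] y by (auto simp: x_def)
    note u = andr_displacement[OF s i x] and v = andr_displacement[OF t i x]
    have "displacement G s (displacement G t x) \<in> lcs G (i + (j + k))"
      using andr_displacement[OF s _ v] i by (simp add: ac_simps)
    moreover have "displacement G t (displacement G s x) \<in> lcs G (i + (j + k))"
      using andr_displacement[OF t _ u] i by (simp add: ac_simps)
    moreover have "comm G (displacement G t x) (displacement G s x) \<in> lcs G (i + (j + k))"
      using comm_lcs_le[OF v u] i by simp
    ultimately show ?thesis
      unfolding y_eq using displacement_AutoGroup_comm[OF autos lcs_carrier[OF x]] by simp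
  qed
  then show ?thesis using A.comm_closed[of s t] autos by (simp add: mem_andr_iff)
qed

lemma lcs_class_displacement_comm_andr:
  assumes s: "s \<in> andr G j" and t: "t \<in> andr G k" and j: "1 \<le> j" and k: "1 \<le> k"
    and i: "1 \<le> i" and x: "x \<in> lcs G i"
  shows "lcs_class G (i + (j + k)) (displacement G (comm (AutoGroup G) s t) (t (s x))) =
    lcs_class G (i + (j + k)) (displacement G s (displacement G t x)
      \<otimes> inv (displacement G t (displacement G s x)))"
proof -
  note autos = andr_auto[OF s] andr_auto[OF t]
  note u = andr_displacement[OF s i x] and v = andr_displacement[OF t i x]
  define a c b where "a = displacement G s (displacement G t x)"
    and "c = comm G (displacement G t x) (displacement G s x)"
    and "b = inv (displacement G t (displacement G s x))"
  have closed: "a \<in> carrier G" "c \<in> carrier G" "b \<in> carrier G"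
    using autos x by (auto simp: a_def b_def c_def auto_imp_hom)
  have "c \<in> lcs G (Suc (i + (j + k)))"
    unfolding c_def using comm_lcs_le[OF v u] i by simp
  then have "lcs_class G (i + (j + k)) (a \<otimes> c \<otimes> b) = lcs_class G (i + (j + k)) (a \<otimes> b)"
    using closed by (intro lcs_class_mult_cong) (auto simp: lcs_class_mult_right)
  then show ?thesis
    using displacement_AutoGroup_comm[OF autos lcs_carrier[OF x]] by (simp add: a_def b_def c_def)
qed

end

section \<open>The Johnson morphism\<close>

context group
begin

lemma johnson_lcs_class:
  assumes s: "s \<in> andr G j" and j: "1 \<le> j" and i: "1 \<le> i" and x: "x \<in> lcs G i"
  shows "johnson G j (andr_class G j s) i (lcs_class G i x) =
      lcs_class G (i + j) (displacement G s x)"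
proof -
  obtain r where r: "r \<in> andr G (Suc j)" "(SOME t. t \<in> andr_class G j s) = r \<otimes>\<^bsub>AutoGroup G\<^esub> s"
    using some_mem_andr_class[OF s] .
  obtain a where a: "a \<in> lcs G (Suc i)" "(SOME y. y \<in> lcs_class G i x) = a \<otimes> x"
    using some_mem_lcs_class[OF x] .
  let ?t = "r \<otimes>\<^bsub>AutoGroup G\<^esub> s"
  have t: "?t \<in> andr G j"
    using r(1) s andr_Suc_subset subgroup.m_closed[OF andr_subgroup] by blast
  have autos: "r \<in> auto G" "s \<in> auto G" using r(1) s andr_auto by auto
  have "displacement G r (s x) \<in> lcs G (Suc (i + j))"
    using andr_displacement[OF r(1) i auto_lcs[OF autos(2) x]] by simp
  then have "lcs_class G (i + j) (displacement G ?t x) = lcs_class G (i + j) (displacement G s x)"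
    using displacement_AutoGroup_mult[OF autos] x autos
    by (simp add: lcs_class_mult_left lcs_carrier auto_imp_hom)
  then show ?thesis
    unfolding johnson_def r(2) using i x a lcs_class_displacement_cong[OF t i x a(1)]
    by (simp add: lcs_class_def[symmetric] displacement_def)
qed

lemma johnson_extensional:
  "johnson G j c 0 = (\<lambda>_. undefined)"
  "1 \<le> i \<Longrightarrow> johnson G j c i \<in> extensional (carrier (grQ G i))"
  by (auto simp: johnson_def)

lemma hom_grQ_if_lcs_class_mult:
  assumes d: "\<And>x. x \<in> lcs G i \<Longrightarrow> d x \<in> lcs G m"
    and f: "\<And>x. x \<in> lcs G i \<Longrightarrow> f (lcs_class G i x) = lcs_class G m (d x)"
    and mult: "\<And>x y. x \<in> lcs G i \<Longrightarrow> y \<in> lcs G i \<Longrightarrow>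
      lcs_class G m (d (x \<otimes> y)) = lcs_class G m (d x \<otimes> d y)"
  shows "f \<in> hom (grQ G i) (grQ G m)"
proof (rule homI)
  fix a b assume "a \<in> carrier (grQ G i)" "b \<in> carrier (grQ G i)"
  then obtain x y where x: "x \<in> lcs G i" "a = lcs_class G i x"
    and y: "y \<in> lcs G i" "b = lcs_class G i y"
    by (auto simp: carrier_grQ)
  have "f (a \<otimes>\<^bsub>grQ G i\<^esub> b) = f (lcs_class G i (x \<otimes> y))"
    using x y by (simp add: lcs_class_mult lcs_carrier)
  also have "\<dots> = lcs_class G m (d x \<otimes> d y)"
    using f mult x(1) y(1) by simp
  also have "\<dots> = f a \<otimes>\<^bsub>grQ G m\<^esub> f b"
    using x y f lcs_carrier[OF d] by (simp add: lcs_class_mult)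
  finally show "f (a \<otimes>\<^bsub>grQ G i\<^esub> b) = f a \<otimes>\<^bsub>grQ G m\<^esub> f b" .
qed (use d f in \<open>auto simp: carrier_grQ\<close>)

lemma derI:
  assumes D: "D 0 = (\<lambda>_. undefined)"
      "\<And>i. 1 \<le> i \<Longrightarrow> D i \<in> extensional (carrier (grQ G i))"
    and d: "\<And>i x. 1 \<le> i \<Longrightarrow> x \<in> lcs G i \<Longrightarrow> d x \<in> lcs G (i + k)"
      "\<And>i x. 1 \<le> i \<Longrightarrow> x \<in> lcs G i \<Longrightarrow> D i (lcs_class G i x) = lcs_class G (i + k) (d x)"
    and mult: "\<And>i x y. 1 \<le> i \<Longrightarrow> x \<in> lcs G i \<Longrightarrow> y \<in> lcs G i \<Longrightarrow>
      lcs_class G (i + k) (d (x \<otimes> y)) = lcs_class G (i + k) (d x \<otimes> d y)"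
    and comm: "\<And>i l x y. 1 \<le> i \<Longrightarrow> 1 \<le> l \<Longrightarrow> x \<in> lcs G i \<Longrightarrow> y \<in> lcs G l \<Longrightarrow>
      lcs_class G (i + l + k) (d (comm G x y)) =
        lcs_class G (i + l + k) (comm G (d x) y \<otimes> comm G x (d y))"
  shows "D \<in> der G k"
proof -
  have "D i \<in> hom (grQ G i) (grQ G (i + k))" if "1 \<le> i" for i
    by (rule hom_grQ_if_lcs_class_mult[where d = d]) (use that d mult in auto)
  moreover have "D (i + l) (lie_br G i l a b) =
      lie_br G (i + k) l (D i a) b \<otimes>\<^bsub>grQ G (i + l + k)\<^esub> lie_br G i (l + k) a (D l b)"
    if i: "1 \<le> i" and l: "1 \<le> l" and "a \<in> carrier (grQ G i)" "b \<in> carrier (grQ G l)" for i l a b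
  proof -
    obtain x y where x: "x \<in> lcs G i" "a = lcs_class G i x"
      and y: "y \<in> lcs G l" "b = lcs_class G l y"
      using \<open>a \<in> _\<close> \<open>b \<in> _\<close> by (auto simp: carrier_grQ)
    have "D (i + l) (lie_br G i l a b) = lcs_class G (i + l + k) (comm G (d x) y \<otimes> comm G x (d y))"
      using lie_br_lcs_class[OF i l x(1) y(1)] d(2)[OF _ comm_lcs[OF i l x(1) y(1)]]
        comm[OF i l x(1) y(1)] i x y
      by simp
    moreover have "lie_br G (i + k) l (D i a) b = lcs_class G (i + l + k) (comm G (d x) y)"
      unfolding x(2) y(2) d(2)[OF i x(1)]
      using lie_br_lcs_class[OF _ l d(1)[OF i x(1)] y(1)] i by (simp add: ac_simps)
    moreover have "lie_br G i (l + k) a (D l b) = lcs_class G (i + l + k) (comm G x (d y))"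
      unfolding x(2) y(2) d(2)[OF l y(1)]
      using lie_br_lcs_class[OF i _ x(1) d(1)[OF l y(1)]] l by (simp add: ac_simps)
    ultimately show ?thesis
      using x(1) y(1) d(1)[OF i x(1)] d(1)[OF l y(1)] by (simp add: lcs_class_mult lcs_carrier)
  qed
  ultimately show ?thesis using D by (simp add: der_def)
qed

lemma johnson_der:
  assumes s: "s \<in> andr G j" and j: "1 \<le> j"
  shows "johnson G j (andr_class G j s) \<in> der G j"
proof (rule derI[where d = "displacement G s"])
  show "lcs_class G (i + l + j) (displacement G s (comm G x y)) =
      lcs_class G (i + l + j) (comm G (displacement G s x) y \<otimes> comm G x (displacement G s y))"
    if "1 \<le> i" "1 \<le> l" "x \<in> lcs G i" "y \<in> lcs G l" for i l x y
    using lcs_class_displacement_comm[OF auto_imp_hom[OF andr_auto[OF s]]] andr_displacement[OF s]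
      j that by simp
qed (use assms in \<open>simp_all add: johnson_extensional johnson_lcs_class andr_displacement
  lcs_class_displacement_mult\<close>)

lemma johnson_hom:
  assumes j: "1 \<le> j"
  shows "johnson G j \<in> hom (AQ G j) (der_grp G j)"
proof (rule homI)
  fix c assume "c \<in> carrier (AQ G j)"
  then show "johnson G j c \<in> carrier (der_grp G j)"
    using johnson_der j by (auto simp: carrier_AQ der_grp_def)
next
  fix c d assume "c \<in> carrier (AQ G j)" "d \<in> carrier (AQ G j)"
  then obtain s t where s: "s \<in> andr G j" "c = andr_class G j s"
    and t: "t \<in> andr G j" "d = andr_class G j t"
    by (auto simp: carrier_AQ)
  note autos = andr_auto[OF s(1)] andr_auto[OF t(1)]
  let ?r = "s \<otimes>\<^bsub>AutoGroup G\<^esub> t"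
  have r: "?r \<in> andr G j" using subgroup.m_closed[OF andr_subgroup s(1) t(1)] .
  have cd: "c \<otimes>\<^bsub>AQ G j\<^esub> d = andr_class G j ?r"
    using andr_class_mult[OF autos] s t by simp
  show "johnson G j (c \<otimes>\<^bsub>AQ G j\<^esub> d) = johnson G j c \<otimes>\<^bsub>der_grp G j\<^esub> johnson G j d"
  proof (rule graded_map_eqI)
    fix i x assume i: "1 \<le> i" and x: "x \<in> lcs G i"
    have "displacement G t x \<in> lcs G (Suc i)"
      using lcs_antimono[OF _ andr_displacement[OF t(1) i x]] j by simp
    then have "lcs_class G (i + j) (displacement G s (t x)) =
        lcs_class G (i + j) (displacement G s x)"
      using lcs_class_displacement_cong[OF s(1) i x, of "displacement G t x"] autos(2) x
      by (simp add: auto_imp_hom lcs_carrier)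
    then have "lcs_class G (i + j) (displacement G ?r x) =
        lcs_class G (i + j) (displacement G s x)
          \<otimes>\<^bsub>grQ G (i + j)\<^esub> lcs_class G (i + j) (displacement G t x)"
      using autos x
      by (simp add: displacement_AutoGroup_mult lcs_class_mult auto_imp_hom auto_closed lcs_carrier)
    then show "johnson G j (c \<otimes>\<^bsub>AQ G j\<^esub> d) i (lcs_class G i x) =
        (johnson G j c \<otimes>\<^bsub>der_grp G j\<^esub> johnson G j d) i (lcs_class G i x)"
      unfolding cd using johnson_lcs_class[OF _ j i x] r s t i x by (simp add: der_grp_def)
  qed (auto simp: johnson_extensional der_grp_def)
qed

lemma johnson_inj:
  assumes j: "1 \<le> j"
  shows "inj_on (johnson G j) (carrier (AQ G j))"
proof (rule inj_onI)
  fix c d assume "c \<in> carrier (AQ G j)" "d \<in> carrier (AQ G j)"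
    and eq: "johnson G j c = johnson G j d"
  then obtain s t where s: "s \<in> andr G j" "c = andr_class G j s"
    and t: "t \<in> andr G j" "d = andr_class G j t"
    by (auto simp: carrier_AQ)
  have "lcs_class G (i + j) (displacement G s x) = lcs_class G (i + j) (displacement G t x)"
    if "1 \<le> i" "x \<in> lcs G i" for i x
    using johnson_lcs_class[OF s(1) j that] johnson_lcs_class[OF t(1) j that] eq s(2) t(2) by simp
  then show "c = d"
    unfolding s(2) t(2) using s(1) t(1) by (intro andr_class_eqI andr_auto)
qed

lemma johnson_comm:
  assumes j: "1 \<le> j" and k: "1 \<le> k" and c: "c \<in> carrier (AQ G j)" and d: "d \<in> carrier (AQ G k)"
  shows "johnson G (j + k) (aut_br G j k c d) = der_br G j k (johnson G j c) (johnson G k d)"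
proof (rule graded_map_eqI)
  fix i x assume i: "1 \<le> i" and x: "x \<in> lcs G i"
  define s t where "s = (SOME s. s \<in> c)" and "t = (SOME t. t \<in> d)"
  have s: "s \<in> andr G j" "c = andr_class G j s" and t: "t \<in> andr G k" "d = andr_class G k t"
    using c d andr_class_some unfolding s_def t_def by (auto simp: carrier_AQ)
  let ?c = "comm (AutoGroup G) s t" and ?m = "i + (j + k)"
  have bracket: "aut_br G j k c d = andr_class G (j + k) ?c"
    unfolding aut_br_def andr_class_def s_def t_def ..
  define u v where "u = displacement G s x" and "v = displacement G t x"
  have u: "u \<in> lcs G (i + j)" and v: "v \<in> lcs G (i + k)"
    unfolding u_def v_def using andr_displacement[OF _ i x] s(1) t(1) by auto
  have du: "displacement G t u \<in> lcs G ?m" and dv: "displacement G s v \<in> lcs G ?m"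
    using andr_displacement[OF t(1) _ u] andr_displacement[OF s(1) _ v] i
    by (simp_all add: ac_simps)
  have tsx: "t (s x) \<in> lcs G i" "lcs_class G i (t (s x)) = lcs_class G i x"
    using lcs_class_andr[OF t(1) k i] lcs_class_andr[OF s(1) j i] x
      auto_lcs[OF andr_auto] s(1) t(1) by auto
  have "johnson G (j + k) (aut_br G j k c d) i (lcs_class G i x) =
      lcs_class G ?m (displacement G ?c (t (s x)))"
    using johnson_lcs_class[OF andr_comm[OF s(1) t(1)] _ i tsx(1)] j
    unfolding bracket tsx(2) by simp
  also have "\<dots> = lcs_class G ?m (displacement G s v) \<otimes>\<^bsub>grQ G ?m\<^esub>
      inv\<^bsub>grQ G ?m\<^esub> lcs_class G ?m (displacement G t u)"
    using lcs_class_displacement_comm_andr[OF s(1) t(1) j k i x] du dv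
    by (simp add: u_def v_def lcs_class_mult lcs_class_inv lcs_carrier)
  also have "\<dots> = der_br G j k (johnson G j c) (johnson G k d) i (lcs_class G i x)"
    using johnson_lcs_class[OF s(1) j i x] johnson_lcs_class[OF t(1) k i x]
      johnson_lcs_class[OF s(1) j _ v] johnson_lcs_class[OF t(1) k _ u] i x
    by (simp add: der_br_def s(2) t(2) u_def v_def ac_simps)
  finally show "johnson G (j + k) (aut_br G j k c d) i (lcs_class G i x) =
      der_br G j k (johnson G j c) (johnson G k d) i (lcs_class G i x)" .
qed (auto simp: johnson_extensional der_br_def)

end

section \<open>Homomorphisms close to the identity\<close>

context group
begin

lemma subgroup_displacement_mem:
  assumes N: "N \<lhd> G" and h: "h \<in> hom G G"
  shows "subgroup {g \<in> carrier G. displacement G h g \<in> N} G"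
proof -
  interpret normal N G by fact
  interpret h: group_hom G G h by unfold_locales fact
  show ?thesis
  proof (rule subgroupI)
    have "\<one> \<in> {g \<in> carrier G. displacement G h g \<in> N}" by (simp add: displacement_def)
    then show "{g \<in> carrier G. displacement G h g \<in> N} \<noteq> {}" by blast
  next
    fix a assume a: "a \<in> {g \<in> carrier G. displacement G h g \<in> N}"
    then have "inv a \<otimes> inv (displacement G h a) \<otimes> a \<in> N"
      using inv_op_closed1[of a "inv (displacement G h a)"] by simp
    moreover have "inv a \<otimes> inv (displacement G h a) \<otimes> a = displacement G h (inv a)"
      using a by (simp add: displacement_def m_assoc inv_mult_group)
    ultimately show "inv a \<in> {g \<in> carrier G. displacement G h g \<in> N}"
      using a by simp
  next
    fix a b assume "a \<in> {g \<in> carrier G. displacement G h g \<in> N}"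
      "b \<in> {g \<in> carrier G. displacement G h g \<in> N}"
    then show "a \<otimes> b \<in> {g \<in> carrier G. displacement G h g \<in> N}"
      by (simp add: displacement_mult[OF h] inv_op_closed2)
  qed auto
qed

lemma displacement_generate_mem:
  assumes N: "N \<lhd> G" and h: "h \<in> hom G G" and S: "S \<subseteq> carrier G"
    and disp: "\<And>s. s \<in> S \<Longrightarrow> displacement G h s \<in> N" and g: "g \<in> generate G S"
  shows "displacement G h g \<in> N"
proof -
  have "generate G S \<subseteq> {g \<in> carrier G. displacement G h g \<in> N}"
    by (rule generate_subgroup_incl[OF _ subgroup_displacement_mem[OF N h]]) (use S disp in auto)
  then show ?thesis using g by blast
qed

lemma displacement_lcs:
  assumes h: "h \<in> hom G G" and S: "S \<subseteq> carrier G" "generate G S = carrier G" and j: "1 \<le> j"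
    and disp: "\<And>s. s \<in> S \<Longrightarrow> displacement G h s \<in> lcs G (1 + j)"
    and i: "1 \<le> i" and g: "g \<in> lcs G i"
  shows "displacement G h g \<in> lcs G (i + j)"
  using i g
proof (induction i arbitrary: g rule: nat_induct_at_least)
  case base
  then show ?case
    using displacement_generate_mem[OF lcs_normal h S(1) disp] S(2) by simp
next
  case (Suc i)
  have carrier: "displacement G h x \<in> lcs G (1 + j)" if "x \<in> carrier G" for x
    by (rule displacement_generate_mem[OF lcs_normal h S(1) disp]) (use that S in auto)
  have "displacement G h (comm G x y) \<in> lcs G (Suc i + j)"
    if x: "x \<in> lcs G 1" and y: "y \<in> lcs G i" for x y
  proof -
    define w where "w = comm G (displacement G h x) y \<otimes> comm G x (displacement G h y)"
    have xy: "x \<in> carrier G" "y \<in> carrier G" using x y by auto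
    note dx = carrier[OF xy(1)] and dy = Suc.IH[OF y]
    have w: "w \<in> lcs G (Suc i + j)"
      unfolding w_def using comm_lcs_le[OF dx y] comm_lcs_le[OF x dy] Suc.hyps by simp
    have "lcs_class G (Suc i + j) (displacement G h (comm G x y)) = lcs_class G (Suc i + j) w"
      using lcs_class_displacement_comm[OF h _ Suc.hyps j x y dx dy] by (simp add: w_def)
    then show ?thesis
      using h xy by (intro mem_if_lcs_class_eq[OF lcs_subgroup lcs_Suc_subset w]) auto
  qed
  then have "lcs G (Suc i) \<subseteq> {g \<in> carrier G. displacement G h g \<in> lcs G (Suc i + j)}"
    by (intro lcs_Suc_minimal[OF Suc.hyps] subgroup_displacement_mem[OF lcs_normal h]) auto
  then show ?case using Suc.prems by blast
qed

lemma bij_betw_if_displacement: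
  assumes h: "h \<in> hom G G" and nilpotent: "lcs G (Suc c) = {\<one>}"
    and disp: "\<And>i g. 1 \<le> i \<Longrightarrow> g \<in> lcs G i \<Longrightarrow> displacement G h g \<in> lcs G (Suc i)"
  shows "bij_betw h (carrier G) (carrier G)"
proof -
  interpret h: group_hom G G h by unfold_locales fact
  have "g \<in> lcs G (Suc i)" if "g \<in> carrier G" "h g = \<one>" for g i
  proof (induction i)
    case (Suc i)
    have "inv (displacement G h g) \<in> lcs G (Suc (Suc i))" using disp[OF _ Suc] by simp
    then show ?case using that by (simp add: displacement_def)
  qed (use that in simp)
  from this[of _ c] have "inj_on h (carrier G)"
    unfolding h.inj_on_one_iff using nilpotent by simp
  moreover have "lcs G i \<subseteq> h ` carrier G" if "1 \<le> i" "i \<le> Suc c" for i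
    using that(2,1)
  proof (induction i rule: inc_induct)
    case base
    show ?case using nilpotent subgroup.one_closed[OF h.img_is_subgroup] by simp
  next
    case (step i)
    show ?case
    proof
      fix g assume g: "g \<in> lcs G i"
      then have "displacement G h g \<in> h ` carrier G" using step disp by auto
      then have "inv (displacement G h g) \<otimes> h g \<in> h ` carrier G"
        using subgroup.m_closed[OF h.img_is_subgroup subgroup.m_inv_closed[OF h.img_is_subgroup]] g
        by (simp add: lcs_carrier)
      then show "g \<in> h ` carrier G"
        using g by (simp add: displacement_def inv_mult_group m_assoc lcs_carrier)
    qed
  qed
  then have "carrier G \<subseteq> h ` carrier G"
    using lcs_one by (metis Suc_le_mono le0 One_nat_def order_refl)
  ultimately show ?thesis by (auto simp: bij_betw_def)
qed

lemma restrict_hom_andr: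
  assumes h: "h \<in> hom G G" and S: "S \<subseteq> carrier G" "generate G S = carrier G" and j: "1 \<le> j"
    and nilpotent: "lcs G (Suc c) = {\<one>}"
    and disp: "\<And>s. s \<in> S \<Longrightarrow> displacement G h s \<in> lcs G (1 + j)"
  shows "restrict h (carrier G) \<in> andr G j"
proof -
  let ?s = "restrict h (carrier G)"
  have disp_lcs: "displacement G h g \<in> lcs G (i + j)" if "1 \<le> i" "g \<in> lcs G i" for i g
    by (rule displacement_lcs[OF h S j disp that])
  have "displacement G h g \<in> lcs G (Suc i)" if "1 \<le> i" "g \<in> lcs G i" for i g
    using lcs_antimono[OF _ disp_lcs[OF that]] j by simp
  then have "bij_betw h (carrier G) (carrier G)"
    by (rule bij_betw_if_displacement[OF h nilpotent])
  then have "bij_betw ?s (carrier G) (carrier G)" by (simp cong: bij_betw_cong)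
  moreover have "?s \<in> hom G G" using h by (auto simp: hom_def)
  ultimately have "?s \<in> auto G" by (simp add: auto_def Bij_def)
  moreover have "displacement G ?s g = displacement G h g" if "g \<in> lcs G i" for i g
    using that by (simp add: displacement_def lcs_carrier)
  ultimately show ?thesis using disp_lcs by (simp add: mem_andr_iff)
qed

end

section \<open>The reduced Magnus ring\<close>

text \<open>Non-commutative power series modulo the monomials with a repeated letter, encoded by their
  coefficient functions on words.\<close>

typedef (overloaded) ('a, 'r) magnus = "{f :: 'a list \<Rightarrow> 'r::zero. \<forall>w. \<not> distinct w \<longrightarrow> f w = 0}"
  morphisms coef Magnus
  by (rule exI[of _ "\<lambda>_. 0"]) simp

setup_lifting type_definition_magnus

lemma coef_not_distinct [simp]: "\<not> distinct w \<Longrightarrow> coef f w = 0"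
  using coef by auto

lemma magnus_eqI: "(\<And>w. distinct w \<Longrightarrow> coef f w = coef g w) \<Longrightarrow> f = g"
  by (metis coef_inject coef_not_distinct ext)

fun conv :: "('a list \<Rightarrow> 'r) \<Rightarrow> ('a list \<Rightarrow> 'r) \<Rightarrow> 'a list \<Rightarrow> 'r::semiring_0" where
  "conv f g [] = f [] * g []"
| "conv f g (a # w) = f [] * g (a # w) + conv (\<lambda>v. f (a # v)) g w"

lemma conv_add_left: "conv (\<lambda>v. f v + g v) h w = conv f h w + conv g h w"
  by (induction w arbitrary: f g) (simp_all add: algebra_simps)

lemma conv_add_right: "conv h (\<lambda>v. f v + g v) w = conv h f w + conv h g w"
  by (induction w arbitrary: h) (simp_all add: algebra_simps)

lemma conv_scale_left: "conv (\<lambda>v. c * f v) h w = c * conv f h w"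
  by (induction w arbitrary: f) (simp_all add: algebra_simps)

lemma conv_assoc: "conv (conv f g) h w = conv f (conv g h) w"
proof (induction w arbitrary: f)
  case (Cons a w)
  have "conv (\<lambda>v. conv f g (a # v)) h w =
      f [] * conv (\<lambda>v. g (a # v)) h w + conv (conv (\<lambda>v. f (a # v)) g) h w"
    by (simp add: conv_add_left conv_scale_left)
  then show ?case by (simp add: Cons algebra_simps)
qed (simp add: mult.assoc)

lemma conv_cong:
  "(\<And>u v. w = u @ v \<Longrightarrow> f u * g v = f' u * g' v) \<Longrightarrow> conv f g w = conv f' g' w"
proof (induction w arbitrary: f f')
  case Nil
  then show ?case by simp
next
  case (Cons a w)
  have "f [] * g (a # w) = f' [] * g' (a # w)" using Cons.prems[of "[]" "a # w"] by simp
  moreover have "conv (\<lambda>v. f (a # v)) g w = conv (\<lambda>v. f' (a # v)) g' w"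
    by (rule Cons.IH) (use Cons.prems in simp)
  ultimately show ?case by simp
qed

lemma conv_eq_zero:
  assumes "\<And>u v. w = u @ v \<Longrightarrow> f u * g v = 0"
  shows "conv f g w = 0"
proof -
  have "conv f g w = conv (\<lambda>_. 0) g w" using assms by (intro conv_cong) simp
  moreover have "conv (\<lambda>_. 0) g w = 0" by (induction w) simp_all
  ultimately show ?thesis by simp
qed

lemma conv_split:
  assumes "\<And>u v. w @ w' = u @ v \<Longrightarrow> u \<noteq> w \<Longrightarrow> f u * g v = 0"
  shows "conv f g (w @ w') = f w * g w'"
  using assms
proof (induction w arbitrary: f)
  case Nil
  show ?case
  proof (cases w')
    case (Cons a v)
    have "conv (\<lambda>v. f (a # v)) g v = 0"
      by (rule conv_eq_zero) (use Nil[of "a # _"] Cons in simp)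
    then show ?thesis using Cons by simp
  qed simp
next
  case (Cons a w)
  have "f [] * g (a # w @ w') = 0" using Cons.prems[of "[]"] by simp
  moreover have "conv (\<lambda>v. f (a # v)) g (w @ w') = f (a # w) * g w'"
    by (rule Cons.IH) (use Cons.prems[of "a # _"] in simp)
  ultimately show ?case by simp
qed

lemma conv_one:
  fixes f :: "'a list \<Rightarrow> 'r::semiring_1"
  shows "conv (\<lambda>w. if w = [] then 1 else 0) f w = f w" "conv f (\<lambda>w. if w = [] then 1 else 0) w = f w"
  using conv_split[of "[]" w "\<lambda>w. if w = [] then 1 else 0" f]
    conv_split[of w "[]" f "\<lambda>w. if w = [] then 1 else 0"] by simp_all

instantiation magnus :: (type, ring_1) ring_1
begin

lift_definition zero_magnus :: "('a, 'b) magnus" is "\<lambda>_. 0" by simp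
lift_definition one_magnus :: "('a, 'b) magnus" is "\<lambda>w. if w = [] then 1 else 0" by auto
lift_definition plus_magnus :: "('a, 'b) magnus \<Rightarrow> ('a, 'b) magnus \<Rightarrow> ('a, 'b) magnus"
  is "\<lambda>f g w. f w + g w" by simp
lift_definition minus_magnus :: "('a, 'b) magnus \<Rightarrow> ('a, 'b) magnus \<Rightarrow> ('a, 'b) magnus"
  is "\<lambda>f g w. f w - g w" by simp
lift_definition uminus_magnus :: "('a, 'b) magnus \<Rightarrow> ('a, 'b) magnus" is "\<lambda>f w. - f w" by simp
lift_definition times_magnus :: "('a, 'b) magnus \<Rightarrow> ('a, 'b) magnus \<Rightarrow> ('a, 'b) magnus"
  is "\<lambda>f g w. if distinct w then conv f g w else 0" by simp

instance
proof
  fix a b c :: "('a, 'b) magnus"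
  show "a + b + c = a + (b + c)" by transfer (simp add: algebra_simps)
  show "a + b = b + a" by transfer (simp add: algebra_simps)
  show "0 + a = a" by transfer simp
  show "- a + a = 0" by transfer simp
  show "a - b = a + - b" by transfer simp
  show "a * b * c = a * (b * c)"
  proof transfer
    fix a b c :: "'a list \<Rightarrow> 'b"
    have "conv (\<lambda>w. if distinct w then conv a b w else 0) c w = conv (conv a b) c w"
      "conv a (\<lambda>w. if distinct w then conv b c w else 0) w = conv a (conv b c) w"
      if "distinct w" for w
      using that by (auto intro!: conv_cong)
    then show "(\<lambda>w. if distinct w then conv (\<lambda>w. if distinct w then conv a b w else 0) c w else 0) =
      (\<lambda>w. if distinct w then conv a (\<lambda>w. if distinct w then conv b c w else 0) w else 0)"
      by (auto simp: conv_assoc)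
  qed
  show "(a + b) * c = a * c + b * c" by transfer (auto simp: conv_add_left)
  show "a * (b + c) = a * b + a * c" by transfer (auto simp: conv_add_right)
  show "1 * a = a" by transfer (auto simp: conv_one)
  show "a * 1 = a" by transfer (auto simp: conv_one)
  show "(0 :: ('a, 'b) magnus) \<noteq> 1" by transfer (metis zero_neq_one)
qed

end

lift_definition mvar :: "'a \<Rightarrow> ('a, 'r::ring_1) magnus" is "\<lambda>i w. if w = [i] then 1 else 0" by auto

lemma coef_simps [simp]:
  "coef 0 w = 0" "coef (f + g) w = coef f w + coef g w" "coef (f - g) w = coef f w - coef g w"
  "coef (- f) w = - coef f w"
  by (transfer; simp)+

lemma coef_one: "coef 1 w = (if w = [] then 1 else 0)"
  by transfer simp

lemma coef_mvar: "coef (mvar i) w = (if w = [i] then 1 else 0)"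
  by transfer simp

lemma coef_times: "distinct w \<Longrightarrow> coef (f * g) w = conv (coef f) (coef g) w"
  by transfer simp

lemma coef_times_eq_zero:
  assumes "\<And>u v. w = u @ v \<Longrightarrow> coef f u * coef g v = 0"
  shows "coef (f * g) w = 0"
  by (cases "distinct w") (use assms in \<open>auto simp: coef_times intro: conv_eq_zero\<close>)

lemma coef_mvar_times:
  "coef (mvar i * f) w = (if distinct w \<and> w \<noteq> [] \<and> hd w = i then coef f (tl w) else 0)"
proof (cases w)
  case (Cons a v)
  have "conv (coef (mvar i)) (coef f) ([a] @ v) = coef (mvar i) [a] * coef f v"
    by (rule conv_split) (auto simp: coef_mvar)
  then show ?thesis using Cons by (cases "distinct w") (auto simp: coef_times coef_mvar)
qed (simp add: coef_times coef_mvar)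

lemma coef_times_mvar:
  "coef (f * mvar i) w = (if distinct w \<and> w \<noteq> [] \<and> last w = i then coef f (butlast w) else 0)"
proof (cases w rule: rev_cases)
  case (snoc v a)
  have "conv (coef f) (coef (mvar i)) (v @ [a]) = coef f v * coef (mvar i) [a]"
    by (rule conv_split) (auto simp: coef_mvar)
  then show ?thesis using snoc by (cases "distinct w") (auto simp: coef_times coef_mvar)
qed (simp add: coef_times coef_mvar)

lemma mvar_times_mvar_zero: "mvar i * f * mvar i = 0"
proof (rule magnus_eqI)
  fix w :: "'a list" assume w: "distinct w"
  show "coef (mvar i * f * mvar i) w = coef (0 :: ('a, 'b) magnus) w"
  proof (cases w rule: rev_cases)
    case (snoc v a)
    then show ?thesis using w by (auto simp: coef_times_mvar coef_mvar_times)
  qed (simp add: coef_times_mvar)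
qed

definition deg_ge :: "nat \<Rightarrow> ('a, 'r::ring_1) magnus \<Rightarrow> bool" where
  "deg_ge m f \<longleftrightarrow> (\<forall>w. length w < m \<longrightarrow> coef f w = 0)"

lemma deg_ge_closed [simp, intro]:
  "deg_ge m 0" "deg_ge m f \<Longrightarrow> deg_ge m g \<Longrightarrow> deg_ge m (f + g)"
  "deg_ge m f \<Longrightarrow> deg_ge m g \<Longrightarrow> deg_ge m (f - g)" "deg_ge m f \<Longrightarrow> deg_ge m (- f)"
  by (simp_all add: deg_ge_def)

lemma deg_ge_0 [simp]: "deg_ge 0 f"
  by (simp add: deg_ge_def)

lemma deg_ge_mono: "deg_ge m f \<Longrightarrow> k \<le> m \<Longrightarrow> deg_ge k f"
  by (simp add: deg_ge_def)

lemma deg_ge_mvar: "deg_ge 1 (mvar i)"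
  by (auto simp: deg_ge_def coef_mvar)

lemma deg_ge_times:
  assumes "deg_ge i f" "deg_ge j g" "m \<le> i + j"
  shows "deg_ge m (f * g)"
  unfolding deg_ge_def
proof (intro allI impI coef_times_eq_zero)
  fix w u v :: "'a list" assume "length w < m" "w = u @ v"
  then have "length u < i \<or> length v < j" using assms(3) by auto
  then show "coef f u * coef g v = 0" using assms by (auto simp: deg_ge_def)
qed

lemma deg_ge_inverse:
  assumes "deg_ge m (f - 1)" "f * f' = 1"
  shows "deg_ge m (f' - 1)"
proof -
  have "f' - 1 = - ((f - 1) * f')" using assms(2) by (simp add: algebra_simps)
  then show ?thesis using deg_ge_times[OF assms(1), of 0 f' m] by simp
qed

lemma deg_ge_product:
  assumes "deg_ge m (f - 1)" "deg_ge m (g - 1)"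
  shows "deg_ge m (f * g - 1)"
proof -
  have "deg_ge m ((f - 1) * g + (g - 1))"
    using deg_ge_times[OF assms(1), of 0 g m] assms(2) by simp
  then show ?thesis by (simp add: algebra_simps)
qed

text \<open>The reason is the identity \<open>f g f' g' - 1 = (f g - g f) f' g'\<close>.\<close>

lemma deg_ge_commutator:
  assumes i: "1 \<le> i" and j: "1 \<le> j" and f: "deg_ge i (f - 1)" and g: "deg_ge j (g - 1)"
    and inv: "f * f' = 1" "g * g' = 1" "f' * f = 1" "g' * g = 1"
  shows "deg_ge (Suc (i + j)) (f * g * f' * g' - 1 - ((f - 1) * (g - 1) - (g - 1) * (f - 1)))"
proof -
  have lie: "(f - 1) * (g - 1) - (g - 1) * (f - 1) = f * g - g * f" by (simp add: algebra_simps)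
  have "deg_ge (i + j) ((f - 1) * (g - 1) - (g - 1) * (f - 1))"
    using deg_ge_times[OF f g] deg_ge_times[OF g f] by simp
  moreover have "deg_ge 1 (f' * g' - 1)"
    using deg_ge_inverse[OF f inv(1)] deg_ge_inverse[OF g inv(2)] i j
    by (intro deg_ge_product) (auto intro: deg_ge_mono)
  ultimately have "deg_ge (Suc (i + j)) ((f * g - g * f) * (f' * g' - 1))"
    unfolding lie by (rule deg_ge_times) simp
  moreover have "g * (f * (f' * g')) = 1"
    using inv by (metis mult.assoc mult_1)
  then have "f * g * f' * g' - 1 - (f * g - g * f) = (f * g - g * f) * (f' * g' - 1)"
    by (simp add: algebra_simps)
  ultimately show ?thesis unfolding lie by simp
qed

fun magnus_bracket :: "'a list \<Rightarrow> 'a \<Rightarrow> ('a, 'r::ring_1) magnus" where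
  "magnus_bracket [] s = mvar s"
| "magnus_bracket (a # u) s = mvar a * magnus_bracket u s - magnus_bracket u s * mvar a"

lemma magnus_bracket_support:
  "coef (magnus_bracket u s :: ('a, 'r::ring_1) magnus) w \<noteq> 0 \<Longrightarrow> set w = insert s (set u)"
proof (induction u arbitrary: w)
  case Nil
  then show ?case by (auto simp: coef_mvar split: if_splits)
next
  case (Cons a u)
  let ?f = "magnus_bracket u s :: ('a, 'r) magnus"
  consider "coef (mvar a * ?f) w \<noteq> 0" | "coef (?f * mvar a) w \<noteq> 0"
    using Cons.prems by (cases "coef (mvar a * ?f) w = 0") auto
  then show ?case
  proof cases
    case 1
    then have "w = a # tl w" "coef ?f (tl w) \<noteq> 0"
      by (auto simp: coef_mvar_times split: if_splits)
    then show ?thesis using Cons.IH[of "tl w"] by (metis insert_commute list.simps(15))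
  next
    case 2
    then have "w = butlast w @ [a]" "coef ?f (butlast w) \<noteq> 0"
      by (auto simp: coef_times_mvar split: if_splits)
    then show ?thesis
      using Cons.IH[of "butlast w"]
      by (metis insert_commute list.simps(15) rotate1.simps(2) set_rotate1)
  qed
qed

lemma coef_magnus_bracket_last:
  assumes "distinct (u @ [s])" "distinct (v @ [s])"
  shows "coef (magnus_bracket u s) (v @ [s]) = (if v = u then 1 else 0)"
  using assms
proof (induction u arbitrary: v)
  case Nil
  then show ?case by (simp add: coef_mvar)
next
  case (Cons a u)
  then show ?case by (cases v) (auto simp: coef_times_mvar coef_mvar_times)
qed

lift_definition kill :: "'a \<Rightarrow> ('a, 'r::ring_1) magnus \<Rightarrow> ('a, 'r) magnus" is
  "\<lambda>i f w. if i \<in> set w then 0 else f w" by auto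

lemma coef_kill: "coef (kill i f) w = (if i \<in> set w then 0 else coef f w)"
  by transfer simp

lemma kill_times: "kill i (f * g) = kill i f * kill i g"
proof (rule magnus_eqI)
  fix w :: "'a list" assume w: "distinct w"
  show "coef (kill i (f * g)) w = coef (kill i f * kill i g) w"
  proof (cases "i \<in> set w")
    case True
    then have "coef (kill i f * kill i g) w = 0"
      by (intro coef_times_eq_zero) (auto simp: coef_kill)
    then show ?thesis using True by (simp add: coef_kill)
  next
    case False
    then show ?thesis using w by (auto simp: coef_kill coef_times intro!: conv_cong)
  qed
qed

lemma kill_one: "kill i 1 = 1"
  by (rule magnus_eqI) (auto simp: coef_kill coef_one)

lemma kill_one_plus_mvar: "kill i (1 + mvar k) = (if k = i then 1 else 1 + mvar k)"
  by (rule magnus_eqI) (auto simp: coef_kill coef_one coef_mvar)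

definition mult_monoid :: "'a::monoid_mult monoid" where
  "mult_monoid = \<lparr>carrier = UNIV, monoid.mult = (*), one = 1\<rparr>"

abbreviation magnus_units :: "('a, 'r::ring_1) magnus monoid" where
  "magnus_units \<equiv> units_of mult_monoid"

lemma monoid_mult_monoid: "monoid mult_monoid"
  by unfold_locales (simp_all add: mult_monoid_def mult.assoc)

lemma group_units_of_mult_monoid: "group (units_of mult_monoid)"
  by (rule monoid.units_group[OF monoid_mult_monoid])

lemma units_of_mult_monoid_simps:
  "u \<otimes>\<^bsub>units_of mult_monoid\<^esub> v = u * v"
  "\<one>\<^bsub>units_of mult_monoid\<^esub> = 1"
  "u \<in> carrier (units_of mult_monoid) \<longleftrightarrow> (\<exists>v. v * u = 1 \<and> u * v = 1)"
  by (auto simp: units_of_def Units_def mult_monoid_def)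

lemma one_plus_mvar_closed: "1 + mvar i \<in> carrier magnus_units"
proof -
  have "mvar i * mvar i = (0 :: ('a, 'b) magnus)"
    using mvar_times_mvar_zero[of i 1] by simp
  then have "(1 - mvar i) * (1 + mvar i) = (1 :: ('a, 'b) magnus)"
    "(1 + mvar i) * (1 - mvar i) = (1 :: ('a, 'b) magnus)"
    by (simp_all add: algebra_simps)
  then show ?thesis unfolding units_of_mult_monoid_simps by blast
qed

text \<open>A conjugate of \<open>1 + X\<^sub>i\<close> is \<open>1 + u X\<^sub>i u\<inverse>\<close>, and \<open>X\<^sub>i u X\<^sub>i = 0\<close>.\<close>

lemma one_plus_mvar_commutes_with_conjugates: "commutes_with_conjugates magnus_units (1 + mvar i)"
  unfolding commutes_with_conjugates_def
proof
  interpret U: group "magnus_units :: ('a, 'b) magnus monoid" by (rule group_units_of_mult_monoid)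
  fix u :: "('a, 'b) magnus" assume u: "u \<in> carrier magnus_units"
  let ?X = "mvar i :: ('a, 'b) magnus" and ?v = "inv\<^bsub>magnus_units\<^esub> u"
  let ?c = "u \<otimes>\<^bsub>magnus_units\<^esub> (1 + ?X) \<otimes>\<^bsub>magnus_units\<^esub> ?v"
  have "u * ?v = 1" using U.r_inv[OF u] by (simp add: units_of_mult_monoid_simps)
  then have conj: "?c = 1 + u * ?X * ?v" by (simp add: units_of_mult_monoid_simps algebra_simps)
  have "?X * (u * ?X * ?v) = 0" "u * ?X * ?v * ?X = 0"
    using mvar_times_mvar_zero[of i u] mvar_times_mvar_zero[of i ?v]
    by (simp_all add: mult.assoc[symmetric]) (simp add: mult.assoc)
  then have "(1 + ?X) * ?c = ?c * (1 + ?X)"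
    unfolding conj by (simp add: distrib_left distrib_right)
  moreover have "?c \<in> carrier magnus_units"
    by (intro U.m_closed U.inv_closed one_plus_mvar_closed u)
  ultimately show "comm magnus_units (1 + ?X) ?c = \<one>\<^bsub>magnus_units\<^esub>"
    unfolding U.comm_eq_one_iff[OF one_plus_mvar_closed \<open>?c \<in> _\<close>]
    by (simp only: units_of_mult_monoid_simps(1))
qed

lemma kill_hom: "kill i \<in> hom magnus_units magnus_units"
proof (rule homI)
  fix f :: "('a, 'b) magnus" assume "f \<in> carrier magnus_units"
  then show "kill i f \<in> carrier magnus_units"
    unfolding units_of_mult_monoid_simps by (metis kill_one kill_times)
qed (simp add: units_of_mult_monoid_simps(1) kill_times)

section \<open>Groups generated by elements commuting with their conjugates\<close>

locale reduced_group = group G for G (structure) +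
  fixes n :: nat and x :: "nat \<Rightarrow> 'a"
  assumes x_closed [intro, simp]: "i < n \<Longrightarrow> x i \<in> carrier G"
    and generated: "generate G (x ` {..<n}) = carrier G"
    and reduced: "i < n \<Longrightarrow> commutes_with_conjugates G (x i)"
begin

definition ncl :: "nat \<Rightarrow> 'a set" where
  "ncl i = normal_closure G {x i}"

lemma ncl_normal: "i < n \<Longrightarrow> ncl i \<lhd> G"
  unfolding ncl_def by (rule normal_closure_normal) simp

lemma x_in_ncl: "i < n \<Longrightarrow> x i \<in> ncl i"
  unfolding ncl_def using normal_closure_incl[of "{x i}"] by simp

lemma ncl_commutes: "i < n \<Longrightarrow> a \<in> ncl i \<Longrightarrow> b \<in> ncl i \<Longrightarrow> comm G a b = \<one>"
  unfolding ncl_def by (rule normal_closure_commutes[OF x_closed reduced])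

lemma ncl_commutes_with_conjugates:
  assumes "i < n" "y \<in> ncl i"
  shows "commutes_with_conjugates G y"
  using ncl_commutes[OF assms] normal.inv_op_closed2[OF ncl_normal[OF assms(1)] _ assms(2)]
  by (simp add: commutes_with_conjugates_def)

definition ncl_inter :: "nat set \<Rightarrow> 'a set" where
  "ncl_inter S = {a \<in> carrier G. \<forall>i\<in>S. a \<in> ncl i}"

definition weight_subgroup :: "nat \<Rightarrow> 'a set" where
  "weight_subgroup m = generate G (\<Union>S\<in>{S. S \<subseteq> {..<n} \<and> card S = m}. ncl_inter S)"

lemma weight_subgroup_normal: "weight_subgroup m \<lhd> G"
  unfolding weight_subgroup_def
proof (rule normal_generateI)
  fix h g assume h: "h \<in> (\<Union>S\<in>{S. S \<subseteq> {..<n} \<and> card S = m}. ncl_inter S)" and g: "g \<in> carrier G"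
  then obtain S where S: "S \<subseteq> {..<n}" "card S = m" "h \<in> ncl_inter S" by auto
  then have "g \<otimes> h \<otimes> inv g \<in> ncl_inter S"
    using g normal.inv_op_closed2[OF ncl_normal _, of _ g h] by (auto simp: ncl_inter_def)
  then show "g \<otimes> h \<otimes> inv g \<in> (\<Union>S\<in>{S. S \<subseteq> {..<n} \<and> card S = m}. ncl_inter S)"
    using S by blast
qed (auto simp: ncl_inter_def)

lemma ncl_inter_subset_weight_subgroup:
  "S \<subseteq> {..<n} \<Longrightarrow> b \<in> ncl_inter S \<Longrightarrow> b \<in> weight_subgroup (card S)"
  unfolding weight_subgroup_def by (intro generate.incl) blast

lemma comm_x_ncl_inter:
  assumes i: "i < n" and S: "S \<subseteq> {..<n}" and b: "b \<in> ncl_inter S"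
  shows "comm G (x i) b \<in> weight_subgroup (Suc (card S))"
proof (cases "i \<in> S")
  case True
  then have "comm G (x i) b = \<one>"
    using ncl_commutes[OF i x_in_ncl[OF i]] b by (simp add: ncl_inter_def)
  then show ?thesis by (simp add: weight_subgroup_def generate.one)
next
  case False
  have "comm G (x i) b \<in> ncl i"
    using comm_normal_left[OF ncl_normal[OF i] x_in_ncl[OF i]] b by (simp add: ncl_inter_def)
  moreover have "comm G (x i) b \<in> ncl k" if "k \<in> S" for k
    using comm_normal_right[OF ncl_normal x_closed[OF i]] that b S by (auto simp: ncl_inter_def)
  ultimately have "comm G (x i) b \<in> ncl_inter (insert i S)"
    using b i by (simp add: ncl_inter_def)
  moreover have "card (insert i S) = Suc (card S)"
    using False S finite_subset[OF S] by simp
  ultimately show ?thesis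
    using ncl_inter_subset_weight_subgroup[of "insert i S"] i S by simp
qed

lemma lcs_subset_weight_subgroup:
  assumes "1 \<le> m"
  shows "lcs G m \<subseteq> weight_subgroup m"
  using assms
proof (induction m rule: nat_induct_at_least)
  case base
  have "x i \<in> weight_subgroup 1" if "i < n" for i
    using ncl_inter_subset_weight_subgroup[of "{i}" "x i"] that x_in_ncl
    by (simp add: ncl_inter_def)
  then have "generate G (x ` {..<n}) \<subseteq> weight_subgroup 1"
    by (intro generate_subgroup_incl[OF _ normal_imp_subgroup[OF weight_subgroup_normal]]) auto
  then show ?case by (simp add: generated)
next
  case (Suc m)
  show ?case
  proof (rule lcs_Suc_minimal[OF Suc.hyps normal_imp_subgroup[OF weight_subgroup_normal]])
    fix a b assume a: "a \<in> carrier G" and b: "b \<in> lcs G m"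
    show "comm G a b \<in> weight_subgroup (Suc m)"
    proof (rule comm_generate_mem[OF weight_subgroup_normal])
      show "a \<in> generate G (x ` {..<n})" using a generated by simp
      show "b \<in> generate G (\<Union>S\<in>{S. S \<subseteq> {..<n} \<and> card S = m}. ncl_inter S)"
        using b Suc.IH by (auto simp: weight_subgroup_def)
      fix y c assume "y \<in> x ` {..<n}" and c: "c \<in> (\<Union>S\<in>{S. S \<subseteq> {..<n} \<and> card S = m}. ncl_inter S)"
      then obtain i where "i < n" "y = x i" by auto
      then show "comm G y c \<in> weight_subgroup (Suc m)"
        using c comm_x_ncl_inter by auto
    qed (auto simp: ncl_inter_def)
  qed
qed

lemma lcs_trivial: "lcs G (Suc n) = {\<one>}"
proof -
  have "card S \<noteq> Suc n" if "S \<subseteq> {..<n}" for S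
    using card_mono[OF _ that] by auto
  then have "{S. S \<subseteq> {..<n} \<and> card S = Suc n} = {}" by blast
  then have "weight_subgroup (Suc n) = {\<one>}"
    unfolding weight_subgroup_def by (simp only: UN_empty generate_empty)
  then show ?thesis using lcs_subset_weight_subgroup[of "Suc n"] by auto
qed

definition ad :: "nat list \<Rightarrow> 'a \<Rightarrow> 'a" where
  "ad u z = foldr (\<lambda>a. comm G (x a)) u z"

lemma ad_simps [simp]:
  "ad [] z = z" "ad (a # u) z = comm G (x a) (ad u z)" "ad (u @ v) z = ad u (ad v z)"
  by (simp_all add: ad_def)

lemma ad_closed: "set u \<subseteq> {..<n} \<Longrightarrow> z \<in> carrier G \<Longrightarrow> ad u z \<in> carrier G"
  by (induction u) auto

lemma ad_lcs: "set u \<subseteq> {..<n} \<Longrightarrow> 1 \<le> k \<Longrightarrow> z \<in> lcs G k \<Longrightarrow> ad u z \<in> lcs G (length u + k)"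
  by (induction u) (auto intro: comm_lcs_Suc)

lemma ad_ncl:
  assumes "i < n" "set u \<subseteq> {..<n}" "z \<in> carrier G" "i \<in> set u \<or> z \<in> ncl i"
  shows "ad u z \<in> ncl i"
  using assms
proof (induction u)
  case (Cons a u)
  show ?case
  proof (cases "a = i")
    case True
    then show ?thesis
      using comm_normal_left[OF ncl_normal x_in_ncl] ad_closed[of u z] Cons.prems by simp
  next
    case False
    then show ?thesis using comm_normal_right[OF ncl_normal] Cons by simp
  qed
qed simp

definition ad_span :: "nat set \<Rightarrow> 'a \<Rightarrow> nat \<Rightarrow> 'a set" where
  "ad_span A z k = generate G ({ad v z | v. distinct v \<and> set v = A} \<union> lcs G (Suc (card A + k)))"

lemma ad_in_ad_span: "distinct v \<Longrightarrow> set v = A \<Longrightarrow> ad v z \<in> ad_span A z k"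
  unfolding ad_span_def by (intro generate.incl) blast

lemma lcs_Suc_subset_ad_span: "lcs G (Suc (card A + k)) \<subseteq> ad_span A z k"
  unfolding ad_span_def by (auto intro: generate.incl)

lemma ad_span_generators_subset:
  assumes "A \<subseteq> {..<n}" "1 \<le> k" "z \<in> lcs G k"
  shows "{ad v z | v. distinct v \<and> set v = A} \<union> lcs G (Suc (card A + k)) \<subseteq> lcs G (card A + k)"
proof (rule Un_least[OF _ lcs_Suc_subset], clarify)
  fix v :: "nat list" assume "distinct v" "A = set v"
  then show "ad v z \<in> lcs G (card (set v) + k)"
    using ad_lcs[of v k z] assms by (simp add: distinct_card)
qed

lemma ad_span_normal:
  assumes "A \<subseteq> {..<n}" "1 \<le> k" "z \<in> lcs G k"
  shows "ad_span A z k \<lhd> G"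
proof (rule normal_between_lcs[OF _ _ lcs_Suc_subset_ad_span])
  note generators = ad_span_generators_subset[OF assms]
  show "subgroup (ad_span A z k) G"
    unfolding ad_span_def
    by (rule generate_is_subgroup[OF subset_trans[OF generators subgroup.subset[OF lcs_subgroup]]])
  show "ad_span A z k \<subseteq> lcs G (card A + k)"
    unfolding ad_span_def by (rule generate_subgroup_incl[OF generators lcs_subgroup])
qed (use assms in simp)

lemma comm_x_ad_span:
  assumes A: "A \<subseteq> {..<n}" and b: "b < n" "b \<notin> A" and z: "1 \<le> k" "z \<in> lcs G k"
    and c: "c \<in> ad_span A z k"
  shows "comm G (x b) c \<in> ad_span (insert b A) z k"
proof (rule comm_generate_mem[OF ad_span_normal])
  show "x b \<in> generate G {x b}" by (simp add: generate.incl)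
  show "c \<in> generate G ({ad v z | v. distinct v \<and> set v = A} \<union> lcs G (Suc (card A + k)))"
    using c by (simp add: ad_span_def)
  show "{ad v z | v. distinct v \<and> set v = A} \<union> lcs G (Suc (card A + k)) \<subseteq> carrier G"
    using ad_span_generators_subset[OF A z] subgroup.subset[OF lcs_subgroup] by blast
  fix a d assume "a \<in> {x b}"
    and "d \<in> {ad v z | v. distinct v \<and> set v = A} \<union> lcs G (Suc (card A + k))"
  then consider v where "distinct v" "set v = A" "d = ad v z"
    | "d \<in> lcs G (Suc (card A + k))" by blast
  then show "comm G a d \<in> ad_span (insert b A) z k"
  proof cases
    case 1
    then show ?thesis using ad_in_ad_span[of "b # v"] b(2) \<open>a \<in> {x b}\<close> by simp
  next
    case 2
    moreover have "card (insert b A) = Suc (card A)" using b(2) finite_subset[OF A] by simp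
    ultimately show ?thesis
      using comm_lcs_Suc[of _ "x b" d] lcs_Suc_subset_ad_span[of "insert b A"] b(1) \<open>a \<in> {x b}\<close>
      by auto
  qed
qed (use A b z in auto)

lemma ad_span_comm_x_subset:
  assumes A: "A \<subseteq> {..<n}" and b: "b < n" "b \<notin> A" and z: "1 \<le> k" "z \<in> lcs G k"
  shows "ad_span A (comm G (x b) z) (Suc k) \<subseteq> ad_span (insert b A) z k"
  unfolding ad_span_def[of A]
proof (rule generate_subgroup_incl[OF Un_least])
  show "{ad v (comm G (x b) z) | v. distinct v \<and> set v = A} \<subseteq> ad_span (insert b A) z k"
  proof clarify
    fix v :: "nat list" assume "distinct v" "A = set v"
    then show "ad v (comm G (x b) z) \<in> ad_span (insert b (set v)) z k"
      using ad_in_ad_span[of "v @ [b]"] b(2) by simp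
  qed
  have "card (insert b A) = Suc (card A)" using b(2) finite_subset[OF A] by simp
  then show "lcs G (Suc (card A + Suc k)) \<subseteq> ad_span (insert b A) z k"
    using lcs_Suc_subset_ad_span[of "insert b A" k] by simp
  show "subgroup (ad_span (insert b A) z k) G"
    by (rule normal_imp_subgroup[OF ad_span_normal]) (use A b z in auto)
qed

lemma comm_x_in_ad_span:
  assumes "s < n" "1 \<le> k" "z \<in> lcs G k"
  shows "comm G z (x s) \<in> ad_span {s} z k"
proof -
  have "ad [s] z \<in> ad_span {s} z k" by (rule ad_in_ad_span) auto
  then have "inv (ad [s] z) \<in> ad_span {s} z k"
    using subgroup.m_inv_closed[OF normal_imp_subgroup[OF ad_span_normal]] assms by simp
  then show ?thesis using inv_comm[of "x s" z] assms by (simp add: lcs_carrier)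
qed

text \<open>In an iterated commutator the letter \<open>z\<close> can be moved to the innermost position.\<close>

lemma comm_ad_in_ad_span:
  assumes "distinct (u @ [s])" "set (u @ [s]) \<subseteq> {..<n}" "1 \<le> k" "z \<in> lcs G k"
  shows "comm G z (ad u (x s)) \<in> ad_span (set (u @ [s])) z k"
  using assms
proof (induction u arbitrary: z k)
  case Nil
  then show ?case using comm_x_in_ad_span by simp
next
  case (Cons b u)
  define A t where "A = set (u @ [s])" and "t = ad u (x s)"
  define L where "L = ad_span (insert b A) z k"
  have b: "b < n" "b \<notin> A" and A: "A \<subseteq> {..<n}" "distinct (u @ [s])" and s: "s < n"
    using Cons.prems by (auto simp: A_def)
  have closed: "z \<in> carrier G" "x b \<in> carrier G" using b Cons.prems(4) by auto
  have t: "t \<in> lcs G (length u + 1)" "t \<in> carrier G"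
    unfolding t_def using ad_lcs[of u 1 "x s"] A s by (auto simp: A_def)
  have L: "L \<lhd> G"
    unfolding L_def by (rule ad_span_normal) (use A b Cons.prems in auto)
  have "comm G (comm G (x b) z) t \<in> ad_span A (comm G (x b) z) (Suc k)"
    unfolding t_def A_def
    using A s Cons.prems(3) comm_lcs_Suc[OF Cons.prems(3) closed(2) Cons.prems(4)]
    by (intro Cons.IH) (auto simp: A_def)
  then have bz: "comm G (comm G (x b) z) t \<in> L"
    using ad_span_comm_x_subset[OF A(1) b Cons.prems(3,4)] by (auto simp: L_def)
  have "comm G z t \<in> ad_span A z k"
    unfolding t_def A_def by (rule Cons.IH) (use A s Cons.prems in auto)
  then have zt: "comm G (x b) (comm G z t) \<in> L"
    unfolding L_def by (rule comm_x_ad_span[OF A(1) b Cons.prems(3,4)])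
  have "card (insert b A) = length u + 2"
    using distinct_card[of "b # u @ [s]"] Cons.prems(1) by (simp add: A_def)
  then have "lcs G (Suc (1 + (length u + 1) + k)) \<subseteq> L"
    using lcs_Suc_subset_ad_span[of "insert b A" k z] by (simp add: L_def)
  then have "comm G z (comm G (x b) t) \<in> L"
    by (rule comm_comm_mem_jacobi[OF L _ _ _ _ _ t(1) Cons.prems(4) bz zt])
      (use closed Cons.prems(3) in auto)
  then show ?case by (simp add: L_def A_def t_def)
qed

definition basic :: "nat \<Rightarrow> (nat list \<times> nat) set" where
  "basic m = {(u, s). distinct (u @ [s]) \<and> s < n \<and> (\<forall>a\<in>set u. a < s) \<and> Suc (length u) = m}"

definition basic_span :: "nat \<Rightarrow> 'a set" where
  "basic_span m = generate G ((\<lambda>(u, s). ad u (x s)) ` basic m \<union> lcs G (Suc m))"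

lemma finite_basic: "finite (basic m)"
proof (rule finite_subset)
  show "basic m \<subseteq> {u. set u \<subseteq> {..<n} \<and> length u = m - 1} \<times> {..<n}"
    by (auto simp: basic_def)
  show "finite ({u. set u \<subseteq> {..<n} \<and> length u = m - 1} \<times> {..<n})"
    by (intro finite_cartesian_product finite_lists_length_eq) auto
qed

lemma basic_ad_lcs: "(u, s) \<in> basic m \<Longrightarrow> ad u (x s) \<in> lcs G m"
  using ad_lcs[of u 1 "x s"] by (fastforce simp: basic_def)

lemma basic_span_generators_subset: "(\<lambda>(u, s). ad u (x s)) ` basic m \<union> lcs G (Suc m) \<subseteq> lcs G m"
  using basic_ad_lcs by (intro Un_least lcs_Suc_subset) auto

lemma basic_in_basic_span: "(u, s) \<in> basic m \<Longrightarrow> ad u (x s) \<in> basic_span m"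
  unfolding basic_span_def by (intro generate.incl UnI1 image_eqI[of _ _ "(u, s)"]) auto

lemma lcs_Suc_subset_basic_span: "lcs G (Suc m) \<subseteq> basic_span m"
  unfolding basic_span_def by (auto intro: generate.incl)

lemma basic_span_normal:
  assumes "1 \<le> m"
  shows "basic_span m \<lhd> G"
proof (rule normal_between_lcs[OF _ assms lcs_Suc_subset_basic_span])
  show "subgroup (basic_span m) G"
    unfolding basic_span_def
    by (rule generate_is_subgroup[OF subset_trans[OF basic_span_generators_subset
      subgroup.subset[OF lcs_subgroup]]])
  show "basic_span m \<subseteq> lcs G m"
    unfolding basic_span_def
    by (rule generate_subgroup_incl[OF basic_span_generators_subset lcs_subgroup])
qed

lemma comm_x_basic:
  assumes i: "i < n" and us: "(u, s) \<in> basic m"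
  shows "comm G (x i) (ad u (x s)) \<in> basic_span (Suc m)"
proof -
  have u: "distinct (u @ [s])" "\<forall>a\<in>set u. a < s" "Suc (length u) = m" "s < n" "set u \<subseteq> {..<n}"
    using us by (auto simp: basic_def)
  consider "i \<in> set (u @ [s])" | "i < s" "i \<notin> set u" | "s < i"
    by (metis Un_iff insertI1 linorder_neqE_nat list.simps(15) set_append)
  then show ?thesis
  proof cases
    case 1
    then have "ad u (x s) \<in> ncl i"
      using ad_ncl[OF i u(5), of "x s"] u(4) x_in_ncl[OF i] by auto
    then have "comm G (x i) (ad u (x s)) = \<one>"
      by (rule ncl_commutes[OF i x_in_ncl[OF i]])
    then show ?thesis by (simp add: basic_span_def generate.one)
  next
    case 2
    then have "(i # u, s) \<in> basic (Suc m)" using u by (simp add: basic_def)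
    from basic_in_basic_span[OF this] show ?thesis by simp
  next
    case 3
    have card: "card (set (u @ [s])) = m" using distinct_card[OF u(1)] u(3) by simp
    have "(v, i) \<in> basic (Suc m)" if "distinct v" "set v = set (u @ [s])" for v
      using that distinct_card[OF that(1)] card 3 i u(2) by (auto simp: basic_def)
    then have "{ad v (x i) | v. distinct v \<and> set v = set (u @ [s])} \<subseteq>
        (\<lambda>(u, s). ad u (x s)) ` basic (Suc m)"
      by force
    then have "ad_span (set (u @ [s])) (x i) 1 \<subseteq> basic_span (Suc m)"
      unfolding ad_span_def basic_span_def card by (intro mono_generate Un_mono) auto
    moreover have "comm G (x i) (ad u (x s)) \<in> ad_span (set (u @ [s])) (x i) 1"
      by (rule comm_ad_in_ad_span[OF u(1)]) (use u i in auto)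
    ultimately show ?thesis by blast
  qed
qed

lemma lcs_subset_basic_span:
  assumes "1 \<le> m"
  shows "lcs G m \<subseteq> basic_span m"
  using assms
proof (induction m rule: nat_induct_at_least)
  case base
  have "x s \<in> basic_span 1" if "s < n" for s
    using basic_in_basic_span[of "[]" s 1] that by (simp add: basic_def)
  then have "generate G (x ` {..<n}) \<subseteq> basic_span 1"
    by (intro generate_subgroup_incl[OF _ normal_imp_subgroup[OF basic_span_normal]]) auto
  then show ?case by (simp add: generated)
next
  case (Suc m)
  have L: "basic_span (Suc m) \<lhd> G" by (rule basic_span_normal) simp
  show ?case
  proof (rule lcs_Suc_minimal[OF Suc.hyps normal_imp_subgroup[OF L]])
    fix a b assume a: "a \<in> carrier G" and b: "b \<in> lcs G m"
    show "comm G a b \<in> basic_span (Suc m)"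
    proof (rule comm_generate_mem[OF L])
      show "a \<in> generate G (x ` {..<n})" using a generated by simp
      show "b \<in> generate G ((\<lambda>(u, s). ad u (x s)) ` basic m \<union> lcs G (Suc m))"
        using b Suc.IH by (auto simp: basic_span_def)
      show "(\<lambda>(u, s). ad u (x s)) ` basic m \<union> lcs G (Suc m) \<subseteq> carrier G"
        using basic_span_generators_subset subgroup.subset[OF lcs_subgroup] by blast
      fix y c assume "y \<in> x ` {..<n}"
        and c: "c \<in> (\<lambda>(u, s). ad u (x s)) ` basic m \<union> lcs G (Suc m)"
      then obtain i where i: "i < n" "y = x i" by auto
      have "comm G (x i) c \<in> basic_span (Suc m)" if "c \<in> lcs G (Suc m)"
        using comm_lcs_Suc[OF _ x_closed[OF i(1)] that] lcs_Suc_subset_basic_span[of "Suc m"]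
        by auto
      then show "comm G y c \<in> basic_span (Suc m)"
        using c comm_x_basic[OF i(1)] i(2) by auto
    qed auto
  qed
qed

end

section \<open>Leading terms of a Magnus representation\<close>

locale reduced_magnus = reduced_group +
  fixes mu :: "'a \<Rightarrow> (nat, int) magnus"
  assumes mu_hom: "mu \<in> hom G magnus_units"
    and mu_gen: "i < n \<Longrightarrow> mu (x i) = 1 + mvar i"
begin

lemma mu_mult: "g \<in> carrier G \<Longrightarrow> h \<in> carrier G \<Longrightarrow> mu (g \<otimes> h) = mu g * mu h"
  using hom_mult[OF mu_hom] by (simp add: units_of_mult_monoid_simps(1))

lemma mu_one [simp]: "mu \<one> = 1"
  using hom_one[OF mu_hom is_group group_units_of_mult_monoid]
  by (simp add: units_of_mult_monoid_simps(2))

lemma mu_inv: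
  "g \<in> carrier G \<Longrightarrow> mu g * mu (inv g) = 1" "g \<in> carrier G \<Longrightarrow> mu (inv g) * mu g = 1"
  by (simp_all flip: mu_mult)

lemma mu_comm:
  "g \<in> carrier G \<Longrightarrow> h \<in> carrier G \<Longrightarrow> mu (comm G g h) = mu g * mu h * mu (inv g) * mu (inv h)"
  by (simp add: comm_def mu_mult)

lemma subgroup_deg_ge: "subgroup {g \<in> carrier G. deg_ge m (mu g - 1)} G"
proof (rule subgroupI)
  have "\<one> \<in> {g \<in> carrier G. deg_ge m (mu g - 1)}" by simp
  then show "{g \<in> carrier G. deg_ge m (mu g - 1)} \<noteq> {}" by blast
next
  fix g assume "g \<in> {g \<in> carrier G. deg_ge m (mu g - 1)}"
  then show "inv g \<in> {g \<in> carrier G. deg_ge m (mu g - 1)}"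
    using deg_ge_inverse[OF _ mu_inv(1)] by simp
next
  fix g h assume "g \<in> {g \<in> carrier G. deg_ge m (mu g - 1)}"
    "h \<in> {g \<in> carrier G. deg_ge m (mu g - 1)}"
  then show "g \<otimes> h \<in> {g \<in> carrier G. deg_ge m (mu g - 1)}"
    using deg_ge_product[of m "mu g" "mu h"] by (simp add: mu_mult)
qed auto

lemma deg_ge_mu_carrier:
  assumes "g \<in> carrier G"
  shows "deg_ge 1 (mu g - 1)"
proof -
  have "generate G (x ` {..<n}) \<subseteq> {g \<in> carrier G. deg_ge 1 (mu g - 1)}"
    using deg_ge_mvar by (intro generate_subgroup_incl[OF _ subgroup_deg_ge]) (auto simp: mu_gen)
  then show ?thesis using assms generated by auto
qed

lemma deg_ge_mu:
  assumes "1 \<le> m" "g \<in> lcs G m"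
  shows "deg_ge m (mu g - 1)"
  using assms
proof (induction m arbitrary: g rule: nat_induct_at_least)
  case base
  then show ?case using deg_ge_mu_carrier by simp
next
  case (Suc m)
  have "deg_ge (Suc m) (mu (comm G a b) - 1)" if a: "a \<in> carrier G" and b: "b \<in> lcs G m" for a b
  proof -
    let ?c = "(mu a - 1) * (mu b - 1) - (mu b - 1) * (mu a - 1)"
    have "deg_ge (Suc (1 + m)) (mu a * mu b * mu (inv a) * mu (inv b) - 1 - ?c)"
      by (rule deg_ge_commutator)
        (use Suc deg_ge_mu_carrier[OF a] a b mu_inv in \<open>auto dest: lcs_carrier\<close>)
    then have "deg_ge (Suc m) (mu (comm G a b) - 1 - ?c)"
      using a b by (auto simp: mu_comm lcs_carrier intro: deg_ge_mono)
    moreover have "deg_ge (Suc m) ?c"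
      using deg_ge_times[OF deg_ge_mu_carrier[OF a] Suc.IH[OF b]]
        deg_ge_times[OF Suc.IH[OF b] deg_ge_mu_carrier[OF a]] by simp
    ultimately have "deg_ge (Suc m) (mu (comm G a b) - 1 - ?c + ?c)" by (rule deg_ge_closed)
    then show ?thesis by simp
  qed
  then have "lcs G (Suc m) \<subseteq> {g \<in> carrier G. deg_ge (Suc m) (mu g - 1)}"
    by (intro lcs_Suc_minimal[OF Suc.hyps subgroup_deg_ge]) (auto dest: lcs_carrier)
  then show ?case using Suc.prems by blast
qed

definition leading_term :: "nat \<Rightarrow> 'a \<Rightarrow> (nat, int) magnus \<Rightarrow> bool" where
  "leading_term m g f \<longleftrightarrow> g \<in> lcs G m \<and> deg_ge m f \<and> deg_ge (Suc m) (mu g - 1 - f)"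

lemma leading_term_self: "1 \<le> m \<Longrightarrow> g \<in> lcs G m \<Longrightarrow> leading_term m g (mu g - 1)"
  using deg_ge_mu by (simp add: leading_term_def)

lemma leading_term_gen: "i < n \<Longrightarrow> leading_term 1 (x i) (mvar i)"
  using deg_ge_mvar by (simp add: leading_term_def mu_gen)

lemma coef_leading_term:
  assumes "leading_term m g f" "length w = m" "1 \<le> m"
  shows "coef (mu g) w = coef f w"
proof -
  have "coef (mu g - 1 - f) w = 0" "w \<noteq> []"
    using assms unfolding leading_term_def deg_ge_def by auto
  then show ?thesis by (simp add: coef_one)
qed

lemma coef_mu_lcs_Suc:
  assumes "g \<in> lcs G (Suc m)" "length w = m" "1 \<le> m"
  shows "coef (mu g) w = 0"
proof -
  have "leading_term m g 0"
    using deg_ge_mu[of "Suc m" g] lcs_antimono[of m "Suc m" g] assms(1)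
    by (simp add: leading_term_def)
  then show ?thesis using coef_leading_term assms by fastforce
qed

lemma leading_term_mult:
  assumes m: "1 \<le> m" and g: "leading_term m g f" and h: "leading_term m h f'"
  shows "leading_term m (g \<otimes> h) (f + f')"
proof -
  have gh: "g \<in> lcs G m" "h \<in> lcs G m" "g \<in> carrier G" "h \<in> carrier G"
    using g h by (auto simp: leading_term_def)
  have "deg_ge (Suc m) ((mu g - 1) * (mu h - 1))"
    using deg_ge_times[OF deg_ge_mu[OF m gh(1)] deg_ge_mu[OF m gh(2)]] m by simp
  then have "deg_ge (Suc m) ((mu g - 1 - f) + (mu h - 1 - f') + (mu g - 1) * (mu h - 1))"
    using g h by (simp add: leading_term_def)
  also have "(mu g - 1 - f) + (mu h - 1 - f') + (mu g - 1) * (mu h - 1) = mu (g \<otimes> h) - 1 - (f + f')"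
    using gh by (simp add: mu_mult algebra_simps)
  finally show ?thesis using g h by (simp add: leading_term_def)
qed

lemma leading_term_comm:
  assumes i: "1 \<le> i" and j: "1 \<le> j" and g: "leading_term i g f" and h: "leading_term j h f'"
  shows "leading_term (i + j) (comm G g h) (f * f' - f' * f)"
proof -
  let ?a = "mu g - 1" and ?b = "mu h - 1" and ?m = "Suc (i + j)"
  have gh: "g \<in> lcs G i" "h \<in> lcs G j" "g \<in> carrier G" "h \<in> carrier G"
    using g h by (auto simp: leading_term_def)
  have a: "deg_ge i ?a" and b: "deg_ge j ?b" using deg_ge_mu i j gh by auto
  have f: "deg_ge i f" "deg_ge (Suc i) (?a - f)" and f': "deg_ge j f'" "deg_ge (Suc j) (?b - f')"
    using g h by (auto simp: leading_term_def)
  have "deg_ge ?m (mu g * mu h * mu (inv g) * mu (inv h) - 1 - (?a * ?b - ?b * ?a))"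
    by (rule deg_ge_commutator[OF i j a b]) (use gh mu_inv in auto)
  moreover have "deg_ge ?m ((?a - f) * ?b + f * (?b - f') - ((?b - f') * ?a + f' * (?a - f)))"
    using deg_ge_times[OF f(2) b] deg_ge_times[OF f(1) f'(2)] deg_ge_times[OF f'(2) a]
      deg_ge_times[OF f'(1) f(2)] by simp
  ultimately have "deg_ge ?m ((mu (comm G g h) - 1 - (?a * ?b - ?b * ?a))
      + ((?a - f) * ?b + f * (?b - f') - ((?b - f') * ?a + f' * (?a - f))))"
    using gh by (simp only: mu_comm deg_ge_closed)
  moreover have "(mu (comm G g h) - 1 - (?a * ?b - ?b * ?a))
      + ((?a - f) * ?b + f * (?b - f') - ((?b - f') * ?a + f' * (?a - f))) =
      mu (comm G g h) - 1 - (f * f' - f' * f)"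
    by (simp add: algebra_simps)
  moreover have "deg_ge (i + j) (f * f' - f' * f)"
    using deg_ge_times[OF f(1) f'(1)] deg_ge_times[OF f'(1) f(1)] by simp
  ultimately show ?thesis using comm_lcs[OF i j gh(1,2)] by (simp add: leading_term_def)
qed

lemma leading_term_ad:
  "set u \<subseteq> {..<n} \<Longrightarrow> s < n \<Longrightarrow> leading_term (Suc (length u)) (ad u (x s)) (magnus_bracket u s)"
proof (induction u)
  case Nil
  then show ?case using leading_term_gen by simp
next
  case (Cons a u)
  then show ?case using leading_term_comm[OF _ _ leading_term_gen[of a] Cons.IH] by simp
qed

lemma coef_mu_mult:
  assumes "g \<in> lcs G m" "h \<in> lcs G m" "length w = m" "1 \<le> m"
  shows "coef (mu (g \<otimes> h)) w = coef (mu g) w + coef (mu h) w"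
proof -
  have "w \<noteq> []" using assms(3,4) by auto
  then show ?thesis
    using coef_leading_term[OF leading_term_mult[OF assms(4) leading_term_self leading_term_self]]
      assms
    by (simp add: coef_one)
qed

lemma coef_mu_basic:
  assumes us: "(u, s) \<in> basic m" and vt: "(v, t) \<in> basic m"
  shows "coef (mu (ad u (x s))) (v @ [t]) = (if (v, t) = (u, s) then 1 else 0)"
proof -
  have u: "distinct (u @ [s])" "\<forall>a\<in>set u. a < s" "Suc (length u) = m" "set u \<subseteq> {..<n}" "s < n"
    and v: "distinct (v @ [t])" "\<forall>a\<in>set v. a < t" "Suc (length v) = m"
    using us vt by (auto simp: basic_def)
  have eq: "coef (mu (ad u (x s))) (v @ [t]) = coef (magnus_bracket u s) (v @ [t])"
    by (rule coef_leading_term[OF leading_term_ad]) (use u v in auto)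
  show ?thesis
  proof (cases "s = t")
    case True
    then show ?thesis using eq coef_magnus_bracket_last[OF u(1), of v] v(1) by simp
  next
    case False
    have "set (v @ [t]) \<noteq> insert s (set u)"
    proof
      assume "set (v @ [t]) = insert s (set u)"
      then have "t \<in> insert s (set u)" "s \<in> insert t (set v)" by auto
      then show False using u(2) v(2) False by (metis insertE order_less_asym)
    qed
    then show ?thesis using eq magnus_bracket_support[of u s "v @ [t]"] False by auto
  qed
qed

definition basic_expansion :: "nat \<Rightarrow> 'a \<Rightarrow> 'a set" where
  "basic_expansion m g = finprod (grQ G m)
    (\<lambda>(u, s). lcs_class G m (ad u (x s)) [^]\<^bsub>grQ G m\<^esub> coef (mu g) (u @ [s])) (basic m)"

lemma basic_expansion_eq_one:
  assumes "1 \<le> m" "\<And>u s. (u, s) \<in> basic m \<Longrightarrow> coef (mu g) (u @ [s]) = 0"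
  shows "basic_expansion m g = \<one>\<^bsub>grQ G m\<^esub>"
proof -
  interpret Q: comm_group "grQ G m" by (rule grQ_comm_group[OF assms(1)])
  show ?thesis
    unfolding basic_expansion_def by (rule Q.finprod_one_eqI) (use assms(2) in auto)
qed

lemma basic_expansion_hom:
  assumes m: "1 \<le> m"
  shows "basic_expansion m \<in> hom (G\<lparr>carrier := lcs G m\<rparr>) (grQ G m)"
proof (rule homI)
  interpret Q: comm_group "grQ G m" by (rule grQ_comm_group[OF m])
  let ?e = "\<lambda>g (u, s). lcs_class G m (ad u (x s)) [^]\<^bsub>grQ G m\<^esub> coef (mu g) (u @ [s])"
  have e: "?e g \<in> basic m \<rightarrow> carrier (grQ G m)" for g
    using basic_ad_lcs by (auto intro!: Q.int_pow_closed)
  show "basic_expansion m g \<in> carrier (grQ G m)" for g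
    unfolding basic_expansion_def by (rule Q.finprod_closed[OF e])
  fix g h assume "g \<in> carrier (G\<lparr>carrier := lcs G m\<rparr>)" "h \<in> carrier (G\<lparr>carrier := lcs G m\<rparr>)"
  then have gh: "g \<in> lcs G m" "h \<in> lcs G m" by simp_all
  have "?e (g \<otimes> h) t = ?e g t \<otimes>\<^bsub>grQ G m\<^esub> ?e h t" if "t \<in> basic m" for t
  proof -
    obtain u s where t: "t = (u, s)" by fastforce
    then have "length (u @ [s]) = m" using that by (auto simp: basic_def)
    then show ?thesis
      using t that coef_mu_mult[OF gh _ m] basic_ad_lcs by (simp add: Q.int_pow_mult)
  qed
  moreover have "(\<lambda>t. ?e g t \<otimes>\<^bsub>grQ G m\<^esub> ?e h t) \<in> basic m \<rightarrow> carrier (grQ G m)"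
    by (intro Pi_I Q.m_closed funcset_mem[OF e])
  ultimately have "basic_expansion m (g \<otimes> h) =
      finprod (grQ G m) (\<lambda>t. ?e g t \<otimes>\<^bsub>grQ G m\<^esub> ?e h t) (basic m)"
    unfolding basic_expansion_def by (intro Q.finprod_cong'[OF refl])
  then show "basic_expansion m (g \<otimes>\<^bsub>G\<lparr>carrier := lcs G m\<rparr>\<^esub> h) =
      basic_expansion m g \<otimes>\<^bsub>grQ G m\<^esub> basic_expansion m h"
    unfolding basic_expansion_def using Q.finprod_multf[OF e e] by simp
qed

lemma basic_expansion_basic:
  assumes m: "1 \<le> m" and us: "(u, s) \<in> basic m"
  shows "basic_expansion m (ad u (x s)) = lcs_class G m (ad u (x s))"
proof -
  interpret Q: comm_group "grQ G m" by (rule grQ_comm_group[OF m])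
  let ?e = "\<lambda>(u, s). lcs_class G m (ad u (x s))"
  have e: "?e \<in> basic m \<rightarrow> carrier (grQ G m)" using basic_ad_lcs by auto
  have "basic_expansion m (ad u (x s)) =
      finprod (grQ G m) (\<lambda>t. if (u, s) = t then ?e t else \<one>\<^bsub>grQ G m\<^esub>) (basic m)"
    unfolding basic_expansion_def
  proof (rule Q.finprod_cong')
    fix t assume t: "t \<in> basic m"
    then show "(case t of (v, r) \<Rightarrow>
          lcs_class G m (ad v (x r)) [^]\<^bsub>grQ G m\<^esub> coef (mu (ad u (x s))) (v @ [r])) =
        (if (u, s) = t then ?e t else \<one>\<^bsub>grQ G m\<^esub>)"
      using coef_mu_basic[OF us] basic_ad_lcs[OF us] by (auto split: prod.splits)
  qed (use basic_ad_lcs in auto)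
  also have "\<dots> = ?e (u, s)"
    by (rule Q.finprod_singleton[OF us finite_basic e])
  finally show ?thesis by simp
qed

lemma lcs_class_eq_basic_expansion:
  assumes m: "1 \<le> m" and g: "g \<in> lcs G m"
  shows "lcs_class G m g = basic_expansion m g"
proof (rule hom_eq_on_generate[OF grQ_group lcs_class_hom basic_expansion_hom[OF m] lcs_subgroup])
  show "(\<lambda>(u, s). ad u (x s)) ` basic m \<union> lcs G (Suc m) \<subseteq> lcs G m"
    by (rule basic_span_generators_subset)
  show "g \<in> generate G ((\<lambda>(u, s). ad u (x s)) ` basic m \<union> lcs G (Suc m))"
    using lcs_subset_basic_span[OF m] g by (auto simp: basic_span_def)
  fix h assume "h \<in> (\<lambda>(u, s). ad u (x s)) ` basic m \<union> lcs G (Suc m)"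
  then consider u s where "(u, s) \<in> basic m" "h = ad u (x s)" | "h \<in> lcs G (Suc m)" by auto
  then show "lcs_class G m h = basic_expansion m h"
  proof cases
    case 1
    then show ?thesis using basic_expansion_basic[OF m] by simp
  next
    case 2
    then have "coef (mu h) (u @ [s]) = 0" if "(u, s) \<in> basic m" for u s
      using coef_mu_lcs_Suc[OF 2 _ m] that by (simp add: basic_def)
    then have "basic_expansion m h = \<one>\<^bsub>grQ G m\<^esub>" by (rule basic_expansion_eq_one[OF m])
    moreover have "lcs_class G m h = \<one>\<^bsub>grQ G m\<^esub>" using 2 lcs_class_eq_one_iff by auto
    ultimately show ?thesis by simp
  qed
qed

lemma mem_lcs_Suc_if_coef_zero:
  assumes m: "1 \<le> m" and g: "g \<in> lcs G m"
    and zero: "\<And>u s. (u, s) \<in> basic m \<Longrightarrow> coef (mu g) (u @ [s]) = 0"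
  shows "g \<in> lcs G (Suc m)"
  using lcs_class_eq_basic_expansion[OF m g] basic_expansion_eq_one[OF m zero]
    lcs_class_eq_one_iff[OF lcs_carrier[OF g]] by simp

end

section \<open>Realising derivations\<close>

text \<open>Apply a derivation with \<open>X\<^sub>i \<mapsto> V\<close> and \<open>X\<^sub>k \<mapsto> W\<close> to \<open>[X\<^sub>i, [X\<^sub>k, X\<^sub>i]]\<close>: the monomial
  \<open>X\<^sub>k M X\<^sub>i\<close> occurs only in \<open>- [X\<^sub>k, V] X\<^sub>i\<close>.\<close>

lemma coef_derivative_bracket:
  fixes V W :: "('a, 'r::ring_1) magnus" and i k :: 'a
  defines "a \<equiv> mvar i" and "b \<equiv> mvar k"
  defines "c \<equiv> W * a - a * W + (b * V - V * b)"
  assumes M: "distinct (k # M @ [i])" "M \<noteq> []"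
  shows "coef (V * (b * a - a * b) - (b * a - a * b) * V + (a * c - c * a)) (k # M @ [i]) =
      - coef V M"
proof -
  have "hd M \<in> set M" "last M \<in> set M" using M(2) by simp_all
  moreover have inner: "distinct M" "k \<notin> set M" "i \<notin> set M" "k \<noteq> i" using M(1) by auto
  ultimately have ends: "hd M \<noteq> i" "last M \<noteq> i" "last M \<noteq> k" by metis+
  have "V * (b * a - a * b) = V * b * a - V * a * b"
    "(b * a - a * b) * V = b * (a * V) - a * (b * V)"
    by (simp_all add: algebra_simps)
  moreover have "coef c (k # M) = coef V M"
    using M(2) inner ends by (simp add: c_def a_def b_def coef_times_mvar coef_mvar_times)
  ultimately show ?thesis
    using M(2) inner ends
    by (simp add: a_def b_def coef_times_mvar coef_mvar_times butlast_append hd_append)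
qed

context group
begin

lemma comm_conj_mult_lcs:
  assumes x: "x \<in> carrier G" "commutes_with_conjugates G x" and m: "1 \<le> m" and a: "a \<in> lcs G m"
    and h: "h \<in> carrier G"
  shows "comm G (a \<otimes> x) (h \<otimes> (a \<otimes> x) \<otimes> inv h) \<in> lcs G (m + 2)"
proof -
  define p q c where "p = comm G h a" and "q = comm G h x" and "c = comm G h (a \<otimes> x)"
  note N = lcs_normal[of "m + 2"]
  have ac: "a \<in> carrier G" using a by auto
  have p: "p \<in> lcs G (m + 1)" and q: "q \<in> lcs G 2" and c: "c \<in> lcs G 2"
    using comm_lcs_le[of h 1 a m "m + 1"] comm_lcs_le[of h 1 _ 1 2] h x(1) ac a m
    by (simp_all add: p_def q_def c_def)
  have closed: "p \<in> carrier G" "q \<in> carrier G" "c \<in> carrier G" using p q c by auto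
  have c_eq: "c = p \<otimes> (comm G a q \<otimes> q)"
    using h ac x(1) by (simp add: c_def p_def q_def comm_mult_right conj_eq_comm_mult)
  have "comm G x (q \<otimes> x) = \<one>"
    using x h by (simp add: commutes_with_conjugates_def q_def flip: conj_eq_comm_mult)
  then have "comm G x q = \<one>" using x(1) closed by (simp add: comm_mult_right)
  moreover have "comm G x (comm G a q) \<in> lcs G (m + 2)"
    using comm_normal_right[OF N x(1)] comm_lcs_le[OF a q, of "m + 2"] m by simp
  moreover have "comm G x p \<in> lcs G (m + 2)"
    using comm_lcs_le[of x 1 p "m + 1"] p x(1) by simp
  ultimately have "comm G x c \<in> lcs G (m + 2)"
    unfolding c_eq using closed x(1) ac by (intro comm_mult_right_mem[OF N]) auto
  moreover have "comm G a c \<in> lcs G (m + 2)"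
    using comm_lcs_le[OF a c] m by simp
  ultimately have "comm G (a \<otimes> x) c \<in> lcs G (m + 2)"
    using closed x(1) ac by (intro comm_mult_left_mem[OF N]) auto
  then have "comm G (a \<otimes> x) (c \<otimes> (a \<otimes> x)) \<in> lcs G (m + 2)"
    using comm_mult_right_mem[OF N, of "a \<otimes> x" c "a \<otimes> x"] closed x(1) ac by simp
  then show ?thesis using h x(1) ac by (simp add: c_def conj_eq_comm_mult)
qed

end

context reduced_group
begin

definition relator_derivative :: "(nat \<Rightarrow> 'a) \<Rightarrow> nat \<Rightarrow> nat \<Rightarrow> 'a" where
  "relator_derivative g i k = comm G (g i) (comm G (x k) (x i))
    \<otimes> comm G (x i) (comm G (g k) (x i) \<otimes> comm G (x k) (g i))"

lemma relator_derivative_lcs: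
  assumes D: "D \<in> der G j" and g: "\<And>i. i < n \<Longrightarrow> g i \<in> lcs G (1 + j)"
      "\<And>i. i < n \<Longrightarrow> D 1 (lcs_class G 1 (x i)) = lcs_class G (1 + j) (g i)"
    and i: "i < n" and k: "k < n"
  shows "relator_derivative g i k \<in> lcs G (j + 4)"
proof -
  let ?t = "comm G (x k) (x i)" and ?c = "comm G (g k) (x i) \<otimes> comm G (x k) (g i)"
  have xs: "x i \<in> lcs G 1" "x k \<in> lcs G 1" using i k by auto
  have closed: "g i \<in> carrier G" "g k \<in> carrier G" using g(1) i k by auto
  have t: "?t \<in> lcs G (1 + 1)" by (rule comm_lcs) (use xs in auto)
  have c: "?c \<in> lcs G (1 + 1 + j)"
    using comm_lcs_le[OF g(1)[OF k] xs(1)] comm_lcs_le[OF xs(2) g(1)[OF i]] by simp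
  have Dt: "D (1 + 1) (lcs_class G (1 + 1) ?t) = lcs_class G (1 + 1 + j) ?c"
    by (rule der_comm[OF D]) (use xs g i k in auto)
  have "D (1 + (1 + 1)) (lcs_class G (1 + (1 + 1)) (comm G (x i) ?t)) =
      lcs_class G (1 + (1 + 1) + j) (relator_derivative g i k)"
    unfolding relator_derivative_def
    by (rule der_comm[OF D _ _ xs(1) g(1)[OF i] g(2)[OF i] t c Dt]) auto
  moreover have "comm G (x i) ?t = \<one>"
    using ncl_commutes[OF i x_in_ncl[OF i]]
      comm_normal_right[OF ncl_normal[OF i] x_closed[OF k] x_in_ncl[OF i]]
    by simp
  moreover have "D (1 + (1 + 1)) \<one>\<^bsub>grQ G (1 + (1 + 1))\<^esub> = \<one>\<^bsub>grQ G (1 + (1 + 1) + j)\<^esub>"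
    by (rule hom_one[OF der_hom[OF D] grQ_group grQ_group]) simp
  ultimately have "lcs_class G (3 + j) (relator_derivative g i k) = \<one>\<^bsub>grQ G (3 + j)\<^esub>"
    by (simp add: lcs_class_one numeral_3_eq_3)
  moreover have "relator_derivative g i k \<in> carrier G"
    using closed i k by (simp add: relator_derivative_def)
  ultimately show ?thesis by (simp add: lcs_class_eq_one_iff add.commute)
qed

end

context reduced_magnus
begin

lemma coef_eq_zero_if_relator_derivative:
  assumes m: "1 \<le> m" and i: "i < n" and k: "k < n" and g: "g i \<in> lcs G m" "g k \<in> lcs G m"
    and rel: "relator_derivative g i k \<in> lcs G (m + 3)"
    and M: "distinct (k # M @ [i])" "length M = m"
  shows "coef (mu (g i)) M = 0"
proof -
  let ?X = "mvar i" and ?Y = "mvar k"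
  define V W where "V = mu (g i) - 1" and "W = mu (g k) - 1"
  define C where "C = W * ?X - ?X * W + (?Y * V - V * ?Y)"
  define F where "F = V * (?Y * ?X - ?X * ?Y) - (?Y * ?X - ?X * ?Y) * V + (?X * C - C * ?X)"
  have V: "leading_term m (g i) V" and W: "leading_term m (g k) W"
    unfolding V_def W_def using leading_term_self[OF m] g by auto
  have "leading_term (1 + 1) (comm G (x k) (x i)) (?Y * ?X - ?X * ?Y)"
    by (rule leading_term_comm) (use leading_term_gen i k in auto)
  then have outer: "leading_term (m + (1 + 1)) (comm G (g i) (comm G (x k) (x i)))
      (V * (?Y * ?X - ?X * ?Y) - (?Y * ?X - ?X * ?Y) * V)"
    by (intro leading_term_comm[OF m _ V]) simp
  have "leading_term (m + 1) (comm G (g k) (x i) \<otimes> comm G (x k) (g i)) C"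
    unfolding C_def
    using leading_term_comm[OF m _ W leading_term_gen[OF i]]
      leading_term_comm[OF _ m leading_term_gen[OF k] V]
    by (intro leading_term_mult) auto
  then have "leading_term (m + (1 + 1)) (comm G (x i) (comm G (g k) (x i) \<otimes> comm G (x k) (g i)))
      (?X * C - C * ?X)"
    using leading_term_comm[OF _ _ leading_term_gen[OF i], of "m + 1"] by simp
  then have "leading_term (m + 2) (relator_derivative g i k) F"
    unfolding relator_derivative_def F_def using outer by (intro leading_term_mult) auto
  moreover have "coef (mu (relator_derivative g i k)) (k # M @ [i]) = 0"
    by (rule coef_mu_lcs_Suc[of _ "m + 2"]) (use rel M in \<open>auto simp: numeral_3_eq_3\<close>)
  ultimately have "coef F (k # M @ [i]) = 0"
    using coef_leading_term[of "m + 2" "relator_derivative g i k" _ "k # M @ [i]"] M by simp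
  moreover have "M \<noteq> []" using M m by auto
  ultimately have "coef V M = 0"
    using coef_derivative_bracket[OF M(1), of V W] unfolding F_def C_def by simp
  then show ?thesis using \<open>M \<noteq> []\<close> by (simp add: V_def coef_one)
qed

end

locale reduced_free_group = reduced_magnus +
  assumes extend: "(\<And>i. i < n \<Longrightarrow> y i \<in> carrier G) \<Longrightarrow>
    (\<And>i. i < n \<Longrightarrow> commutes_with_conjugates G (y i)) \<Longrightarrow> \<exists>h\<in>hom G G. \<forall>i<n. h (x i) = y i"
begin

lemma retraction:
  assumes i: "i < n"
  obtains p where "p \<in> hom G G" "\<And>g. g \<in> carrier G \<Longrightarrow> displacement G p g \<in> ncl i"
    "\<And>g. g \<in> carrier G \<Longrightarrow> mu (p g) = kill i (mu g)"
proof -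
  have "commutes_with_conjugates G \<one>" by (simp add: commutes_with_conjugates_def)
  then have "\<exists>h\<in>hom G G. \<forall>k<n. h (x k) = (if k = i then \<one> else x k)"
    by (intro extend) (auto simp: reduced)
  then obtain p where p: "p \<in> hom G G" "\<And>k. k < n \<Longrightarrow> p (x k) = (if k = i then \<one> else x k)"
    by blast
  interpret N: normal "ncl i" G by (rule ncl_normal[OF i])
  have "displacement G p g \<in> ncl i" if "g \<in> carrier G" for g
  proof (rule displacement_generate_mem[OF ncl_normal[OF i] p(1)])
    show "g \<in> generate G (x ` {..<n})" using that generated by simp
    fix s assume "s \<in> x ` {..<n}"
    then show "displacement G p s \<in> ncl i"
      using p(2) x_in_ncl[OF i] by (auto simp: displacement_def)
  qed auto
  moreover have "mu (p g) = kill i (mu g)" if "g \<in> carrier G" for g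
  proof -
    have "(mu \<circ> p) g = (kill i \<circ> mu) g"
    proof (rule hom_eq_on_generate[OF group_units_of_mult_monoid _ _ subgroup_self])
      show "mu \<circ> p \<in> hom (G\<lparr>carrier := carrier G\<rparr>) magnus_units"
        using Group.hom_compose[OF p(1) mu_hom] by simp
      show "kill i \<circ> mu \<in> hom (G\<lparr>carrier := carrier G\<rparr>) magnus_units"
        using Group.hom_compose[OF mu_hom kill_hom] by simp
      show "g \<in> generate G (x ` {..<n})" using that generated by simp
    qed (use p(2) in \<open>auto simp: mu_gen kill_one_plus_mvar\<close>)
    then show ?thesis by simp
  qed
  ultimately show ?thesis using that p(1) by blast
qed

lemma coef_eq_zero_if_avoids:
  assumes m: "1 \<le> m" "m + 1 < n" and i: "i < n" and g: "\<And>k. k < n \<Longrightarrow> g k \<in> lcs G m"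
    and rel: "\<And>k. k < n \<Longrightarrow> relator_derivative g i k \<in> lcs G (m + 3)"
    and M: "distinct M" "length M = m" "i \<notin> set M"
  shows "coef (mu (g i)) M = 0"
proof -
  have "card (insert i (set M)) < n" using M m(2) by (simp add: distinct_card)
  then have "\<not> {..<n} \<subseteq> insert i (set M)"
    using card_mono[of "insert i (set M)" "{..<n}"] by auto
  then obtain k where k: "k < n" "k \<noteq> i" "k \<notin> set M" by blast
  show ?thesis
    by (rule coef_eq_zero_if_relator_derivative[OF m(1) i k(1) g[OF i] g[OF k(1)] rel[OF k(1)]])
      (use k M in auto)
qed

lemma lift_in_ncl:
  assumes m: "1 \<le> m" "m + 1 < n" and i: "i < n" and g: "\<And>k. k < n \<Longrightarrow> g k \<in> lcs G m"
    and rel: "\<And>k. k < n \<Longrightarrow> relator_derivative g i k \<in> lcs G (m + 3)"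
  obtains y where "y \<in> lcs G m" "lcs_class G m y = lcs_class G m (g i)" "y \<in> ncl i"
proof -
  obtain p where p: "p \<in> hom G G" "\<And>g. g \<in> carrier G \<Longrightarrow> displacement G p g \<in> ncl i"
    "\<And>g. g \<in> carrier G \<Longrightarrow> mu (p g) = kill i (mu g)" using retraction[OF i] by blast
  have gi: "g i \<in> lcs G m" "g i \<in> carrier G" using g[OF i] by auto
  have pg: "p (g i) \<in> lcs G m" by (rule hom_lcs[OF is_group p(1) gi(1)])
  have "p (g i) \<in> lcs G (Suc m)"
  proof (rule mem_lcs_Suc_if_coef_zero[OF m(1) pg])
    fix u s assume us: "(u, s) \<in> basic m"
    define M where "M = u @ [s]"
    have M: "distinct M" "length M = m" using us by (auto simp: basic_def M_def)
    have "coef (mu (g i)) M = 0" if "i \<notin> set M"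
      by (rule coef_eq_zero_if_avoids[OF m i g rel M that])
    then show "coef (mu (p (g i))) (u @ [s]) = 0"
      using p(3)[OF gi(2)] by (simp add: coef_kill M_def)
  qed
  then have "lcs_class G m (inv (p (g i)) \<otimes> g i) = lcs_class G m (g i)"
    using gi by (simp add: lcs_class_mult_left)
  moreover have "inv (p (g i)) \<otimes> g i \<in> ncl i"
  proof -
    interpret normal "ncl i" G by (rule ncl_normal[OF i])
    have "inv (p (g i)) \<otimes> inv (displacement G p (g i)) \<otimes> p (g i) \<in> ncl i"
      using inv_op_closed1[OF _ m_inv_closed[OF p(2)[OF gi(2)]]] pg by auto
    moreover have "inv (p (g i)) \<otimes> inv (displacement G p (g i)) \<otimes> p (g i) = inv (p (g i)) \<otimes> g i"
      using gi pg by (simp add: displacement_def inv_mult_group m_assoc lcs_carrier)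
    ultimately show ?thesis by simp
  qed
  ultimately show ?thesis
    using that[of "inv (p (g i)) \<otimes> g i"] gi(1) pg by simp
qed

lemma commuting_lift:
  assumes m: "1 \<le> m" and i: "i < n" and g: "\<And>k. k < n \<Longrightarrow> g k \<in> lcs G m"
    and rel: "\<And>k. k < n \<Longrightarrow> relator_derivative g i k \<in> lcs G (m + 3)"
  obtains y where "y \<in> lcs G m" "lcs_class G m y = lcs_class G m (g i)"
    "commutes_with_conjugates G (y \<otimes> x i)"
proof (cases "m + 1 < n")
  case True
  obtain y where y: "y \<in> lcs G m" "lcs_class G m y = lcs_class G m (g i)" "y \<in> ncl i"
    using lift_in_ncl[OF m True i g rel] .
  interpret normal "ncl i" G by (rule ncl_normal[OF i])
  have "commutes_with_conjugates G (y \<otimes> x i)"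
    using ncl_commutes_with_conjugates[OF i m_closed[OF y(3) x_in_ncl[OF i]]] .
  then show ?thesis using that y by blast
next
  case False
  have "comm G (g i \<otimes> x i) (h \<otimes> (g i \<otimes> x i) \<otimes> inv h) = \<one>" if "h \<in> carrier G" for h
    using comm_conj_mult_lcs[OF x_closed[OF i] reduced[OF i] m g[OF i] that]
      lcs_antimono[of "Suc n" "m + 2"] False lcs_trivial by simp
  then show ?thesis using that g[OF i] by (simp add: commutes_with_conjugates_def)
qed

lemma andr_extend:
  assumes j: "1 \<le> j" and y: "\<And>i. i < n \<Longrightarrow> y i \<in> lcs G (1 + j)"
    and comm: "\<And>i. i < n \<Longrightarrow> commutes_with_conjugates G (y i \<otimes> x i)"
  obtains s where "s \<in> andr G j" "\<And>i. i < n \<Longrightarrow> displacement G s (x i) = y i"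
proof -
  have "\<exists>h\<in>hom G G. \<forall>i<n. h (x i) = y i \<otimes> x i"
    by (rule extend) (use y comm in auto)
  then obtain h where h: "h \<in> hom G G" "\<And>i. i < n \<Longrightarrow> h (x i) = y i \<otimes> x i" by blast
  have disp: "displacement G h (x i) = y i" if "i < n" for i
    using h(2)[OF that] y[OF that] that by (simp add: displacement_def m_assoc lcs_carrier)
  have "restrict h (carrier G) \<in> andr G j"
    by (rule restrict_hom_andr[OF h(1) _ generated j lcs_trivial]) (use disp y in auto)
  moreover have "displacement G (restrict h (carrier G)) (x i) = y i" if "i < n" for i
    using disp[OF that] that by (simp add: displacement_def)
  ultimately show ?thesis using that by blast
qed

lemma johnson_surj:
  assumes j: "1 \<le> j" and D: "D \<in> der G j"
  shows "D \<in> johnson G j ` carrier (AQ G j)"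
proof -
  have "\<exists>g. g \<in> lcs G (1 + j) \<and> D 1 (lcs_class G 1 (x i)) = lcs_class G (1 + j) g"
    if i: "i < n" for i
    by (rule der_lift[OF D, of 1 "x i"]) (use i in auto)
  then obtain g where g: "\<And>i. i < n \<Longrightarrow> g i \<in> lcs G (1 + j)"
    "\<And>i. i < n \<Longrightarrow> D 1 (lcs_class G 1 (x i)) = lcs_class G (1 + j) (g i)" by metis
  have rel: "relator_derivative g i k \<in> lcs G (1 + j + 3)" if "i < n" "k < n" for i k
    using relator_derivative_lcs[OF D g that] by (simp add: add.commute)
  have "\<exists>y. y \<in> lcs G (1 + j) \<and> lcs_class G (1 + j) y = lcs_class G (1 + j) (g i)
      \<and> commutes_with_conjugates G (y \<otimes> x i)" if i: "i < n" for i
  proof -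
    obtain y where "y \<in> lcs G (1 + j)" "lcs_class G (1 + j) y = lcs_class G (1 + j) (g i)"
      "commutes_with_conjugates G (y \<otimes> x i)"
      using commuting_lift[OF le_add1 i g(1) rel[OF i]] .
    then show ?thesis by blast
  qed
  then obtain y where y: "\<And>i. i < n \<Longrightarrow> y i \<in> lcs G (1 + j)"
    "\<And>i. i < n \<Longrightarrow> lcs_class G (1 + j) (y i) = lcs_class G (1 + j) (g i)"
    "\<And>i. i < n \<Longrightarrow> commutes_with_conjugates G (y i \<otimes> x i)"
    by metis
  obtain s where s: "s \<in> andr G j" "\<And>i. i < n \<Longrightarrow> displacement G s (x i) = y i"
    using andr_extend[OF j y(1,3)] by blast
  have "johnson G j (andr_class G j s) = D"
  proof (rule der_eqI[OF johnson_der[OF s(1) j] D _ generated])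
    fix a assume "a \<in> x ` {..<n}"
    then obtain i where i: "i < n" "a = x i" by auto
    then show "johnson G j (andr_class G j s) 1 (lcs_class G 1 a) = D 1 (lcs_class G 1 a)"
      using johnson_lcs_class[OF s(1) j, of 1 "x i"] s(2) y(2) g(2) by simp
  qed auto
  then show ?thesis using s(1) by (auto simp: carrier_AQ)
qed

theorem johnson_iso:
  assumes "1 \<le> j"
  shows "johnson G j \<in> iso (AQ G j) (der_grp G j)"
proof -
  have "bij_betw (johnson G j) (carrier (AQ G j)) (carrier (der_grp G j))"
    unfolding bij_betw_def
    using johnson_inj[OF assms] johnson_surj[OF assms] hom_in_carrier[OF johnson_hom[OF assms]]
    by (auto simp: der_grp_def)
  then show ?thesis using johnson_hom[OF assms] by (simp add: iso_def)
qed

end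

section \<open>The free group\<close>

definition linv :: "letter \<Rightarrow> letter" where
  "linv a = (fst a, \<not> snd a)"

abbreviation reduced_word :: "letter list \<Rightarrow> bool" where
  "reduced_word \<equiv> successively (\<lambda>a b. b \<noteq> linv a)"

lemma linv_simps [simp]: "linv (linv a) = a" "fst (linv a) = fst a" "snd (linv a) \<longleftrightarrow> \<not> snd a"
  by (simp_all add: linv_def)

lemma red_cons_Cons: "red_cons a (b # w) = (if b = linv a then w else a # b # w)"
  by (auto simp: linv_def prod_eq_iff)

declare red_cons.simps(2) [simp del]

lemma reduced_word_red_cons: "reduced_word w \<Longrightarrow> reduced_word (red_cons a w)"
  by (cases w) (auto simp: red_cons_Cons successively_Cons)

lemma reduced_word_reduce: "reduced_word (reduce w)"
  by (induction w) (auto intro: reduced_word_red_cons)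

lemma reduce_reduced_word: "reduced_word w \<Longrightarrow> reduce w = w"
proof (induction w)
  case (Cons a w)
  then show ?case by (cases w) (auto simp: red_cons_Cons)
qed simp

lemma red_cons_cancel:
  assumes "reduced_word w"
  shows "red_cons a (red_cons (linv a) w) = w"
proof (cases w)
  case (Cons b v)
  then show ?thesis
    using assms by (cases v) (auto simp: red_cons_Cons)
qed (simp add: red_cons_Cons)

lemma reduce_append: "reduce (u @ v) = foldr red_cons u (reduce v)"
  by (induction u) auto

lemma reduced_word_foldr: "reduced_word z \<Longrightarrow> reduced_word (foldr red_cons u z)"
  by (induction u) (auto intro: reduced_word_red_cons)

lemma foldr_red_cons:
  assumes "reduced_word z"
  shows "foldr red_cons (red_cons a u) z = red_cons a (foldr red_cons u z)"
proof (cases u)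
  case (Cons b v)
  then show ?thesis
    using red_cons_cancel[OF reduced_word_foldr[OF assms], of a v] by (auto simp: red_cons_Cons)
qed simp

lemma foldr_reduce: "reduced_word z \<Longrightarrow> foldr red_cons (reduce u) z = foldr red_cons u z"
  by (induction u) (auto simp: foldr_red_cons)

lemma reduce_append_reduce:
  "reduce (reduce u @ v) = reduce (u @ v)" "reduce (u @ reduce v) = reduce (u @ v)"
  by (simp_all add: reduce_append foldr_reduce reduced_word_reduce reduce_reduced_word)

lemma set_reduce: "set (reduce w) \<subseteq> set w"
proof (induction w)
  case (Cons a w)
  have "set (red_cons a v) \<subseteq> insert a (set v)" for v
    by (cases v) (auto simp: red_cons_Cons)
  then show ?case using Cons by fastforce
qed simp

lemma reduce_inverse: "reduce (rev (map linv w) @ w) = []"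
proof (induction w)
  case (Cons a w)
  have "reduce (rev (map linv (a # w)) @ a # w) =
      foldr red_cons (rev (map linv w)) (red_cons (linv a) (red_cons (linv (linv a)) (reduce w)))"
    by (simp add: reduce_append)
  also have "\<dots> = foldr red_cons (rev (map linv w)) (reduce w)"
    by (simp only: red_cons_cancel[OF reduced_word_reduce])
  finally show ?case using Cons by (simp add: reduce_append)
qed simp

lemma free_grp_simps:
  "w \<in> carrier (free_grp n) \<longleftrightarrow> reduced_word w \<and> (\<forall>a\<in>set w. fst a < n)"
  "u \<otimes>\<^bsub>free_grp n\<^esub> v = reduce (u @ v)"
  "\<one>\<^bsub>free_grp n\<^esub> = []"
  by (auto simp: free_grp_def reduce_reduced_word) (metis reduced_word_reduce)

lemma reduce_in_free_grp: "\<forall>a\<in>set w. fst a < n \<Longrightarrow> reduce w \<in> carrier (free_grp n)"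
  using set_reduce by (auto simp: free_grp_simps reduced_word_reduce)

lemma free_grp_group: "group (free_grp n)"
proof (rule groupI)
  fix u v w assume "u \<in> carrier (free_grp n)" "v \<in> carrier (free_grp n)"
  then show "u \<otimes>\<^bsub>free_grp n\<^esub> v \<in> carrier (free_grp n)"
    unfolding free_grp_simps(2) by (intro reduce_in_free_grp) (auto simp: free_grp_simps)
  show "u \<otimes>\<^bsub>free_grp n\<^esub> v \<otimes>\<^bsub>free_grp n\<^esub> w = u \<otimes>\<^bsub>free_grp n\<^esub> (v \<otimes>\<^bsub>free_grp n\<^esub> w)"
    by (simp add: free_grp_simps reduce_append_reduce)
next
  fix u assume u: "u \<in> carrier (free_grp n)"
  then show "\<one>\<^bsub>free_grp n\<^esub> \<otimes>\<^bsub>free_grp n\<^esub> u = u"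
    by (simp add: free_grp_simps reduce_reduced_word)
  have "reduce (rev (map linv u)) \<in> carrier (free_grp n)"
    by (rule reduce_in_free_grp) (use u in \<open>auto simp: free_grp_simps\<close>)
  moreover have "reduce (rev (map linv u)) \<otimes>\<^bsub>free_grp n\<^esub> u = \<one>\<^bsub>free_grp n\<^esub>"
    by (simp add: free_grp_simps reduce_append_reduce reduce_inverse)
  ultimately show "\<exists>v\<in>carrier (free_grp n). v \<otimes>\<^bsub>free_grp n\<^esub> u = \<one>\<^bsub>free_grp n\<^esub>"
    by blast
qed (simp add: free_grp_simps)

lemma gen_closed: "i < n \<Longrightarrow> gen i \<in> carrier (free_grp n)"
  by (simp add: free_grp_simps gen_def)

lemma letter_in_generate:
  assumes "fst a < n"
  shows "[a] \<in> generate (free_grp n) (gen ` {..<n})"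
proof (cases "snd a")
  case True
  then have "[a] = gen (fst a)" by (simp add: gen_def prod_eq_iff)
  then show ?thesis using assms by (auto intro!: generate.incl)
next
  case False
  interpret F: group "free_grp n" by (rule free_grp_group)
  have "[a] \<otimes>\<^bsub>free_grp n\<^esub> gen (fst a) = \<one>\<^bsub>free_grp n\<^esub>"
    using False by (simp add: gen_def free_grp_simps red_cons_Cons linv_def)
  then have "inv\<^bsub>free_grp n\<^esub> gen (fst a) = [a]"
    by (rule F.inv_equality) (use assms gen_closed in \<open>simp_all add: free_grp_simps(1)\<close>)
  then show ?thesis
    using generate.inv[of "gen (fst a)" "gen ` {..<n}" "free_grp n"] assms by auto
qed

lemma generate_free_grp: "generate (free_grp n) (gen ` {..<n}) = carrier (free_grp n)"
proof
  interpret F: group "free_grp n" by (rule free_grp_group)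
  show "generate (free_grp n) (gen ` {..<n}) \<subseteq> carrier (free_grp n)"
    by (rule F.generate_incl) (auto simp: gen_closed)
  have "w \<in> generate (free_grp n) (gen ` {..<n})" if "reduced_word w" "\<forall>a\<in>set w. fst a < n" for w
    using that
  proof (induction w)
    case Nil
    then show ?case using generate.one[of "free_grp n"] by (simp add: free_grp_simps)
  next
    case (Cons a w)
    then have "[a] \<otimes>\<^bsub>free_grp n\<^esub> w \<in> generate (free_grp n) (gen ` {..<n})"
      by (intro generate.eng letter_in_generate) (auto simp: successively_Cons)
    then show ?case using reduce_reduced_word[OF Cons.prems(1)] by (simp add: free_grp_simps(2))
  qed
  then show "carrier (free_grp n) \<subseteq> generate (free_grp n) (gen ` {..<n})"
    by (auto simp: free_grp_simps)
qed

context group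
begin

definition letter_value :: "(nat \<Rightarrow> 'a) \<Rightarrow> letter \<Rightarrow> 'a" where
  "letter_value y a = (if snd a then y (fst a) else inv y (fst a))"

definition word_value :: "(nat \<Rightarrow> 'a) \<Rightarrow> letter list \<Rightarrow> 'a" where
  "word_value y w = foldr (\<lambda>a g. letter_value y a \<otimes> g) w \<one>"

lemma word_value_simps [simp]:
  "word_value y [] = \<one>" "word_value y (a # w) = letter_value y a \<otimes> word_value y w"
  by (simp_all add: word_value_def)

lemma word_value_closed:
  assumes "\<And>i. i < n \<Longrightarrow> y i \<in> carrier G" "\<forall>a\<in>set w. fst a < n"
  shows "word_value y w \<in> carrier G"
  using assms(2) by (induction w) (auto simp: letter_value_def assms(1))

lemma word_value_append:
  assumes "\<And>i. i < n \<Longrightarrow> y i \<in> carrier G" "\<forall>a\<in>set u. fst a < n" "\<forall>a\<in>set v. fst a < n"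
  shows "word_value y (u @ v) = word_value y u \<otimes> word_value y v"
  using assms(2)
  by (induction u)
    (auto simp: letter_value_def assms(1) word_value_closed[OF assms(1)] assms(3) m_assoc)

lemma word_value_red_cons:
  assumes y: "\<And>i. i < n \<Longrightarrow> y i \<in> carrier G" and a: "fst a < n" and w: "\<forall>a\<in>set w. fst a < n"
  shows "word_value y (red_cons a w) = letter_value y a \<otimes> word_value y w"
proof (cases w)
  case (Cons b v)
  have "word_value y v \<in> carrier G" using word_value_closed[OF y] w Cons by simp
  then have "letter_value y a \<otimes> (letter_value y (linv a) \<otimes> word_value y v) = word_value y v"
    using y[OF a] by (simp add: letter_value_def)
  then show ?thesis using Cons by (auto simp: red_cons_Cons)
qed simp

lemma word_value_reduce:
  assumes "\<And>i. i < n \<Longrightarrow> y i \<in> carrier G" "\<forall>a\<in>set w. fst a < n"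
  shows "word_value y (reduce w) = word_value y w"
  using assms(2)
proof (induction w)
  case (Cons a w)
  then have "\<forall>b\<in>set (reduce w). fst b < n" using set_reduce[of w] by auto
  then show ?case using Cons word_value_red_cons[OF assms(1)] by simp
qed simp

lemma word_value_hom:
  assumes y: "\<And>i. i < n \<Longrightarrow> y i \<in> carrier G"
  shows "word_value y \<in> hom (free_grp n) G"
proof (rule homI)
  fix u v assume "u \<in> carrier (free_grp n)" "v \<in> carrier (free_grp n)"
  then have uv: "\<forall>a\<in>set u. fst a < n" "\<forall>a\<in>set v. fst a < n"
    by (auto simp: free_grp_simps)
  then have "\<forall>a\<in>set (u @ v). fst a < n" by auto
  then show "word_value y (u \<otimes>\<^bsub>free_grp n\<^esub> v) = word_value y u \<otimes> word_value y v"
    using word_value_reduce[OF y] word_value_append[OF y uv] by (simp add: free_grp_simps(2))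
qed (use word_value_closed[OF y] in \<open>simp add: free_grp_simps\<close>)

lemma word_value_gen: "y i \<in> carrier G \<Longrightarrow> word_value y (gen i) = y i"
  by (simp add: gen_def letter_value_def)

end

section \<open>The reduced free group\<close>

abbreviation rf_kernel :: "nat \<Rightarrow> letter list set" where
  "rf_kernel n \<equiv> normal_closure (free_grp n) (rf_rel n)"

definition rf_proj :: "nat \<Rightarrow> letter list \<Rightarrow> letter list set" where
  "rf_proj n w = r_coset (free_grp n) (rf_kernel n) w"

definition rf_gen :: "nat \<Rightarrow> nat \<Rightarrow> letter list set" where
  "rf_gen n i = rf_proj n (gen i)"

lemma rf_rel_closed: "rf_rel n \<subseteq> carrier (free_grp n)"
proof -
  interpret F: group "free_grp n" by (rule free_grp_group)
  show ?thesis by (auto simp: rf_rel_def gen_closed)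
qed

lemma rf_kernel_normal: "rf_kernel n \<lhd> free_grp n"
  by (rule group.normal_closure_normal[OF free_grp_group rf_rel_closed])

lemma RF_group: "group (RF n)"
  unfolding RF_def by (rule normal.factorgroup_is_group[OF rf_kernel_normal])

lemma rf_proj_hom: "rf_proj n \<in> hom (free_grp n) (RF n)"
  unfolding RF_def using normal.r_coset_hom_Mod[OF rf_kernel_normal]
  by (simp add: rf_proj_def[abs_def])

lemma rf_proj_group_hom: "group_hom (free_grp n) (RF n) (rf_proj n)"
  by (intro group_hom.intro group_hom_axioms.intro free_grp_group RF_group rf_proj_hom)

lemma rf_proj_image: "rf_proj n ` carrier (free_grp n) = carrier (RF n)"
  by (simp add: RF_def carrier_FactGroup rf_proj_def)

lemma rf_proj_eq_one: "w \<in> rf_kernel n \<Longrightarrow> rf_proj n w = \<one>\<^bsub>RF n\<^esub>"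
  using group.coset_join2[OF free_grp_group _ normal_imp_subgroup[OF rf_kernel_normal]]
    subgroup.mem_carrier[OF normal_imp_subgroup[OF rf_kernel_normal]]
  by (simp add: rf_proj_def RF_def one_FactGroup)

lemma rf_gen_closed: "i < n \<Longrightarrow> rf_gen n i \<in> carrier (RF n)"
  unfolding rf_gen_def using hom_in_carrier[OF rf_proj_hom gen_closed] .

lemma generate_rf_gen: "generate (RF n) (rf_gen n ` {..<n}) = carrier (RF n)"
proof -
  interpret p: group_hom "free_grp n" "RF n" "rf_proj n" by (rule rf_proj_group_hom)
  have "generate (RF n) (rf_proj n ` gen ` {..<n}) =
      rf_proj n ` generate (free_grp n) (gen ` {..<n})"
    by (rule p.generate_img) (auto simp: gen_closed)
  then show ?thesis by (simp add: generate_free_grp rf_proj_image rf_gen_def image_image)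
qed

lemma rf_gen_commutes_with_conjugates:
  assumes i: "i < n"
  shows "commutes_with_conjugates (RF n) (rf_gen n i)"
  unfolding commutes_with_conjugates_def
proof
  fix g assume "g \<in> carrier (RF n)"
  then obtain w where w: "w \<in> carrier (free_grp n)" "g = rf_proj n w"
    using rf_proj_image by blast
  interpret F: group "free_grp n" by (rule free_grp_group)
  interpret p: group_hom "free_grp n" "RF n" "rf_proj n" by (rule rf_proj_group_hom)
  let ?v = "inv\<^bsub>free_grp n\<^esub> w"
  let ?r = "comm (free_grp n) (gen i) (inv\<^bsub>free_grp n\<^esub> ?v \<otimes>\<^bsub>free_grp n\<^esub> gen i \<otimes>\<^bsub>free_grp n\<^esub> ?v)"
  have "?r \<in> rf_rel n" unfolding rf_rel_def using i F.inv_closed[OF w(1)] by blast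
  then have "rf_proj n ?r = \<one>\<^bsub>RF n\<^esub>"
    by (rule rf_proj_eq_one[OF subsetD[OF F.normal_closure_incl[OF rf_rel_closed]]])
  moreover have "rf_proj n ?r =
      comm (RF n) (rf_gen n i) (g \<otimes>\<^bsub>RF n\<^esub> rf_gen n i \<otimes>\<^bsub>RF n\<^esub> inv\<^bsub>RF n\<^esub> g)"
    using F.hom_comm[OF RF_group rf_proj_hom gen_closed[OF i]] gen_closed[OF i] w
    by (simp add: rf_gen_def)
  ultimately show "comm (RF n) (rf_gen n i) (g \<otimes>\<^bsub>RF n\<^esub> rf_gen n i \<otimes>\<^bsub>RF n\<^esub> inv\<^bsub>RF n\<^esub> g) = \<one>\<^bsub>RF n\<^esub>"
    by simp
qed

lemma rf_kernel_subset_kernel: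
  assumes H: "group H" and f: "f \<in> hom (free_grp n) H"
    and rel: "\<And>i. i < n \<Longrightarrow> commutes_with_conjugates H (f (gen i))"
  shows "rf_kernel n \<subseteq> kernel (free_grp n) H f"
proof -
  interpret F: group "free_grp n" by (rule free_grp_group)
  interpret f: group_hom "free_grp n" H f
    using free_grp_group H f by (simp add: group_hom_def group_hom_axioms_def)
  show ?thesis
  proof (rule F.normal_closure_minimal[OF f.normal_kernel], rule subsetI)
    fix r assume r: "r \<in> rf_rel n"
    then obtain i w where i: "i < n" and w: "w \<in> carrier (free_grp n)"
      and r_eq: "r = comm (free_grp n) (gen i)
        (inv\<^bsub>free_grp n\<^esub> w \<otimes>\<^bsub>free_grp n\<^esub> gen i \<otimes>\<^bsub>free_grp n\<^esub> w)"
      by (auto simp: rf_rel_def)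
    have "f r = comm H (f (gen i)) (inv\<^bsub>H\<^esub> f w \<otimes>\<^bsub>H\<^esub> f (gen i) \<otimes>\<^bsub>H\<^esub> inv\<^bsub>H\<^esub> (inv\<^bsub>H\<^esub> f w))"
      unfolding r_eq using F.hom_comm[OF H f gen_closed[OF i]] gen_closed[OF i] w by simp
    also have "\<dots> = \<one>\<^bsub>H\<^esub>"
      using rel[OF i] f.H.inv_closed[OF f.hom_closed[OF w]]
      by (simp add: commutes_with_conjugates_def)
    finally show "r \<in> kernel (free_grp n) H f"
      using rf_rel_closed r by (auto simp: kernel_def)
  qed
qed

lemma RF_universal:
  assumes H: "group H" and y: "\<And>i. i < n \<Longrightarrow> y i \<in> carrier H"
    and comm: "\<And>i. i < n \<Longrightarrow> commutes_with_conjugates H (y i)"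
  shows "\<exists>h\<in>hom (RF n) H. \<forall>i<n. h (rf_gen n i) = y i"
proof -
  interpret F: group "free_grp n" by (rule free_grp_group)
  interpret H: group H by (rule H)
  define f where "f = H.word_value y"
  have f: "f \<in> hom (free_grp n) H" and f_gen: "\<And>i. i < n \<Longrightarrow> f (gen i) = y i"
    unfolding f_def by (simp_all add: H.word_value_hom H.word_value_gen y)
  interpret f: group_hom "free_grp n" H f by unfold_locales (rule f)
  have kernel: "rf_kernel n \<subseteq> kernel (free_grp n) H f"
    by (rule rf_kernel_subset_kernel[OF H f]) (simp add: f_gen comm)
  have "f u = f v" if uv: "u \<in> carrier (free_grp n)" "v \<in> carrier (free_grp n)"
      "r_coset (free_grp n) (rf_kernel n) u = r_coset (free_grp n) (rf_kernel n) v" for u v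
  proof -
    have "u \<otimes>\<^bsub>free_grp n\<^esub> inv\<^bsub>free_grp n\<^esub> v \<in> rf_kernel n"
      using F.rcos_eq_iff[OF normal_imp_subgroup[OF rf_kernel_normal] uv(1,2)] uv(3) by simp
    then have "f u \<otimes>\<^bsub>H\<^esub> inv\<^bsub>H\<^esub> f v = \<one>\<^bsub>H\<^esub>"
      using kernel uv by (auto simp: kernel_def)
    then show ?thesis using H.inv_solve_right[of "\<one>\<^bsub>H\<^esub>" "f u" "f v"] uv(1,2) by simp
  qed
  from FactGroup_universal[OF f rf_kernel_normal this]
  obtain h where h: "h \<in> hom (RF n) H" "\<And>w. w \<in> carrier (free_grp n) \<Longrightarrow> h (rf_proj n w) = f w"
    unfolding RF_def rf_proj_def by blast
  have "\<forall>i<n. h (rf_gen n i) = y i"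
    using h(2) f_gen gen_closed by (simp add: rf_gen_def)
  then show ?thesis using h(1) by blast
qed

theorem theorem3p4:
  fixes n :: nat
  assumes "n \<ge> 2"
  shows "(\<forall>j\<ge>1. johnson (RF n) j \<in> iso (AQ (RF n) j) (der_grp (RF n) j)) \<and>
         (\<forall>j\<ge>1. \<forall>k\<ge>1. \<forall>c\<in>carrier (AQ (RF n) j). \<forall>d\<in>carrier (AQ (RF n) k).
            johnson (RF n) (j + k) (aut_br (RF n) j k c d) =
            der_br (RF n) j k (johnson (RF n) j c) (johnson (RF n) k d))"
proof -
  interpret R: group "RF n" by (rule RF_group)
  have "\<exists>mu\<in>hom (RF n) magnus_units. \<forall>i<n. mu (rf_gen n i) = (1 + mvar i :: (nat, int) magnus)"
    by (rule RF_universal[OF group_units_of_mult_monoid one_plus_mvar_closed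
        one_plus_mvar_commutes_with_conjugates])
  then obtain mu :: "letter list set \<Rightarrow> (nat, int) magnus"
    where mu: "mu \<in> hom (RF n) magnus_units" "\<forall>i<n. mu (rf_gen n i) = 1 + mvar i"
    by blast
  interpret R: reduced_free_group "RF n" n "rf_gen n" mu
  proof unfold_locales
    show "\<exists>h\<in>hom (RF n) (RF n). \<forall>i<n. h (rf_gen n i) = y i"
      if "\<And>i. i < n \<Longrightarrow> y i \<in> carrier (RF n)"
        "\<And>i. i < n \<Longrightarrow> commutes_with_conjugates (RF n) (y i)" for y
      by (rule RF_universal[OF RF_group that])
  qed (use mu in \<open>simp_all add: rf_gen_closed generate_rf_gen rf_gen_commutes_with_conjugates\<close>)
  show ?thesis using R.johnson_iso R.johnson_comm by blast
qed

end
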